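(* Suppose that the Hilbert modular space $G/\Gamma$ is of rank $r = 2$. Let $g \in G$ be such that the orbit $D\pi(g)$ is locally divergent. Then $D\pi(g)$ is either closed or $$\overline{D\pi(g)} \setminus D\pi(g) = \bigcup_{i=1}^{s} D\pi(h_i),$$ where $2 \leq s \leq 4$, $h_i \in G$, and the $D\pi(h_i)$ are pairwise different, closed, non-compact orbits.
   Context: $K$ is a number field, $\mathcal{O}$ its ring of integers, $K_1,\dots,K_r$ all its archimedean completions (each is $\mathbb{R}$ or $\mathbb{C}$). $G = \prod_{i=1}^r G_i$ with $G_i = \mathrm{SL}(2,K_i)$, and $\Gamma = \mathrm{SL}(2,\mathcal{O})$ is identified with its image in $G$ under the diagonal embedding. $G/\Gamma$ is called a Hilbert modular space of rank $r$. $\pi: G \to G/\Gamma$ is the natural projection. $D_i$ is the connected component of the identity of the diagonal subgroup of $G_i$ (viewed also as a subgroup of $G$), and $D = \prod_{i=1}^r D_i$. For a closed non-compact subgroup $H$ of $G$, the orbit $Hx$ is divergent if the orbit map $h \mapsto hx$ from $H$ to $G/\Gamma$ is proper. The orbit $D\pi(g)$ is locally divergent if $D_i\pi(g)$ is divergent for every $1 \leq i \leq r$. *)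

theory Defs
  imports "HOL-Analysis.Analysis"
begin

section \<open>Number fields and their archimedean completions\<close>

definition number_field :: "'k::field_char_0 itself \<Rightarrow> bool" where
  "number_field _ \<longleftrightarrow>
     (\<exists>B :: 'k set. finite B \<and> module.span (\<lambda>q x. of_rat q * x) B = (UNIV :: 'k set))"

definition archimedean_absolute_value :: "('k::field_char_0 \<Rightarrow> real) \<Rightarrow> bool" where
  "archimedean_absolute_value v \<longleftrightarrow>
     (\<forall>x. 0 \<le> v x) \<and> (\<forall>x. v x = 0 \<longleftrightarrow> x = 0) \<and>
     (\<forall>x y. v (x * y) = v x * v y) \<and> (\<forall>x y. v (x + y) \<le> v x + v y) \<and>
     \<not> (\<forall>x y. v (x + y) \<le> max (v x) (v y))"

definition equivalent_absolute_values :: "('k \<Rightarrow> real) \<Rightarrow> ('k \<Rightarrow> real) \<Rightarrow> bool" where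
  "equivalent_absolute_values v w \<longleftrightarrow> (\<exists>s>0. \<forall>x. w x = v x powr s)"

definition field_embedding :: "('k::field_char_0 \<Rightarrow> complex) \<Rightarrow> bool" where
  "field_embedding f \<longleftrightarrow>
     f 1 = 1 \<and> (\<forall>x y. f (x + y) = f x + f y) \<and> (\<forall>x y. f (x * y) = f x * f y)"

text \<open>
  Every archimedean completion of a number field is, as a valued field, given by an embedding
  of the field into the complex numbers, the completion being the closure of the image
  (the real line or the whole complex plane). Accordingly, the family of all archimedean
  completions, each taken once, is a family of embeddings that induce every archimedean absolute
  value for exactly one index, up to equivalence. The rank is the number of indices. A complex
  place is represented by one of its two conjugate embeddings.
\<close>

definition archimedean_completions :: "('i \<Rightarrow> 'k::field_char_0 \<Rightarrow> complex) \<Rightarrow> bool" where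
  "archimedean_completions \<sigma> \<longleftrightarrow>
     (\<forall>i. field_embedding (\<sigma> i)) \<and>
     (\<forall>v. archimedean_absolute_value v \<longrightarrow>
        (\<exists>!i. equivalent_absolute_values v (\<lambda>x. cmod (\<sigma> i x))))"

definition completion :: "('k \<Rightarrow> complex) \<Rightarrow> complex set" where
  "completion f = closure (range f)"


section \<open>Hilbert modular spaces\<close>

definition SL2 :: "'a::comm_ring_1 set \<Rightarrow> ('a^2^2) set" where
  "SL2 R = {A. (\<forall>a b. A $ a $ b \<in> R) \<and> det A = 1}"

definition hilbert_group :: "('i::finite \<Rightarrow> 'k \<Rightarrow> complex) \<Rightarrow> (complex^2^2^'i) set" where
  "hilbert_group \<sigma> = {g. \<forall>i. g $ i \<in> SL2 (completion (\<sigma> i))}"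

definition gmult :: "complex^2^2^'i::finite \<Rightarrow> complex^2^2^'i \<Rightarrow> complex^2^2^'i" where
  "gmult g h = (\<chi> i. g $ i ** h $ i)"

definition diagonal_embedding ::
  "('i::finite \<Rightarrow> 'k \<Rightarrow> complex) \<Rightarrow> 'k^2^2 \<Rightarrow> complex^2^2^'i" where
  "diagonal_embedding \<sigma> A = (\<chi> i a b. \<sigma> i (A $ a $ b))"

definition hilbert_lattice ::
  "('i::finite \<Rightarrow> 'k::field_char_0 \<Rightarrow> complex) \<Rightarrow> (complex^2^2^'i) set" where
  "hilbert_lattice \<sigma> = diagonal_embedding \<sigma> ` SL2 {x. algebraic_int x}"

definition proj ::
  "('i::finite \<Rightarrow> 'k::field_char_0 \<Rightarrow> complex) \<Rightarrow> complex^2^2^'i \<Rightarrow> (complex^2^2^'i) set" where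
  "proj \<sigma> g = gmult g ` hilbert_lattice \<sigma>"

definition hilbert_modular_space ::
  "('i::finite \<Rightarrow> 'k::field_char_0 \<Rightarrow> complex) \<Rightarrow> (complex^2^2^'i) set topology" where
  "hilbert_modular_space \<sigma> = topology (\<lambda>U. U \<subseteq> proj \<sigma> ` hilbert_group \<sigma> \<and>
     openin (top_of_set (hilbert_group \<sigma>)) {g \<in> hilbert_group \<sigma>. proj \<sigma> g \<in> U})"

lemma openin_hilbert_modular_space:
  "openin (hilbert_modular_space \<sigma>) U \<longleftrightarrow> U \<subseteq> proj \<sigma> ` hilbert_group \<sigma> \<and>
     openin (top_of_set (hilbert_group \<sigma>)) {g \<in> hilbert_group \<sigma>. proj \<sigma> g \<in> U}"
proof -
  let ?G = "hilbert_group \<sigma>"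
  let ?L = "\<lambda>U. U \<subseteq> proj \<sigma> ` ?G \<and> openin (top_of_set ?G) {g \<in> ?G. proj \<sigma> g \<in> U}"
  have "istopology ?L"
    unfolding istopology_def
  proof (intro conjI allI impI)
    fix S T assume "?L S" "?L T"
    moreover have "{g \<in> ?G. proj \<sigma> g \<in> S \<inter> T} =
        {g \<in> ?G. proj \<sigma> g \<in> S} \<inter> {g \<in> ?G. proj \<sigma> g \<in> T}" by auto
    ultimately show "S \<inter> T \<subseteq> proj \<sigma> ` ?G"
      "openin (top_of_set ?G) {g \<in> ?G. proj \<sigma> g \<in> S \<inter> T}" by (auto intro: openin_Int)
  next
    fix \<K> assume K: "\<forall>K\<in>\<K>. ?L K"
    have "{g \<in> ?G. proj \<sigma> g \<in> \<Union>\<K>} = \<Union> ((\<lambda>K. {g \<in> ?G. proj \<sigma> g \<in> K}) ` \<K>)" by auto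
    with K show "\<Union>\<K> \<subseteq> proj \<sigma> ` ?G" "openin (top_of_set ?G) {g \<in> ?G. proj \<sigma> g \<in> \<Union>\<K>}"
      by (auto intro!: openin_Union)
  qed
  then show ?thesis
    unfolding hilbert_modular_space_def by simp
qed


section \<open>Orbits\<close>

definition translate :: "complex^2^2^'i::finite \<Rightarrow> (complex^2^2^'i) set \<Rightarrow> (complex^2^2^'i) set" where
  "translate h x = gmult h ` x"

definition orbit :: "(complex^2^2^'i::finite) set \<Rightarrow> (complex^2^2^'i) set \<Rightarrow> (complex^2^2^'i) set set" where
  "orbit H x = (\<lambda>h. translate h x) ` H"

text \<open>
  Divergence is only considered for closed non-compact subgroups \<open>H\<close>, and is used here for the
  factors \<open>D_factor \<sigma> i\<close>, which have these properties. As the target is Hausdorff and locally compact,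
  the library's proper maps are the continuous maps with compact preimages of compact sets
  (continuity being automatic for orbit maps).
\<close>

definition divergent_orbit ::
  "('i::finite \<Rightarrow> 'k::field_char_0 \<Rightarrow> complex) \<Rightarrow> (complex^2^2^'i) set \<Rightarrow> (complex^2^2^'i) set \<Rightarrow> bool" where
  "divergent_orbit \<sigma> H x \<longleftrightarrow>
     proper_map (top_of_set H) (hilbert_modular_space \<sigma>) (\<lambda>h. translate h x)"

definition diagonal_component :: "('k \<Rightarrow> complex) \<Rightarrow> (complex^2^2) set" where
  "diagonal_component f = connected_component_set
     {A \<in> SL2 (completion f). A $ 1 $ 2 = 0 \<and> A $ 2 $ 1 = 0} (mat 1)"

definition D_factor :: "('i::finite \<Rightarrow> 'k \<Rightarrow> complex) \<Rightarrow> 'i \<Rightarrow> (complex^2^2^'i) set" where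
  "D_factor \<sigma> i = {h. h $ i \<in> diagonal_component (\<sigma> i) \<and> (\<forall>j. j \<noteq> i \<longrightarrow> h $ j = mat 1)}"

definition D_group :: "('i::finite \<Rightarrow> 'k \<Rightarrow> complex) \<Rightarrow> (complex^2^2^'i) set" where
  "D_group \<sigma> = {h. \<forall>i. h $ i \<in> diagonal_component (\<sigma> i)}"

definition locally_divergent ::
  "('i::finite \<Rightarrow> 'k::field_char_0 \<Rightarrow> complex) \<Rightarrow> complex^2^2^'i \<Rightarrow> bool" where
  "locally_divergent \<sigma> g \<longleftrightarrow> (\<forall>i. divergent_orbit \<sigma> (D_factor \<sigma> i) (proj \<sigma> g))"

end

theory Submission
  imports Defs "HOL-Computational_Algebra.Fundamental_Theorem_Algebra"
begin

text \<open>
  Let \<open>K\<close> have the two places \<open>i\<close> and \<open>j\<close>. Two facts tie boundedness modulo the lattice to the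
  lengths of integral vectors. If a right translate of an element of \<open>G\<close> by the lattice lies in a
  bounded set, then the element makes no integral vector too short, where length is measured by a weighted
  logarithmic height that units do not change (\<open>height_of_bounded\<close>). Conversely, if two independent integral
  vectors stay bounded, then so does some translate by the lattice.

  Local divergence forces rationality. Suppose that the second row of \<open>g\<close> at \<open>i\<close> vanishes on no nonzero
  vector of \<open>K\<^sup>2\<close>, and let \<open>diag (2\<^sup>-\<^sup>k, 2\<^sup>k)\<close> act at \<open>i\<close>. For each \<open>k\<close> Minkowski's argument yields a short
  integral vector, and no line stays short forever. So for infinitely many \<open>k\<close> the short
  vectors at times \<open>k\<close> and \<open>k + 1\<close> are independent; they form an integral matrix of bounded
  determinant, there are finitely many of these modulo the lattice, and the orbit returns to a
  bounded set infinitely often (\<open>recurrent_if_irrational\<close>). Applied to both rows at both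
  places, this shows that up to the diagonal group \<open>g\<close> is given by matrices \<open>q i\<close>, \<open>q j\<close>
  in \<open>SL\<^sub>2(K)\<close> (\<open>locally_divergent_rational\<close>).

  The closure of such an orbit is found by following \<open>diag t\<close> for \<open>t\<close> tending to infinity. The
  height of the rational vectors killed by the rows of \<open>q\<close> shows that convergence modulo the lattice
  is possible only if the coordinates at the two places grow at comparable speed
  (\<open>coordinates_comparable\<close>). This leaves four directions, given by the signs of the two
  logarithms, and each has at most one limit orbit. Indeed, if both coordinates contract, let \<open>P\<close> be the
  rational matrix formed by the second rows of \<open>q i\<close> and \<open>q j\<close>. A unit \<open>\<eta>\<close> of infinite order,
  which exists because there are two places, yields lattice elements
  \<open>P\<^sup>-\<^sup>1 diag (\<eta>\<^sup>n, \<eta>\<^sup>-\<^sup>n) P\<close>, and multiplication by these compensates \<open>diag t\<close> up to a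
  bounded factor (\<open>tendsto_limit\<close>, \<open>limit_of_contracting\<close>). If the two rows are
  proportional, the direction is divergent (\<open>coincident_lower_bound\<close>). The Weyl element
  reduces the other directions to this one.

  The four directions correspond to the four entries of \<open>rel = q j (q i)\<^sup>-\<^sup>1\<close>: an entry vanishes if and only
  if its direction has no limit. Up to diagonal factors on both sides, \<open>rel\<close> depends only on the orbit.
  For a limit orbit it is monomial, antidiagonal for two of the directions and diagonal
  for the other two (\<open>rel_untwist_limit\<close>). If \<open>rel\<close> is itself monomial, the limits lie in the orbit, which is
  therefore closed (\<open>monomial_closed\<close>); so limit orbits are closed. Otherwise at
  least one diagonal and at least one antidiagonal entry is nonzero, so there are between two and four limit
  orbits, all disjoint from the given one (\<open>orbit_closure_structure\<close>).

  The arithmetic of \<open>K\<close> needed for this (discreteness of the integers, integrality of the norm, finite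
  residue rings, the unit) is obtained from the fact that every additive functional on \<open>K\<close> is a
  combination of embeddings (\<open>functional_combination_of_embeddings\<close>).
\<close>


section \<open>Algebraic integers form a ring\<close>

interpretation int_mod: module "\<lambda>(n::int) (x::'a::field_char_0). of_int n * x"
  by unfold_locales (auto simp: algebra_simps)

interpretation rat_vs: vector_space "\<lambda>(q::rat) (x::'a::field_char_0). of_rat q * x"
  by unfold_locales (auto simp: algebra_simps of_rat_add of_rat_mult)

text \<open>
  This is the Noetherian property of the integers in the form needed here. By induction on
  the generators: the coefficients of one generator in all integer combinations of the
  \<open>y i\<close> form an ideal, which is already produced by finitely many of the \<open>y i\<close>; subtracting
  suitable combinations of these removes that generator from all later terms.
\<close>
lemma int_span_sequence_dependent:
  fixes y :: "nat \<Rightarrow> 'a::field_char_0"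
  assumes "finite S" and "\<And>i. y i \<in> int_mod.span S"
  shows "\<exists>k. y k \<in> int_mod.span (y ` {..<k})"
  using assms
proof (induction S arbitrary: y rule: finite_induct)
  case empty
  then have "y 0 = 0" by simp
  then show ?case using int_mod.span_zero by metis
next
  case (insert s S)
  have "\<exists>a. y i - of_int a * s \<in> int_mod.span S" for i
    using insert.prems[of i] by (simp add: int_mod.span_breakdown_eq)
  then obtain a where a: "\<And>i. y i - of_int (a i) * s \<in> int_mod.span S" by metis
  define A where "A = {n. \<exists>k. \<exists>x\<in>int_mod.span (y ` {..<k}). x - of_int n * s \<in> int_mod.span S}"
  have A_diff: "m - q * n \<in> A" if m: "m \<in> A" and n: "n \<in> A" for m n q
  proof -
    from m obtain k x where k: "x \<in> int_mod.span (y ` {..<k})" "x - of_int m * s \<in> int_mod.span S"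
      by (auto simp: A_def)
    from n obtain l z where l: "z \<in> int_mod.span (y ` {..<l})" "z - of_int n * s \<in> int_mod.span S"
      by (auto simp: A_def)
    have "x \<in> int_mod.span (y ` {..<max k l})" "z \<in> int_mod.span (y ` {..<max k l})"
      using k(1) l(1) int_mod.span_mono[of "y ` {..<k}" "y ` {..<max k l}"]
        int_mod.span_mono[of "y ` {..<l}" "y ` {..<max k l}"] by force+
    then have 1: "x - of_int q * z \<in> int_mod.span (y ` {..<max k l})"
      by (intro int_mod.span_diff int_mod.span_scale)
    have "(x - of_int m * s) - of_int q * (z - of_int n * s) \<in> int_mod.span S"
      using int_mod.span_diff[OF k(2) int_mod.span_scale[OF l(2), of q]] by simp
    then have 2: "(x - of_int q * z) - of_int (m - q * n) * s \<in> int_mod.span S"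
      by (simp add: algebra_simps)
    show ?thesis unfolding A_def using 1 2 by blast
  qed
  have aA: "a i \<in> A" for i
    unfolding A_def using a[of i] int_mod.span_base[of "y i" "y ` {..<Suc i}"] by blast
  obtain k0 c where c: "\<And>i. y i - c i \<in> int_mod.span S" "\<And>i. c i \<in> int_mod.span (y ` {..<k0})"
  proof (cases "\<exists>n>0. n \<in> A")
    case False
    have "a i = 0" for i
    proof (rule ccontr)
      assume "a i \<noteq> 0"
      moreover have "- a i \<in> A" using A_diff[OF aA[of i] aA[of i], of 2] by simp
      ultimately show False using False aA[of i] by (metis linorder_neqE_linordered_idom neg_0_less_iff_less)
    qed
    then have "\<And>i. y i - 0 \<in> int_mod.span S" using a by (metis mult_zero_left of_int_0)
    then show ?thesis using that[of "\<lambda>_. 0" 0] int_mod.span_zero by blast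
  next
    case True
    define d where "d = int (LEAST n. n > 0 \<and> int n \<in> A)"
    from True obtain n where "n > 0" "n \<in> A" by blast
    then have ex: "nat n > 0 \<and> int (nat n) \<in> A" by simp
    then have d: "d > 0" "d \<in> A" unfolding d_def
      by (metis (mono_tags, lifting) LeastI of_nat_0_less_iff)
        (metis (mono_tags, lifting) LeastI ex)
    have min: "d \<le> n" if "n > 0" "n \<in> A" for n
    proof -
      have "(LEAST n. n > 0 \<and> int n \<in> A) \<le> nat n" using that by (intro Least_le) auto
      then show ?thesis using that d_def by linarith
    qed
    have dvd: "a i = (a i div d) * d" for i
    proof -
      have "a i mod d \<in> A" using A_diff[OF aA[of i] d(2), of "a i div d"]
        by (simp add: minus_div_mult_eq_mod)
      moreover have "0 \<le> a i mod d" "a i mod d < d" using d(1) by auto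
      ultimately have "a i mod d = 0" using min[of "a i mod d"] by linarith
      then show ?thesis by auto
    qed
    from d(2) obtain k0 x where x: "x \<in> int_mod.span (y ` {..<k0})"
      "x - of_int d * s \<in> int_mod.span S" by (auto simp: A_def)
    show ?thesis
    proof (rule that[of "\<lambda>i. of_int (a i div d) * x" k0])
      fix i
      have "(y i - of_int (a i) * s) - of_int (a i div d) * (x - of_int d * s) \<in> int_mod.span S"
        using int_mod.span_diff[OF a[of i] int_mod.span_scale[OF x(2), of "a i div d"]] by simp
      moreover have "of_int (a i) = of_int (a i div d) * (of_int d :: 'a)"
        by (metis dvd of_int_mult)
      ultimately show "y i - of_int (a i div d) * x \<in> int_mod.span S" by (simp add: algebra_simps)
      show "of_int (a i div d) * x \<in> int_mod.span (y ` {..<k0})"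
        using x(1) by (rule int_mod.span_scale)
    qed
  qed
  obtain k where k: "y (k + k0) - c (k + k0) \<in> int_mod.span ((\<lambda>i. y (i + k0) - c (i + k0)) ` {..<k})"
    using insert.IH[of "\<lambda>i. y (i + k0) - c (i + k0)"] c(1) by blast
  have mono: "int_mod.span (y ` {..<k0}) \<subseteq> int_mod.span (y ` {..<k + k0})"
    by (intro int_mod.span_mono) auto
  have "(\<lambda>i. y (i + k0) - c (i + k0)) ` {..<k} \<subseteq> int_mod.span (y ` {..<k + k0})"
  proof safe
    fix i assume "i < k"
    then have "y (i + k0) \<in> int_mod.span (y ` {..<k + k0})" by (intro int_mod.span_base) auto
    then show "y (i + k0) - c (i + k0) \<in> int_mod.span (y ` {..<k + k0})"
      using c(2) mono by (intro int_mod.span_diff) auto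
  qed
  then have "y (k + k0) - c (k + k0) \<in> int_mod.span (y ` {..<k + k0})"
    using k int_mod.span_minimal[of _ "int_mod.span (y ` {..<k + k0})"] int_mod.subspace_span by blast
  then have "y (k + k0) \<in> int_mod.span (y ` {..<k + k0})"
    using c(2)[of "k + k0"] mono int_mod.span_add[of "y (k + k0) - c (k + k0)" _ "c (k + k0)"] by auto
  then show ?case by blast
qed

lemma algebraic_int_if_power_in_span:
  fixes x :: "'a::field_char_0"
  assumes "x ^ k \<in> int_mod.span ((\<lambda>i. x ^ i) ` {..<k})"
  shows "algebraic_int x"
proof -
  have "\<exists>p :: 'a poly. (\<forall>i\<ge>k. coeff p i = 0) \<and> (\<forall>i. coeff p i \<in> \<int>) \<and> poly p x = z"
    if "z \<in> int_mod.span ((\<lambda>i. x ^ i) ` {..<k})" for z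
    using that
  proof (induction rule: int_mod.span_induct_alt)
    case base
    show ?case by (rule exI[of _ 0]) auto
  next
    case (step c w z)
    then obtain i p where i: "i < k" "w = x ^ i"
      and p: "\<forall>i\<ge>k. coeff p i = 0" "\<forall>i. coeff p i \<in> \<int>" "poly p x = z" by auto
    show ?case
      by (rule exI[of _ "monom (of_int c) i + p"]) (use i p in \<open>auto simp: poly_monom\<close>)
  qed
  from this[OF assms] obtain p :: "'a poly"
    where p: "\<forall>i\<ge>k. coeff p i = 0" "\<forall>i. coeff p i \<in> \<int>" "poly p x = x ^ k" by blast
  let ?q = "monom 1 k - p"
  have "degree ?q = k"
    by (rule antisym, rule degree_le) (use p(1) in \<open>auto intro: le_degree\<close>)
  then have "lead_coeff ?q = 1" using p(1) by simp
  moreover have "poly ?q x = 0"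
    using p(3) by (simp add: poly_monom)
  moreover have "\<forall>i. coeff ?q i \<in> \<int>" using p(2) by auto
  ultimately show ?thesis by (blast intro: algebraic_int.intros)
qed

text \<open>
  The powers of \<open>x\<close> stay in a finitely generated group, so one of them is an integral
  combination of earlier ones; this is a monic equation for \<open>x\<close>.
\<close>
lemma algebraic_int_stable_span:
  fixes x :: "'a::field_char_0"
  assumes "finite S" "1 \<in> S" and st: "\<And>s. s \<in> S \<Longrightarrow> x * s \<in> int_mod.span S"
  shows "algebraic_int x"
proof -
  have mult: "x * z \<in> int_mod.span S" if "z \<in> int_mod.span S" for z
    using that
  proof (induction rule: int_mod.span_induct_alt)
    case (step c w z)
    then show ?case using int_mod.span_add[OF int_mod.span_scale[OF st[of w], of c]]
      by (simp add: algebra_simps)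
  qed (simp add: int_mod.span_zero)
  have "x ^ i \<in> int_mod.span S" for i
    by (induction i) (auto simp: int_mod.span_base assms mult)
  from int_span_sequence_dependent[of S "\<lambda>i. x ^ i", OF assms(1) this]
  show ?thesis using algebraic_int_if_power_in_span by blast
qed

lemma algebraic_int_power_in_span:
  assumes "algebraic_int (x::'a::field_char_0)"
  obtains d where "d > 0" "x ^ d \<in> int_mod.span ((\<lambda>i. x ^ i) ` {..<d})"
proof -
  from assms obtain p where p: "lead_coeff p = 1" "\<forall>i. coeff p i \<in> \<int>" "poly p x = 0"
    by (auto elim: algebraic_int.cases)
  let ?d = "degree p"
  have d: "?d > 0"
  proof (rule ccontr)
    assume "\<not> ?d > 0"
    then obtain a where "p = [:a:]" by (metis degree_eq_zeroE gr0I)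
    then show False using p by simp
  qed
  have "0 = (\<Sum>i\<le>?d. coeff p i * x ^ i)"
    using p(3) by (simp add: poly_altdef)
  also have "\<dots> = (\<Sum>i<?d. coeff p i * x ^ i) + x ^ ?d"
    using p(1) by (simp add: lessThan_Suc_atMost[symmetric])
  finally have "x ^ ?d = - (\<Sum>i<?d. coeff p i * x ^ i)"
    by (simp add: eq_neg_iff_add_eq_0 add.commute)
  also have "\<dots> \<in> int_mod.span ((\<lambda>i. x ^ i) ` {..<?d})"
  proof (intro int_mod.span_neg int_mod.span_sum)
    fix i assume i: "i \<in> {..<?d}"
    obtain c where "coeff p i = of_int c" using p(2) by (metis Ints_cases)
    then show "coeff p i * x ^ i \<in> int_mod.span ((\<lambda>i. x ^ i) ` {..<?d})"
      using i int_mod.span_scale[OF int_mod.span_base[of "x ^ i" "(\<lambda>i. x ^ i) ` {..<?d}"], of c] by auto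
  qed
  finally show thesis using that d by blast
qed

text \<open>
  The products \<open>x\<^sup>i * y\<^sup>j\<close> with exponents below the degrees of monic equations for \<open>x\<close> and
  \<open>y\<close> span a group that is stable under multiplication by both.
\<close>
lemma algebraic_int_add_mult:
  fixes x y :: "'a::field_char_0"
  assumes "algebraic_int x" "algebraic_int y"
  shows "algebraic_int (x + y)" "algebraic_int (x * y)"
proof -
  obtain d where d: "d > 0" "x ^ d \<in> int_mod.span ((\<lambda>i. x ^ i) ` {..<d})"
    using algebraic_int_power_in_span assms(1) by blast
  obtain e where e: "e > 0" "y ^ e \<in> int_mod.span ((\<lambda>i. y ^ i) ` {..<e})"
    using algebraic_int_power_in_span assms(2) by blast
  define S where "S = (\<lambda>(i, j). x ^ i * y ^ j) ` ({..<d} \<times> {..<e})"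
  have fin: "finite S" by (simp add: S_def)
  have one: "1 \<in> S" unfolding S_def
    by (rule image_eqI[of _ _ "(0, 0)"]) (use d(1) e(1) in auto)
  have mulS: "z * w \<in> int_mod.span S"
    if "z \<in> int_mod.span T" "\<And>t. t \<in> T \<Longrightarrow> t * w \<in> int_mod.span S" for z w T
    using that(1)
  proof (induction rule: int_mod.span_induct_alt)
    case (step c t z)
    then show ?case using int_mod.span_add[OF int_mod.span_scale[OF that(2)[of t], of c]]
      by (simp add: algebra_simps)
  qed (simp add: int_mod.span_zero)
  have memS: "x ^ i * y ^ j \<in> int_mod.span S" if "i < d" "j < e" for i j
    using that by (intro int_mod.span_base) (auto simp: S_def)
  have xS: "x * s \<in> int_mod.span S" if "s \<in> S" for s
  proof -
    from that obtain i j where ij: "i < d" "j < e" "s = x ^ i * y ^ j" by (auto simp: S_def)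
    show ?thesis
    proof (cases "Suc i = d")
      case True
      have "x ^ d * y ^ j \<in> int_mod.span S"
        by (rule mulS[OF d(2)]) (use ij memS in auto)
      then show ?thesis using ij True by (auto simp: mult.assoc)
    next
      case False
      then show ?thesis using ij memS[of "Suc i" j] by (simp add: mult.assoc)
    qed
  qed
  have yS: "y * s \<in> int_mod.span S" if "s \<in> S" for s
  proof -
    from that obtain i j where ij: "i < d" "j < e" "s = x ^ i * y ^ j" by (auto simp: S_def)
    show ?thesis
    proof (cases "Suc j = e")
      case True
      have "y ^ e * x ^ i \<in> int_mod.span S"
        by (rule mulS[OF e(2)]) (use ij memS in \<open>auto simp: mult.commute\<close>)
      then show ?thesis using ij True by (auto simp: ac_simps)
    next
      case False
      then show ?thesis using ij memS[of i "Suc j"] by (simp add: ac_simps)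
    qed
  qed
  show "algebraic_int (x + y)"
    by (rule algebraic_int_stable_span[OF fin one])
      (use xS yS in \<open>auto simp: distrib_right intro: int_mod.span_add\<close>)
  have "y * s * x \<in> int_mod.span S" if "s \<in> S" for s
    by (rule mulS[OF yS[OF that]]) (use xS in \<open>auto simp: mult.commute\<close>)
  then show "algebraic_int (x * y)"
    by (intro algebraic_int_stable_span[OF fin one]) (auto simp: ac_simps)
qed

lemma algebraic_int_diff:
  "algebraic_int x \<Longrightarrow> algebraic_int y \<Longrightarrow> algebraic_int (x - y)"
  for x y :: "'a::field_char_0"
  using algebraic_int_add_mult(1)[of x "- y"] by simp

lemma algebraic_int_of_int [simp]: "algebraic_int (of_int n :: 'a::field_char_0)"
  by (rule int_imp_algebraic_int) simp

lemma algebraic_int_1 [simp]: "algebraic_int (1 :: 'a::field_char_0)"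
  using algebraic_int_of_int[of 1] by simp

lemma algebraic_int_sum:
  "(\<And>x. x \<in> A \<Longrightarrow> algebraic_int (f x)) \<Longrightarrow> algebraic_int (sum f A :: 'a::field_char_0)"
  by (induction A rule: infinite_finite_induct) (auto intro: algebraic_int_add_mult)

lemma algebraic_int_prod:
  "(\<And>x. x \<in> A \<Longrightarrow> algebraic_int (f x)) \<Longrightarrow> algebraic_int (prod f A :: 'a::field_char_0)"
  by (induction A rule: infinite_finite_induct) (auto intro: algebraic_int_add_mult)

lemma algebraic_int_power:
  "algebraic_int x \<Longrightarrow> algebraic_int (x ^ n :: 'a::field_char_0)"
  by (induction n) (auto intro: algebraic_int_add_mult)


section \<open>Embeddings of a number field into the complex numbers\<close>

lemma additive_of_rat:
  fixes \<phi> :: "'k::field_char_0 \<Rightarrow> complex"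
  assumes add: "\<And>x y. \<phi> (x + y) = \<phi> x + \<phi> y"
  shows "\<phi> (of_rat q * x) = of_rat q * \<phi> x"
proof -
  interpret additive \<phi> by unfold_locales (rule add)
  have nat: "\<phi> (of_nat n * y) = of_nat n * \<phi> y" for n y
    by (induction n) (simp_all add: zero add distrib_right)
  have int: "\<phi> (of_int n * y) = of_int n * \<phi> y" for n y
    by (cases n rule: int_cases2) (simp_all add: nat minus)
  obtain a b where q: "q = of_int a / of_int b" "b > 0"
    by (metis quotient_of_denom_pos quotient_of_div prod.exhaust_sel)
  have "of_int b * \<phi> (of_rat q * x) = \<phi> (of_int b * (of_rat q * x))" by (rule int[symmetric])
  also have "of_int b * (of_rat q * x) = of_int a * x"
    unfolding q(1) of_rat_divide using q(2) by simp
  also have "\<phi> (of_int a * x) = of_int b * (of_rat q * \<phi> x)"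
    unfolding q(1) of_rat_divide int using q(2) by simp
  finally show ?thesis using q(2) by simp
qed

lemma field_embedding_simps:
  assumes f: "field_embedding f"
  shows "f 0 = 0" "f 1 = 1" "f (x + y) = f x + f y" "f (x * y) = f x * f y"
    "f (- x) = - f x" "f (x - y) = f x - f y" "f (x ^ n) = f x ^ n" "f (sum h A) = (\<Sum>a\<in>A. f (h a))"
    "f (of_rat q) = of_rat q" "f (of_int m) = of_int m" "f x = 0 \<longleftrightarrow> x = 0"
    "f (inverse x) = inverse (f x)" "f (x / y) = f x / f y"
proof -
  have 1: "f 1 = 1" "f (x + y) = f x + f y" "f (x * y) = f x * f y" for x y
    using f by (auto simp: field_embedding_def)
  interpret additive f by unfold_locales (rule 1)
  show "f 0 = 0" "f 1 = 1" "f (x + y) = f x + f y" "f (x * y) = f x * f y"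
    "f (- x) = - f x" "f (x - y) = f x - f y" "f (sum h A) = (\<Sum>a\<in>A. f (h a))"
    by (simp_all add: zero 1 minus diff sum)
  show "f (x ^ n) = f x ^ n" by (induction n) (simp_all add: 1)
  show q: "f (of_rat q) = of_rat q" for q using additive_of_rat[of f q 1] 1 by simp
  show "f (of_int m) = of_int m" using q[of "of_int m"] by simp
  have inv: "f x * f (inverse x) = 1" if "x \<noteq> 0" for x using 1(3)[of x "inverse x"] 1(1) that by simp
  show z: "f x = 0 \<longleftrightarrow> x = 0" for x using inv[of x] zero by (cases "x = 0") auto
  show i: "f (inverse x) = inverse (f x)" for x
    using inv[of x] zero by (cases "x = 0") (auto simp: inverse_unique)
  show "f (x / y) = f x / f y" by (simp add: divide_inverse 1 i)
qed

lemma algebraic_int_field_embedding: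
  assumes "field_embedding f"
  shows "algebraic_int (f x) \<longleftrightarrow> algebraic_int x"
proof -
  have "f (poly (map_poly of_int p) x) = poly (map_poly of_int p) (f x)" for p
    by (induction p) (simp_all add: map_poly_pCons field_embedding_simps[OF assms])
  then show ?thesis
    by (metis algebraic_int_altdef_ipoly field_embedding_simps(11)[OF assms])
qed


text \<open>
  The action of complex polynomials on functionals in which the variable \<open>X\<close> sends \<open>\<phi>\<close> to
  \<open>\<lambda>x. \<phi> (b * x)\<close>.
\<close>
definition poly_act :: "('k \<Rightarrow> complex) \<Rightarrow> 'k \<Rightarrow> complex poly \<Rightarrow> 'k::field_char_0 \<Rightarrow> complex" where
  "poly_act \<phi> b r x = (\<Sum>k\<le>degree r. coeff r k * \<phi> (b ^ k * x))"

lemma poly_act_bound: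
  assumes "degree r \<le> N"
  shows "poly_act \<phi> b r x = (\<Sum>k\<le>N. coeff r k * \<phi> (b ^ k * x))"
  unfolding poly_act_def
  by (rule sum.mono_neutral_left) (use assms in \<open>auto simp: coeff_eq_0\<close>)

lemma poly_act_simps:
  "poly_act \<phi> b 0 x = 0" "poly_act \<phi> b 1 x = \<phi> x"
  "poly_act \<phi> b (smult c r) x = c * poly_act \<phi> b r x"
  "poly_act \<phi> b (r + s) x = poly_act \<phi> b r x + poly_act \<phi> b s x"
  "poly_act \<phi> b (pCons c r) x = c * \<phi> x + poly_act \<phi> b r (b * x)"
  "poly_act (\<lambda>x. 0) b r x = 0"
proof -
  show "poly_act \<phi> b 0 x = 0" "poly_act \<phi> b 1 x = \<phi> x" "poly_act (\<lambda>x. 0) b r x = 0"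
    by (simp_all add: poly_act_def)
  show "poly_act \<phi> b (smult c r) x = c * poly_act \<phi> b r x"
    by (subst (1 2) poly_act_bound[of _ "degree r"])
      (simp_all add: degree_smult_le sum_distrib_left mult.assoc)
  show "poly_act \<phi> b (r + s) x = poly_act \<phi> b r x + poly_act \<phi> b s x"
    by (subst (1 2 3) poly_act_bound[of _ "max (degree r) (degree s)"])
      (simp_all add: degree_add_le_max sum.distrib distrib_right)
  show "poly_act \<phi> b (pCons c r) x = c * \<phi> x + poly_act \<phi> b r (b * x)"
    by (subst poly_act_bound[of _ "Suc (degree r)"], simp add: degree_pCons_le,
        subst sum.atMost_Suc_shift) (simp add: poly_act_def ac_simps)
qed

lemma poly_act_mult:
  "poly_act \<phi> b (r * s) x = poly_act (poly_act \<phi> b s) b r x"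
proof (induction r arbitrary: x)
  case 0
  show ?case by (simp add: poly_act_simps)
next
  case (pCons a r)
  show ?case using pCons.IH by (simp add: poly_act_simps)
qed

lemma poly_act_diff:
  "poly_act \<phi> b (r - s) x = poly_act \<phi> b r x - poly_act \<phi> b s x"
  using poly_act_simps(4)[of \<phi> b "r - s" s x] by simp

text \<open>
  Splitting off the coprime linear factors one at a time, a functional annihilated by a polynomial with
  simple roots is a sum of eigenfunctionals. In the form used below: a set closed under sums
  that contains the eigenfunctionals contains such a functional.
\<close>
lemma poly_act_eigen_decomposition:
  assumes S0: "(\<lambda>x. 0) \<in> S" and S_add: "\<And>\<phi> \<psi>. \<phi> \<in> S \<Longrightarrow> \<psi> \<in> S \<Longrightarrow> (\<lambda>x. \<phi> x + \<psi> x) \<in> S"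
    and V: "\<And>\<phi> r. \<phi> \<in> V \<Longrightarrow> poly_act \<phi> b r \<in> V"
    and eigen: "\<And>\<phi> z. \<phi> \<in> V \<Longrightarrow> (\<And>x. \<phi> (b * x) = z * \<phi> x) \<Longrightarrow> \<phi> \<in> S"
    and "finite Z" "\<phi> \<in> V" "\<And>x. poly_act \<phi> b (\<Prod>z\<in>Z. [:-z, 1:]) x = 0"
  shows "\<phi> \<in> S"
  using assms(5-)
proof (induction Z arbitrary: \<phi> rule: finite_induct)
  case empty
  then have "\<phi> = (\<lambda>x. 0)" by (auto simp: poly_act_simps)
  then show ?case using S0 by simp
next
  case (insert z0 Z)
  define p1 where "p1 = (\<Prod>z\<in>Z. [:-z, 1:])"
  define c where "c = 1 / poly p1 z0"
  have nz: "poly p1 z0 \<noteq> 0" using insert.hyps by (auto simp: p1_def poly_prod)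
  have zero: "poly_act \<phi> b (p1 * [:-z0, 1:]) x = 0" for x
    using insert.prems(2)[of x] insert.hyps by (simp add: p1_def mult.commute)
  have zero': "poly_act \<phi> b (w * (p1 * [:-z0, 1:])) x = 0" for x w
    unfolding poly_act_mult[of \<phi> b w] zero by (simp add: poly_act_simps)
  have "poly (1 - smult c p1) z0 = 0" using nz by (simp add: c_def)
  then obtain w where w: "1 - smult c p1 = [:-z0, 1:] * w"
    unfolding poly_eq_0_iff_dvd by (auto elim: dvdE)
  define \<phi>1 where "\<phi>1 = poly_act \<phi> b (smult c p1)"
  define \<phi>2 where "\<phi>2 = poly_act \<phi> b (1 - smult c p1)"
  have "\<phi>1 \<in> S"
  proof (rule eigen[of _ z0])
    show "\<phi>1 \<in> V" unfolding \<phi>1_def by (intro V insert.prems)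
    fix x
    have "poly_act \<phi>1 b [:-z0, 1:] x = 0"
      unfolding \<phi>1_def poly_act_mult[symmetric] using zero'[of "[:c:]" x]
      by (simp add: mult.commute smult_diff_right)
    then show "\<phi>1 (b * x) = z0 * \<phi>1 x" by (simp add: poly_act_simps)
  qed
  moreover have "\<phi>2 \<in> S"
  proof (rule insert.IH)
    show "\<phi>2 \<in> V" unfolding \<phi>2_def by (intro V insert.prems)
    fix x
    show "poly_act \<phi>2 b (\<Prod>z\<in>Z. [:- z, 1:]) x = 0"
      unfolding \<phi>2_def poly_act_mult[symmetric] p1_def[symmetric] w
      using zero'[of w x] by (simp only: ac_simps)
  qed
  moreover have "\<phi> = (\<lambda>x. \<phi>1 x + \<phi>2 x)"
    by (auto simp: \<phi>1_def \<phi>2_def poly_act_diff poly_act_simps)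
  ultimately show ?case using S_add by metis
qed

abbreviation ratpoly_eval :: "rat poly \<Rightarrow> 'a::field_char_0 \<Rightarrow> 'a" where
  "ratpoly_eval p x \<equiv> poly (map_poly of_rat p) x"

lemma ratpoly_eval_simps:
  "ratpoly_eval (p + q) x = ratpoly_eval p x + ratpoly_eval q x"
  "ratpoly_eval (smult c p) x = of_rat c * ratpoly_eval p x"
  "ratpoly_eval (p - q) x = ratpoly_eval p x - ratpoly_eval q x"
  "ratpoly_eval (p * q) x = ratpoly_eval p x * ratpoly_eval q x"
proof -
  show add: "ratpoly_eval (p + q) x = ratpoly_eval p x + ratpoly_eval q x" for p q
    by (induction p q rule: poly_induct2) (simp_all add: map_poly_pCons of_rat_add algebra_simps)
  show smult: "ratpoly_eval (smult c p) x = of_rat c * ratpoly_eval p x" for c p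
    by (induction p) (simp_all add: map_poly_pCons of_rat_mult algebra_simps)
  show "ratpoly_eval (p - q) x = ratpoly_eval p x - ratpoly_eval q x"
    using add[of "p - q" q] by simp
  show "ratpoly_eval (p * q) x = ratpoly_eval p x * ratpoly_eval q x"
    by (induction p) (simp_all add: map_poly_pCons add smult algebra_simps)
qed

lemma number_field_annihilating_poly:
  assumes "number_field TYPE('k::field_char_0)"
  shows "\<exists>p. p \<noteq> 0 \<and> ratpoly_eval p (b::'k) = 0"
proof -
  obtain B :: "'k set" where B: "finite B" "rat_vs.span B = UNIV"
    using assms by (auto simp: number_field_def)
  let ?n = "card B"
  show ?thesis
  proof (cases "inj_on (\<lambda>i. b ^ i) {..?n}")
    case False
    then obtain i j where ij: "i \<noteq> j" "b ^ i = b ^ j" by (auto simp: inj_on_def)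
    have "ratpoly_eval (monom 1 i - monom 1 j) b = 0"
      using ij(2) by (simp add: ratpoly_eval_simps map_poly_monom poly_monom)
    moreover have "monom 1 i - monom 1 j \<noteq> (0 :: rat poly)" using ij(1) by (simp add: monom_eq_iff')
    ultimately show ?thesis by blast
  next
    case True
    let ?S = "(\<lambda>i. b ^ i) ` {..?n}"
    have "card ?S = ?n + 1" using True by (simp add: card_image)
    then have "rat_vs.dependent ?S"
      using rat_vs.independent_span_bound[OF B(1), of ?S] B(2) by auto
    then obtain u where u: "\<exists>v\<in>?S. u v \<noteq> 0" "(\<Sum>v\<in>?S. of_rat (u v) * v) = 0"
      by (auto simp: rat_vs.dependent_finite)
    define p where "p = (\<Sum>i\<le>?n. monom (u (b ^ i)) i)"
    have co: "coeff p i = (if i \<le> ?n then u (b ^ i) else 0)" for i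
      by (simp add: p_def coeff_sum)
    have "p \<noteq> 0" using u(1) co by (metis coeff_0 imageE atMost_iff)
    have "ratpoly_eval (\<Sum>i\<in>A. monom (u (b ^ i)) i) b = (\<Sum>i\<in>A. of_rat (u (b ^ i)) * b ^ i)"
      if "finite A" for A
      using that by (induction A) (simp_all add: ratpoly_eval_simps map_poly_monom poly_monom)
    then have "ratpoly_eval p b = (\<Sum>i\<le>?n. of_rat (u (b ^ i)) * b ^ i)"
      by (simp add: p_def)
    also have "\<dots> = (\<Sum>v\<in>?S. of_rat (u v) * v)"
      by (subst sum.reindex[OF True]) simp
    finally show ?thesis using u(2) \<open>p \<noteq> 0\<close> by auto
  qed
qed

text \<open>
  Take an annihilating rational polynomial of least degree. At a multiple complex root
  \<open>z\<close> of it, a rational polynomial of least degree vanishing at \<open>z\<close> would divide both it and its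
  derivative, and so split off a proper factor annihilating \<open>b\<close>.
\<close>
lemma number_field_simple_root_poly:
  assumes "number_field TYPE('k::field_char_0)"
  shows "\<exists>p. p \<noteq> 0 \<and> ratpoly_eval p (b::'k) = 0 \<and> rsquarefree (map_poly of_rat p :: complex poly)"
proof -
  obtain p where p: "p \<noteq> 0" "ratpoly_eval p b = 0"
    and min: "\<And>q. q \<noteq> 0 \<Longrightarrow> ratpoly_eval q b = 0 \<Longrightarrow> degree p \<le> degree q"
    using ex_has_least_nat[of "\<lambda>p. p \<noteq> 0 \<and> ratpoly_eval p b = 0" _ degree]
      number_field_annihilating_poly[OF assms, of b] by blast
  have "\<not> (ratpoly_eval p z = 0 \<and> poly (pderiv (map_poly of_rat p)) z = 0)" for z :: complex
  proof
    assume "ratpoly_eval p z = 0 \<and> poly (pderiv (map_poly of_rat p)) z = 0"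
    moreover have "pderiv (map_poly of_rat p) = (map_poly of_rat (pderiv p) :: complex poly)"
      by (rule poly_eqI) (simp add: coeff_pderiv coeff_map_poly of_rat_mult of_rat_add)
    ultimately have z: "ratpoly_eval p z = 0" "ratpoly_eval (pderiv p) z = 0" by simp_all
    obtain m where m: "m \<noteq> 0" "ratpoly_eval m z = 0"
      and min': "\<And>q. q \<noteq> 0 \<Longrightarrow> ratpoly_eval q z = 0 \<Longrightarrow> degree m \<le> degree q"
      using ex_has_least_nat[of "\<lambda>p. p \<noteq> 0 \<and> ratpoly_eval p z = 0" _ degree] p(1) z(1) by blast
    have dvd: "m dvd q" if "ratpoly_eval q z = 0" for q
    proof (rule ccontr)
      assume nd: "\<not> m dvd q"
      have "q = m * (q div m) + q mod m" by simp
      then have "ratpoly_eval q z = ratpoly_eval (m * (q div m)) z + ratpoly_eval (q mod m) z"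
        by (metis ratpoly_eval_simps(1))
      then have "ratpoly_eval (q mod m) z = 0" using that m(2) by (simp add: ratpoly_eval_simps(4))
      then show False using min'[of "q mod m"] nd m(1) degree_mod_less[of m q]
        by (auto simp: mod_eq_0_iff_dvd)
    qed
    from dvd[OF z(1)] obtain k where k: "p = m * k" by (elim dvdE)
    have "degree m \<noteq> 0"
    proof
      assume "degree m = 0"
      then obtain a where "m = [:a:]" by (rule degree_eq_zeroE)
      then show False using m by (simp add: map_poly_pCons)
    qed
    have dk: "degree p = degree m + degree k" using p(1) k by (simp add: degree_mult_eq)
    have "ratpoly_eval m b = 0 \<or> ratpoly_eval k b = 0" using p(2) k by (simp add: ratpoly_eval_simps(4))
    then show False
    proof
      assume "ratpoly_eval k b = 0"
      then show False using min[of k] dk \<open>degree m \<noteq> 0\<close> p(1) k by auto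
    next
      assume "ratpoly_eval m b = 0"
      then have "degree p \<le> degree m" using min m(1) by blast
      moreover have "degree p \<noteq> 0" using \<open>degree m \<noteq> 0\<close> dk by simp
      then have "pderiv p \<noteq> 0" by (simp add: pderiv_eq_0_iff)
      then have "degree m \<le> degree (pderiv p)" using dvd[OF z(2)] dvd_imp_degree_le by blast
      ultimately show False using \<open>degree p \<noteq> 0\<close> by (simp add: degree_pderiv)
    qed
  qed
  then show ?thesis using p by (auto simp: rsquarefree_roots)
qed


definition embeddings :: "('k::field_char_0 \<Rightarrow> complex) set" where
  "embeddings = {f. field_embedding f}"

lemma poly_act_map_poly_of_rat:
  assumes add: "\<And>x y. \<phi> (x + y) = \<phi> x + \<phi> y"
  shows "poly_act \<phi> b (map_poly of_rat p) x = \<phi> (ratpoly_eval p b * x)"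
proof -
  interpret additive \<phi> by unfold_locales (rule add)
  show ?thesis
  proof (induction p arbitrary: x)
    case (pCons a p)
    have "\<phi> (ratpoly_eval (pCons a p) b * x) = \<phi> (of_rat a * x) + \<phi> (ratpoly_eval p b * (b * x))"
      by (simp add: map_poly_pCons algebra_simps flip: add)
    then show ?case
      using pCons.IH by (simp add: map_poly_pCons poly_act_simps additive_of_rat[OF add])
  qed (simp add: poly_act_simps zero)
qed

lemma finite_embeddings:
  assumes "number_field TYPE('k::field_char_0)"
  shows "finite (embeddings :: ('k \<Rightarrow> complex) set)"
proof -
  obtain B :: "'k set" where B: "finite B" "rat_vs.span B = UNIV"
    using assms by (auto simp: number_field_def)
  from number_field_annihilating_poly[OF assms] obtain p
    where p: "\<And>b::'k. p b \<noteq> 0" "\<And>b::'k. ratpoly_eval (p b) b = 0" by metis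
  let ?P = "PiE B (\<lambda>b. {z::complex. ratpoly_eval (p b) z = 0})"
  have "finite ?P"
    using B(1) p(1) by (intro finite_PiE poly_roots_finite) (auto simp: map_poly_eq_0_iff)
  moreover have "(\<lambda>f. restrict f B) ` embeddings \<subseteq> ?P"
  proof (rule image_subsetI)
    fix f :: "'k \<Rightarrow> complex" assume "f \<in> embeddings"
    then have f: "field_embedding f" by (simp add: embeddings_def)
    have "f (ratpoly_eval q x) = ratpoly_eval q (f x)" for q x
      by (induction q) (simp_all add: map_poly_pCons field_embedding_simps[OF f])
    then have "ratpoly_eval (p b) (f b) = 0" for b
      using p(2)[of b] by (metis field_embedding_simps(1)[OF f])
    then show "restrict f B \<in> ?P" by auto
  qed
  moreover have "inj_on (\<lambda>f. restrict f B) (embeddings :: ('k \<Rightarrow> complex) set)"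
  proof (rule inj_onI)
    fix f g :: "'k \<Rightarrow> complex" assume "f \<in> embeddings" "g \<in> embeddings" and eq: "restrict f B = restrict g B"
    then have f: "field_embedding f" and g: "field_embedding g" by (simp_all add: embeddings_def)
    have "rat_vs.span B \<subseteq> {x. f x = g x}"
    proof (rule rat_vs.span_minimal)
      show "B \<subseteq> {x. f x = g x}" using eq by (auto dest: fun_cong split: if_splits simp: restrict_def)
      show "rat_vs.subspace {x. f x = g x}"
        by (rule rat_vs.subspaceI) (simp_all add: field_embedding_simps[OF f] field_embedding_simps[OF g])
    qed
    then show "f = g" using B(2) by auto
  qed
  ultimately show ?thesis using finite_subset finite_imageD by metis
qed

text \<open>
  The field acts on its functionals by commuting
  operators, each annihilated by a polynomial with simple roots, so every functional is a
  sum of joint eigenfunctionals, and a joint eigenfunctional that takes the value \<open>1\<close> at \<open>1\<close> is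
  multiplicative, hence an embedding.
\<close>
lemma functional_combination_of_embeddings:
  assumes nf: "number_field TYPE('k::field_char_0)"
    and add: "\<And>x y. \<phi> (x + y) = \<phi> x + \<phi> (y::'k)"
  shows "\<exists>c. \<forall>x. \<phi> x = (\<Sum>f\<in>embeddings. c f * f x)"
proof -
  let ?E = "embeddings :: ('k \<Rightarrow> complex) set"
  obtain B :: "'k set" where B: "finite B" "rat_vs.span B = UNIV"
    using assms by (auto simp: number_field_def)
  define S where "S = {\<phi>. \<exists>c. \<forall>x::'k. \<phi> x = (\<Sum>f\<in>embeddings. c f * f x)}"
  have S0: "(\<lambda>x. 0) \<in> S" unfolding S_def by (auto intro!: exI[of _ "\<lambda>_. 0"])
  have S_add: "(\<lambda>x. \<phi> x + \<psi> x) \<in> S" if phi: "\<phi> \<in> S" and psi: "\<psi> \<in> S" for \<phi> \<psi>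
  proof -
    obtain c where c: "\<And>x. \<phi> x = (\<Sum>f\<in>embeddings. c f * f x)" using phi by (auto simp: S_def)
    obtain d where d: "\<And>x. \<psi> x = (\<Sum>f\<in>embeddings. d f * f x)" using psi by (auto simp: S_def)
    show ?thesis unfolding S_def c d
      by (auto intro!: exI[of _ "\<lambda>f. c f + d f"] simp: distrib_right sum.distrib)
  qed
  define V where "V R = {\<phi>::'k \<Rightarrow> complex. (\<forall>x y. \<phi> (x + y) = \<phi> x + \<phi> y) \<and> (\<forall>b\<in>B - R. \<exists>z. \<forall>x. \<phi> (b * x) = z * \<phi> x)}" for R
  have V_act: "poly_act \<phi> b r \<in> V R" if V: "\<phi> \<in> V R" for \<phi> b r R
  proof -
    have "\<exists>z. \<forall>x. poly_act \<phi> b r (b' * x) = z * poly_act \<phi> b r x" if "b' \<in> B - R" for b'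
    proof -
      have "\<exists>z. \<forall>x. \<phi> (b' * x) = z * \<phi> x" using that V by (auto simp: V_def)
      then obtain z where z: "\<And>x. \<phi> (b' * x) = z * \<phi> x" by blast
      have "\<phi> (b ^ k * (b' * x)) = z * \<phi> (b ^ k * x)" for k x
        using z[of "b ^ k * x"] by (simp add: ac_simps)
      then show ?thesis by (auto intro!: exI[of _ z] simp: poly_act_def sum_distrib_left ac_simps)
    qed
    then show ?thesis using V by (auto simp: V_def poly_act_def sum.distrib distrib_left)
  qed
  have "V R \<subseteq> S" if "finite R" for R
    using that
  proof (induction R rule: finite_induct)
    case empty
    show ?case
    proof
      fix \<phi> assume "\<phi> \<in> V {}"
      then have add: "\<And>x y. \<phi> (x + y) = \<phi> x + \<phi> y"
        and eig: "\<And>b. b \<in> B \<Longrightarrow> \<exists>z. \<forall>x. \<phi> (b * x) = z * \<phi> x" by (auto simp: V_def)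
      have "rat_vs.span B \<subseteq> {a. \<exists>z. \<forall>x. \<phi> (a * x) = z * \<phi> x}"
      proof (rule rat_vs.span_minimal)
        show "rat_vs.subspace {a. \<exists>z. \<forall>x. \<phi> (a * x) = z * \<phi> x}"
        proof (rule rat_vs.subspaceI, goal_cases)
          case 1
          show ?case using additive_of_rat[of \<phi> 0, OF add] by (auto intro!: exI[of _ 0])
        next
          case (2 x y)
          then obtain u v where "\<And>t. \<phi> (x * t) = u * \<phi> t" "\<And>t. \<phi> (y * t) = v * \<phi> t" by auto
          then show ?case by (auto intro!: exI[of _ "u + v"] simp: distrib_right add)
        next
          case (3 q x)
          from 3 have "\<exists>z. \<forall>t. \<phi> (x * t) = z * \<phi> t" by simp
          then obtain u where u: "\<And>t. \<phi> (x * t) = u * \<phi> t" by blast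
          have "\<phi> (of_rat q * x * t) = (of_rat q * u) * \<phi> t" for t
            using additive_of_rat[of \<phi> q "x * t", OF add] by (simp only: mult.assoc u)
          then have "\<exists>z. \<forall>t. \<phi> (of_rat q * x * t) = z * \<phi> t" by (intro exI allI)
          then show ?case by (rule CollectI)
        qed
      qed (use eig in auto)
      then have "\<exists>z. \<forall>x. \<phi> (a * x) = z * \<phi> x" for a using B(2) by auto
      then obtain z where z: "\<And>a x. \<phi> (a * x) = z a * \<phi> x" by metis
      have z1: "\<phi> a = z a * \<phi> 1" for a using z[of a 1] by simp
      show "\<phi> \<in> S"
      proof (cases "\<phi> 1 = 0")
        case True
        then have "\<phi> a = 0" for a using z1[of a] by simp
        then have "\<phi> = (\<lambda>x. 0)" by (rule ext)
        then show ?thesis using S0 by simp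
      next
        case False
        have "z 1 = 1" using z1[of 1] False by simp
        moreover have "z (x + y) = z x + z y" for x y
          using z1[of "x + y"] z1[of x] z1[of y] add[of x y] False by (simp flip: distrib_right)
        moreover have "z (x * y) = z x * z y" for x y
          using z1[of "x * y"] z[of x y] z1[of y] False by simp
        ultimately have "z \<in> ?E" by (simp add: embeddings_def field_embedding_def)
        then have "\<phi> x = (\<Sum>f\<in>embeddings. (if f = z then \<phi> 1 else 0) * f x)" for x
          using z1[of x] finite_embeddings[OF nf] by (simp add: if_distrib[of "\<lambda>u. u * _"] sum.delta cong: if_cong)
        then show ?thesis unfolding S_def
          by (intro CollectI exI[of _ "\<lambda>f. if f = z then \<phi> 1 else 0"] allI)
      qed
    qed
  next
    case (insert b R)
    show ?case
    proof
      fix \<phi> assume phi: "\<phi> \<in> V (insert b R)"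
      obtain p where p: "p \<noteq> 0" "ratpoly_eval p b = 0" "rsquarefree (map_poly of_rat p :: complex poly)"
        using number_field_simple_root_poly[OF nf] by blast
      let ?q = "map_poly of_rat p :: complex poly"
      have q: "?q \<noteq> 0" using p(1) by (simp add: map_poly_eq_0_iff)
      show "\<phi> \<in> S"
      proof (rule poly_act_eigen_decomposition[of S "V (insert b R)" b "{z. poly ?q z = 0}"])
        show "\<psi> \<in> S" if \<psi>: "\<psi> \<in> V (insert b R)" and eig: "\<And>x. \<psi> (b * x) = z * \<psi> x" for \<psi> z
        proof -
          have "\<exists>z. \<forall>x. \<psi> (b' * x) = z * \<psi> x" if b': "b' \<in> B - R" for b'
          proof (cases "b' = b")
            case True
            then show ?thesis using eig by (intro exI[of _ z]) simp
          next
            case False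
            then show ?thesis using b' \<psi> by (simp add: V_def)
          qed
          then have "\<psi> \<in> V R" using \<psi> by (simp add: V_def)
          then show ?thesis using insert.IH by blast
        qed
        show "finite {z. poly ?q z = 0}" using q by (rule poly_roots_finite)
        fix x
        have "0 = poly_act \<phi> b ?q x"
          by (subst poly_act_map_poly_of_rat) (use phi p(2) additive_of_rat[of \<phi> 0 0] in \<open>auto simp: V_def\<close>)
        also have "?q = smult (lead_coeff ?q) (\<Prod>z|poly ?q z = 0. [:-z, 1:])"
          using complex_poly_decompose_rsquarefree[OF p(3)] by simp
        finally show "poly_act \<phi> b (\<Prod>z|poly ?q z = 0. [:-z, 1:]) x = 0"
          using q by (simp add: poly_act_simps)
      qed (use S0 S_add V_act phi in auto)
    qed
  qed
  from this[OF B(1)] have "\<phi> \<in> S" using add by (auto simp: V_def)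
  then show ?thesis by (simp add: S_def)
qed

text \<open>
  Dedekind's independence of characters: comparing a relation at \<open>y * x\<close> with \<open>g y\<close> times the
  relation at \<open>x\<close> eliminates \<open>g\<close>.
\<close>
lemma embeddings_independent:
  assumes "finite F" "F \<subseteq> embeddings" "\<And>x. (\<Sum>f\<in>F. c f * f x) = 0" "f \<in> F"
  shows "c f = 0"
  using assms
proof (induction F arbitrary: c f rule: finite_induct)
  case empty
  then show ?case by simp
next
  case (insert g F)
  have g: "field_embedding g" using insert.prems by (auto simp: embeddings_def)
  have F: "c h = 0" if h: "h \<in> F" for h
  proof -
    have "h \<noteq> g" using h insert.hyps by auto
    then obtain y where y: "h y \<noteq> g y" by auto
    have "(\<Sum>f\<in>F. (c f * (f y - g y)) * f x) = 0" for x
    proof -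
      have emb: "f (y * x) = f y * f x" if "f \<in> F" for f
        using insert.prems(1) that by (auto simp: embeddings_def field_embedding_def)
      have "(\<Sum>f\<in>F. (c f * (f y - g y)) * f x) = (\<Sum>f\<in>F. c f * f (y * x) - g y * (c f * f x))"
        by (rule sum.cong) (simp_all only: emb, simp add: algebra_simps)
      also have "\<dots> = (\<Sum>f\<in>F. c f * f (y * x)) - g y * (\<Sum>f\<in>F. c f * f x)"
        by (simp add: sum_subtractf sum_distrib_left)
      also have "(\<Sum>f\<in>F. c f * f (y * x)) = - (c g * g (y * x))"
        using insert.prems(2)[of "y * x"] insert.hyps by (simp add: eq_neg_iff_add_eq_0 add.commute)
      also have "(\<Sum>f\<in>F. c f * f x) = - (c g * g x)"
        using insert.prems(2)[of x] insert.hyps by (simp add: eq_neg_iff_add_eq_0 add.commute)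
      finally show ?thesis by (simp add: field_embedding_simps[OF g])
    qed
    from insert.IH[of "\<lambda>f. c f * (f y - g y)", OF _ this h] insert.prems(1) y show ?thesis by simp
  qed
  moreover have "c g = 0"
    using insert.prems(2)[of 1] insert.hyps F by (simp add: field_embedding_simps[OF g])
  ultimately show ?case using insert.prems by auto
qed

text \<open>
  If \<open>b\<close> is a root of an integral polynomial of degree \<open>n\<close> with leading coefficient \<open>a\<close>,
  then multiplication of the equation by \<open>a\<^sup>n\<^sup>-\<^sup>1\<close> makes it a monic integral equation for \<open>a * b\<close>.
\<close>
lemma algebraic_int_scale:
  fixes b :: "'k::field_char_0"
  assumes "number_field TYPE('k)"
  shows "\<exists>n::int. n > 0 \<and> algebraic_int (of_int n * b)"
proof -
  obtain p :: "rat poly" where p: "p \<noteq> 0" "ratpoly_eval p b = 0"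
    using number_field_annihilating_poly[OF assms] by blast
  have "algebraic b"
    unfolding algebraic_altdef
    by (rule exI[of _ "map_poly of_rat p"]) (use p in \<open>auto simp: coeff_map_poly map_poly_eq_0_iff\<close>)
  then obtain p where p: "\<And>i. coeff p i \<in> \<int>" "p \<noteq> 0" "poly p b = 0"
    unfolding algebraic_def by blast
  let ?n = "degree p" and ?a = "lead_coeff p"
  have n: "?n > 0"
  proof (rule ccontr)
    assume "\<not> ?n > 0"
    then obtain a where "p = [:a:]" by (metis degree_eq_zeroE gr0I)
    then show False using p by simp
  qed
  define q where "q = monom 1 ?n + (\<Sum>i<?n. monom (coeff p i * ?a ^ (?n - 1 - i)) i)"
  have co: "coeff q i = (if i = ?n then 1 else if i < ?n then coeff p i * ?a ^ (?n - 1 - i) else 0)" for i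
    by (auto simp: q_def coeff_sum)
  have "degree q = ?n"
    by (rule antisym, rule degree_le) (auto simp: co intro: le_degree)
  then have "lead_coeff q = 1" by (simp add: co)
  moreover have "\<forall>i. coeff q i \<in> \<int>" using p(1) by (auto simp: co)
  moreover have "poly q (?a * b) = 0"
  proof -
    have *: "?a ^ (?n - 1 - i) * ?a ^ i = ?a ^ (?n - 1)" if "i < ?n" for i
      using that by (simp flip: power_add)
    have "poly q (?a * b) = ?a ^ ?n * b ^ ?n + (\<Sum>i<?n. coeff p i * (?a ^ (?n - 1 - i) * ?a ^ i) * b ^ i)"
      by (simp add: q_def poly_monom poly_sum power_mult_distrib ac_simps)
    also have "\<dots> = ?a ^ (?n - 1) * ?a * b ^ ?n + (\<Sum>i<?n. ?a ^ (?n - 1) * (coeff p i * b ^ i))"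
      using * power_minus_mult[OF n, of ?a] by (simp add: ac_simps)
    also have "\<dots> = ?a ^ (?n - 1) * (\<Sum>i\<le>?n. coeff p i * b ^ i)"
      by (simp add: lessThan_Suc_atMost[symmetric] distrib_left sum_distrib_left ac_simps)
    also have "\<dots> = 0" using p(3) by (simp add: poly_altdef)
    finally show ?thesis .
  qed
  ultimately have alg: "algebraic_int (?a * b)" by (blast intro: algebraic_int.intros)
  obtain m where m: "?a = of_int m" using p(1) by (metis Ints_cases)
  have "m \<noteq> 0" using p(2) m by auto
  moreover have "algebraic_int (of_int (-m) * b)" using alg m by (metis algebraic_int_minus_iff mult_minus_left of_int_minus)
  ultimately show ?thesis using alg m by (metis linorder_neqE_linordered_idom neg_0_less_iff_less)
qed

definition integral_basis :: "'k::field_char_0 set \<Rightarrow> bool" where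
  "integral_basis B \<longleftrightarrow> finite B \<and> rat_vs.independent B \<and> rat_vs.span B = UNIV \<and> (\<forall>b\<in>B. algebraic_int b)"

lemma integral_basis_exists:
  assumes nf: "number_field TYPE('k::field_char_0)"
  shows "\<exists>B :: 'k set. integral_basis B"
proof -
  obtain B :: "'k set" where B: "finite B" "rat_vs.span B = UNIV"
    using assms by (auto simp: number_field_def)
  obtain n where n: "\<And>b::'k. n b > (0::int)" "\<And>b::'k. algebraic_int (of_int (n b) * b)"
    using algebraic_int_scale[OF nf] by metis
  let ?B = "(\<lambda>b. of_int (n b) * b) ` B"
  obtain C where C: "C \<subseteq> ?B" "rat_vs.independent C" "?B \<subseteq> rat_vs.span C"
    using rat_vs.maximal_independent_subset[of ?B] by blast
  have "B \<subseteq> rat_vs.span C"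
  proof
    fix b assume "b \<in> B"
    then have "of_int (n b) * b \<in> rat_vs.span C" using C(3) by auto
    from rat_vs.span_scale[OF this, of "1 / of_int (n b)"] n(1)[of b]
    show "b \<in> rat_vs.span C" by (simp add: of_rat_divide)
  qed
  then have "rat_vs.span C = UNIV"
    using B(2) rat_vs.span_minimal[of B "rat_vs.span C"] rat_vs.subspace_span by auto
  then show ?thesis
    using C n(2) B(1) finite_subset[OF C(1)] unfolding integral_basis_def by blast
qed

text \<open>
  Writing the coordinate functionals as combinations of embeddings inverts the matrix of the values of the
  embeddings on the basis. So the sum over all embeddings is the trace of multiplication by \<open>\<alpha>\<close>,
  computed in two bases of the space of functionals.
\<close>
lemma trace_formula:
  assumes nf: "number_field TYPE('k::field_char_0)" and B: "integral_basis (B::'k set)"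
  shows "(\<Sum>f\<in>embeddings. f \<alpha>) = (\<Sum>b\<in>B. of_rat (rat_vs.representation B (\<alpha> * b) b))"
proof -
  let ?r = "rat_vs.representation B"
  have B': "finite B" "rat_vs.independent B" "rat_vs.span B = UNIV"
    using B by (auto simp: integral_basis_def)
  have "\<exists>c. \<forall>x. of_rat (?r x b) = (\<Sum>f\<in>embeddings. c f * f x)" for b
    by (rule functional_combination_of_embeddings[OF nf])
      (simp add: rat_vs.representation_add[OF B'(2)] B'(3) of_rat_add)
  then obtain U where U: "\<And>b x. of_rat (?r x b) = (\<Sum>f\<in>embeddings. U b f * f x)" by metis
  have fx: "f x = (\<Sum>b\<in>B. of_rat (?r x b) * f b)" if "field_embedding f" for f x
  proof -
    have "x = (\<Sum>b\<in>B. of_rat (?r x b) * b)"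
      using rat_vs.sum_representation_eq[OF B'(2) _ B'(1) order.refl, of x] B'(3) by simp
    then have "f x = f (\<Sum>b\<in>B. of_rat (?r x b) * b)" by simp
    then show ?thesis by (simp add: field_embedding_simps[OF that])
  qed
  have dual: "(\<Sum>b\<in>B. U b f * f b) = 1" if f: "f \<in> embeddings" for f
  proof -
    have ff: "field_embedding f" using f by (simp add: embeddings_def)
    have "(\<Sum>g\<in>embeddings. ((\<Sum>b\<in>B. U b g * f b) - (if g = f then 1 else 0)) * g x) = 0" for x
    proof -
      have "(\<Sum>g\<in>embeddings. (\<Sum>b\<in>B. U b g * f b) * g x) = (\<Sum>g\<in>embeddings. \<Sum>b\<in>B. U b g * g x * f b)"
        by (simp add: sum_distrib_left sum_distrib_right ac_simps)
      also have "\<dots> = (\<Sum>b\<in>B. \<Sum>g\<in>embeddings. U b g * g x * f b)" by (rule sum.swap)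
      also have "\<dots> = f x" by (subst fx[OF ff]) (simp add: U sum_distrib_right)
      finally have "(\<Sum>g\<in>embeddings. (\<Sum>b\<in>B. U b g * f b) * g x) = f x" .
      moreover have "(\<Sum>g\<in>embeddings. (if g = f then 1 else 0) * g x) = f x"
        using f finite_embeddings[OF nf] by (simp add: if_distrib[of "\<lambda>u. u * _"] sum.delta cong: if_cong)
      ultimately show ?thesis by (simp add: left_diff_distrib sum_subtractf)
    qed
    from embeddings_independent[OF finite_embeddings[OF nf] order.refl this f] show ?thesis by simp
  qed
  have "(\<Sum>f\<in>embeddings. f \<alpha>) = (\<Sum>f\<in>embeddings. f \<alpha> * (\<Sum>b\<in>B. U b f * f b))"
    by (rule sum.cong) (simp_all add: dual)
  also have "\<dots> = (\<Sum>f\<in>embeddings. \<Sum>b\<in>B. U b f * f (\<alpha> * b))"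
    by (rule sum.cong) (auto simp: sum_distrib_left embeddings_def field_embedding_simps ac_simps)
  also have "\<dots> = (\<Sum>b\<in>B. \<Sum>f\<in>embeddings. U b f * f (\<alpha> * b))" by (rule sum.swap)
  finally show ?thesis by (simp add: U)
qed

text \<open>
  This is the trace formula at \<open>\<alpha> = 1\<close>.
\<close>
lemma card_embeddings:
  assumes nf: "number_field TYPE('k::field_char_0)" and B: "integral_basis (B::'k set)"
  shows "card (embeddings :: ('k \<Rightarrow> complex) set) = card B"
proof -
  have B': "finite B" "rat_vs.independent B" "rat_vs.span B = UNIV"
    using B by (auto simp: integral_basis_def)
  have "of_nat (card (embeddings :: ('k \<Rightarrow> complex) set)) = (\<Sum>f\<in>embeddings. (f (1::'k)) :: complex)"
    by (simp add: embeddings_def field_embedding_simps)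
  also have "\<dots> = (\<Sum>b\<in>B. 1)"
    unfolding trace_formula[OF nf B]
    by (rule sum.cong) (simp_all add: rat_vs.representation_basis[OF B'(2)])
  finally have "complex_of_nat (card (embeddings :: ('k \<Rightarrow> complex) set)) = of_nat (card B)" by simp
  then show ?thesis by (simp only: of_nat_eq_iff)
qed

lemma trace_rational:
  assumes nf: "number_field TYPE('k::field_char_0)"
  shows "(\<Sum>f\<in>embeddings. f (\<alpha>::'k)) \<in> \<rat>"
proof -
  obtain B :: "'k set" where B: "integral_basis B" using integral_basis_exists[OF nf] by blast
  show ?thesis unfolding trace_formula[OF nf B] by (intro Rats_sum) auto
qed

lemma trace_integer:
  assumes nf: "number_field TYPE('k::field_char_0)" and "algebraic_int \<alpha>"
  shows "(\<Sum>f\<in>embeddings. f (\<alpha>::'k)) \<in> \<int>"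
  by (rule rational_algebraic_int_is_int[OF algebraic_int_sum trace_rational[OF nf]])
    (use assms in \<open>auto simp: embeddings_def algebraic_int_field_embedding\<close>)


section \<open>Discreteness, norms and residue classes\<close>

lemma embeddings_nonempty:
  assumes nf: "number_field TYPE('k::field_char_0)"
  shows "(embeddings :: ('k \<Rightarrow> complex) set) \<noteq> {}"
proof
  assume empty: "(embeddings :: ('k \<Rightarrow> complex) set) = {}"
  obtain B :: "'k set" where B: "integral_basis B" using integral_basis_exists[OF nf] by blast
  have "B = {}" using empty card_embeddings[OF nf B] B by (simp add: integral_basis_def)
  then have "(1::'k) \<in> rat_vs.span {}" using B by (simp add: integral_basis_def)
  then show False by simp
qed

text \<open>
  An algebraic integer \<open>\<alpha>\<close> is determined by the traces of \<open>\<alpha> * b\<close> for \<open>b\<close> in a basis,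
  and these are rational integers that are bounded in terms of the conjugates of \<open>\<alpha>\<close>.
\<close>
lemma finite_algebraic_int_bounded:
  assumes nf: "number_field TYPE('k::field_char_0)"
  shows "finite {\<alpha>::'k. algebraic_int \<alpha> \<and> (\<forall>f\<in>embeddings. cmod (f \<alpha>) \<le> C)}" (is "finite ?A")
proof -
  let ?E = "embeddings :: ('k \<Rightarrow> complex) set"
  let ?T = "\<lambda>\<alpha>::'k. \<Sum>f\<in>embeddings. f \<alpha>"
  obtain B :: "'k set" where B: "integral_basis B" using integral_basis_exists[OF nf] by blast
  then have B': "finite B" "rat_vs.span B = UNIV" "\<And>b. b \<in> B \<Longrightarrow> algebraic_int b" by (auto simp: integral_basis_def)
  define M where "M b = (\<Sum>f\<in>?E. C * cmod (f b))" for b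
  let ?P = "PiE B (\<lambda>b. of_int ` {-\<lceil>M b\<rceil>..\<lceil>M b\<rceil>} :: complex set)"
  have finP: "finite ?P" using B'(1) by (intro finite_PiE) auto
  have sub: "(\<lambda>\<alpha>. \<lambda>b\<in>B. ?T (\<alpha> * b)) ` ?A \<subseteq> ?P"
  proof (intro image_subsetI restrict_PiE_iff[THEN iffD2] ballI)
    fix \<alpha> b :: 'k assume "\<alpha> \<in> ?A" and b: "b \<in> B"
    then have a: "algebraic_int \<alpha>" "\<forall>f\<in>embeddings. cmod (f \<alpha>) \<le> C" by auto
    have "?T (\<alpha> * b) \<in> \<int>"
      by (intro trace_integer[OF nf] algebraic_int_add_mult a B'(3) b)
    then obtain m where m: "?T (\<alpha> * b) = of_int m" by (elim Ints_cases)
    have "cmod (?T (\<alpha> * b)) \<le> M b" unfolding M_def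
      using a(2) by (intro sum_norm_le) (auto simp: embeddings_def field_embedding_simps norm_mult intro!: mult_right_mono)
    then have "\<bar>real_of_int m\<bar> \<le> M b" by (simp add: m)
    then have "m \<in> {-\<lceil>M b\<rceil>..\<lceil>M b\<rceil>}" by (auto simp: le_ceiling_iff) linarith+
    then show "?T (\<alpha> * b) \<in> of_int ` {-\<lceil>M b\<rceil>..\<lceil>M b\<rceil>}" using m by auto
  qed
  have inj: "inj_on (\<lambda>\<alpha>. \<lambda>b\<in>B. ?T (\<alpha> * b)) ?A"
  proof (rule inj_onI)
    fix x y :: 'k assume eq: "(\<lambda>b\<in>B. ?T (x * b)) = (\<lambda>b\<in>B. ?T (y * b))"
    have "rat_vs.span B \<subseteq> {b. ?T (x * b) = ?T (y * b)}"
    proof (rule rat_vs.span_minimal)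
      show "B \<subseteq> {b. ?T (x * b) = ?T (y * b)}"
        using eq by (auto dest: fun_cong simp: restrict_def split: if_splits)
      have hom: "?T (z * (a + b)) = ?T (z * a) + ?T (z * b)" "?T (z * (of_rat q * b)) = of_rat q * ?T (z * b)"
        "?T (z * 0) = 0" for z a b q
        by (simp_all add: embeddings_def field_embedding_simps distrib_left sum.distrib sum_distrib_left ac_simps)
      show "rat_vs.subspace {b. ?T (x * b) = ?T (y * b)}"
        by (rule rat_vs.subspaceI) (simp_all only: mem_Collect_eq hom)
    qed
    then have T: "?T (x * z) = ?T (y * z)" for z using B'(2) by auto
    show "x = y"
    proof (rule ccontr)
      assume "x \<noteq> y"
      have "?T ((x - y) * (1 / (x - y))) = ?T (x * (1 / (x - y))) - ?T (y * (1 / (x - y)))"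
        unfolding left_diff_distrib by (simp add: embeddings_def field_embedding_simps sum_subtractf)
      then have "?T 1 = 0" using T[of "1 / (x - y)"] \<open>x \<noteq> y\<close> by simp
      moreover have "?T 1 = of_nat (card ?E)" by (simp add: embeddings_def field_embedding_simps)
      ultimately show False using embeddings_nonempty[OF nf] finite_embeddings[OF nf] by simp
    qed
  qed
  show ?thesis by (rule finite_imageD[OF finite_subset[OF sub finP] inj])
qed

text \<open>
  Newton's identities, in the form that \<open>\<Prod>(1 - a X)\<close> has logarithmic derivative
  \<open>- \<Sum> p\<^sub>k\<^sub>+\<^sub>1 X\<^sup>k\<close> for the power sums \<open>p\<^sub>k\<close>.
\<close>
lemma prod_rational_if_power_sums_rational:
  fixes a :: "'b \<Rightarrow> complex"
  assumes fin: "finite E" and pow: "\<And>k. (\<Sum>f\<in>E. a f ^ Suc k) \<in> \<rat>"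
  shows "(\<Prod>f\<in>E. a f) \<in> \<rat>"
proof -
  define P where "P F = (\<Prod>f\<in>F. 1 - fps_const (a f) * fps_X)" for F
  define S where "S F = Abs_fps (\<lambda>k. \<Sum>f\<in>F. a f ^ Suc k)" for F
  have geo: "(1 - fps_const x * fps_X) * Abs_fps (\<lambda>k. x ^ Suc k) = fps_const x" for x :: complex
  proof (rule fps_ext)
    fix n show "fps_nth ((1 - fps_const x * fps_X) * Abs_fps (\<lambda>k. x ^ Suc k)) n = fps_nth (fps_const x) n"
      by (cases n) (simp_all add: left_diff_distrib mult.assoc)
  qed
  have deriv: "fps_deriv (P F) = - P F * S F" if "finite F" for F
    using that
  proof (induction F)
    case empty
    show ?case by (simp add: P_def S_def fps_eq_iff)
  next
    case (insert f F)
    have S: "S (insert f F) = Abs_fps (\<lambda>k. a f ^ Suc k) + S F"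
      using insert.hyps by (simp add: S_def fps_eq_iff)
    have P: "P (insert f F) = (1 - fps_const (a f) * fps_X) * P F"
      using insert.hyps by (simp add: P_def)
    have "fps_deriv (P (insert f F)) = - (fps_const (a f) * P F) + (1 - fps_const (a f) * fps_X) * (- P F * S F)"
      unfolding P by (simp add: insert.IH algebra_simps flip: fps_const_neg)
    also have "fps_const (a f) * P F = P (insert f F) * Abs_fps (\<lambda>k. a f ^ Suc k)"
      unfolding P using geo[of "a f"] by (metis mult.assoc mult.commute)
    also have "(1 - fps_const (a f) * fps_X) * (- P F * S F) = - (P (insert f F) * S F)"
      by (simp add: P mult.assoc)
    also have "- (P (insert f F) * Abs_fps (\<lambda>k. a f ^ Suc k)) + - (P (insert f F) * S F)
        = - P (insert f F) * S (insert f F)"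
      unfolding S by (simp add: distrib_left)
    finally show ?case .
  qed
  have coeff: "fps_nth (P E) n \<in> \<rat>" for n
  proof (induction n rule: less_induct)
    case (less n)
    show ?case
    proof (cases n)
      case 0
      have "fps_nth (P F) 0 = 1" if "finite F" for F
        using that by (induction F) (auto simp: P_def)
      then show ?thesis using 0 fin by simp
    next
      case (Suc m)
      have "of_nat (Suc m) * fps_nth (P E) (Suc m) = - (\<Sum>i=0..m. fps_nth (P E) i * (\<Sum>f\<in>E. a f ^ Suc (m - i)))"
        using arg_cong[OF deriv[OF fin], of "\<lambda>Q. fps_nth Q m"]
        by (simp add: fps_mult_nth S_def sum_negf)
      also have "\<dots> \<in> \<rat>"
        using less Suc by (intro Rats_minus_iff[THEN iffD2] Rats_sum Rats_mult pow) auto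
      finally have "of_nat (Suc m) * fps_nth (P E) (Suc m) / of_nat (Suc m) \<in> \<rat>"
        by (intro Rats_divide) auto
      then show ?thesis using Suc by (simp del: of_nat_Suc)
    qed
  qed
  have top: "fps_nth (P F) (card F) = (\<Prod>f\<in>F. - a f) \<and> (\<forall>n>card F. fps_nth (P F) n = 0)"
    if "finite F" for F
    using that
  proof (induction F)
    case empty
    show ?case by (simp add: P_def)
  next
    case (insert f F)
    have "P (insert f F) = P F - fps_const (a f) * (fps_X * P F)"
      using insert.hyps by (simp add: P_def algebra_simps)
    then have "fps_nth (P (insert f F)) (Suc n) = fps_nth (P F) (Suc n) - a f * fps_nth (P F) n" for n
      by simp
    then show ?case using insert by (auto simp: gr0_conv_Suc less_Suc_eq_le Suc_less_eq2)
  qed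
  have "(\<Prod>f\<in>E. a f) = (- 1) ^ card E * (\<Prod>f\<in>E. - a f)"
    by (simp add: prod_uminus flip: power_add mult.assoc)
  also have "\<dots> \<in> \<rat>" using coeff[of "card E"] top[OF fin] by (intro Rats_mult) auto
  finally show ?thesis .
qed

text \<open>
  The norm is rational by Newton's identities. Every embedding maps the cofactor \<open>m / \<alpha>\<close> to a product of conjugates
  of \<open>\<alpha>\<close>, so it is an algebraic integer.
\<close>
lemma norm_integer:
  assumes nf: "number_field TYPE('k::field_char_0)" and \<alpha>: "algebraic_int (\<alpha>::'k)" "\<alpha> \<noteq> 0"
  shows "\<exists>m::int. m \<noteq> 0 \<and> of_int m = (\<Prod>f\<in>embeddings. f \<alpha>) \<and> algebraic_int (of_int m / \<alpha>)"
proof -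
  let ?E = "embeddings :: ('k \<Rightarrow> complex) set"
  let ?N = "\<Prod>f\<in>?E. f \<alpha>"
  have "(\<Sum>f\<in>?E. f \<alpha> ^ Suc k) = (\<Sum>f\<in>?E. f (\<alpha> ^ Suc k))" for k
    by (rule sum.cong) (auto simp: embeddings_def field_embedding_simps)
  then have "?N \<in> \<rat>"
    using trace_rational[OF nf]
    by (intro prod_rational_if_power_sums_rational finite_embeddings nf) metis
  moreover have "algebraic_int ?N"
    by (intro algebraic_int_prod) (auto simp: embeddings_def algebraic_int_field_embedding \<alpha>)
  ultimately have "?N \<in> \<int>" by (intro rational_algebraic_int_is_int)
  then obtain m where m: "?N = of_int m" by (elim Ints_cases)
  have nz: "f \<alpha> \<noteq> 0" if "f \<in> ?E" for f using that \<alpha>(2) by (auto simp: embeddings_def field_embedding_simps)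
  have "?N \<noteq> 0" using nz finite_embeddings[OF nf] by simp
  then have "m \<noteq> 0" using m by auto
  obtain f where f: "f \<in> ?E" using embeddings_nonempty[OF nf] by blast
  then have fe: "field_embedding f" by (simp add: embeddings_def)
  have "f (of_int m / \<alpha>) = ?N / f \<alpha>" by (simp add: field_embedding_simps[OF fe] m)
  also have "\<dots> = (\<Prod>g\<in>?E - {f}. g \<alpha>)"
    using nz[OF f] finite_embeddings[OF nf] f by (simp add: prod.remove)
  also have "algebraic_int \<dots>"
    by (intro algebraic_int_prod) (auto simp: embeddings_def algebraic_int_field_embedding \<alpha>)
  finally have "algebraic_int (of_int m / \<alpha>)" by (simp add: algebraic_int_field_embedding[OF fe])
  then show ?thesis using \<open>m \<noteq> 0\<close> m by auto
qed

lemma complex_of_rat_eq_of_real: "(of_rat q :: complex) = of_real (of_rat q)"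
proof -
  obtain a b where "q = of_int a / of_int b"
    by (metis quotient_of_div prod.exhaust_sel)
  then show ?thesis by (simp add: of_rat_divide)
qed

text \<open>
  Let \<open>m\<close> be the norm of \<open>\<delta>\<close>. Reducing the coordinates with respect to an integral basis modulo \<open>m\<close>
  gives a representative with bounded conjugates, and there are finitely many of these.
\<close>
lemma finite_residues:
  assumes nf: "number_field TYPE('k::field_char_0)" and \<delta>: "algebraic_int (\<delta>::'k)" "\<delta> \<noteq> 0"
  shows "\<exists>R. finite R \<and> (\<forall>\<alpha>. algebraic_int \<alpha> \<longrightarrow> (\<exists>\<rho>\<in>R. algebraic_int ((\<alpha> - \<rho>) / \<delta>)))"
proof -
  obtain m where m: "m \<noteq> 0" "algebraic_int (of_int m / \<delta>)" using norm_integer[OF nf \<delta>] by blast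
  obtain B :: "'k set" where B: "integral_basis B" using integral_basis_exists[OF nf] by blast
  then have B': "finite B" "rat_vs.independent B" "rat_vs.span B = UNIV" "\<And>b. b \<in> B \<Longrightarrow> algebraic_int b"
    by (auto simp: integral_basis_def)
  define C where "C f = (\<Sum>b\<in>B. \<bar>of_int m\<bar> * cmod (f b))" for f :: "'k \<Rightarrow> complex"
  define C' where "C' = (\<Sum>f\<in>embeddings. C f)"
  have "C f \<ge> 0" for f unfolding C_def by (intro sum_nonneg) auto
  then have CC': "C f \<le> C'" if "f \<in> embeddings" for f
    unfolding C'_def using that finite_embeddings[OF nf] by (intro member_le_sum) auto
  let ?R = "{\<rho>::'k. algebraic_int \<rho> \<and> (\<forall>f\<in>embeddings. cmod (f \<rho>) \<le> C')}"
  have "\<exists>\<rho>\<in>?R. algebraic_int ((\<alpha> - \<rho>) / \<delta>)" if a: "algebraic_int \<alpha>" for \<alpha>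
  proof -
    define r where "r = rat_vs.representation B \<alpha>"
    define q where "q b = \<lfloor>r b / of_int m\<rfloor>" for b
    define \<beta> where "\<beta> = (\<Sum>b\<in>B. of_int (q b) * b)"
    have \<beta>: "algebraic_int \<beta>" unfolding \<beta>_def
      by (rule algebraic_int_sum, rule algebraic_int_add_mult(2)) (simp_all add: B'(4))
    define \<rho> where "\<rho> = \<alpha> - of_int m * \<beta>"
    have \<rho>: "algebraic_int \<rho>" unfolding \<rho>_def by (intro algebraic_int_diff algebraic_int_add_mult a \<beta>) auto
    have "\<alpha> = (\<Sum>b\<in>B. of_rat (r b) * b)"
      unfolding r_def using rat_vs.sum_representation_eq[OF B'(2) _ B'(1) order.refl, of \<alpha>] B'(3) by simp
    then have \<rho>_eq: "\<rho> = (\<Sum>b\<in>B. of_rat (r b - of_int m * of_int (q b)) * b)"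
      by (simp add: \<rho>_def \<beta>_def sum_distrib_left sum_subtractf[symmetric] of_rat_diff of_rat_mult algebra_simps)
    have small: "\<bar>r b - of_int m * of_int (q b)\<bar> \<le> \<bar>of_int m\<bar>" for b
    proof -
      have "\<bar>r b / of_int m - of_int (q b)\<bar> \<le> 1" unfolding q_def by linarith
      then have "\<bar>of_int m\<bar> * \<bar>r b / of_int m - of_int (q b)\<bar> \<le> \<bar>of_int m :: rat\<bar> * 1"
        by (intro mult_left_mono) auto
      then show ?thesis using m(1) by (simp add: abs_mult[symmetric] right_diff_distrib)
    qed
    have "cmod (f \<rho>) \<le> C'" if f: "f \<in> embeddings" for f
    proof -
      have fe: "field_embedding f" using f by (simp add: embeddings_def)
      have "cmod (f \<rho>) \<le> C f"
        unfolding \<rho>_eq C_def field_embedding_simps(8)[OF fe]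
      proof (rule sum_norm_le)
        fix b
        have "cmod (of_rat (r b - of_int m * of_int (q b))) \<le> \<bar>of_int m\<bar>"
        proof -
          have "\<bar>r b - of_int m * of_int (q b)\<bar> \<le> of_int \<bar>m\<bar>" using small[of b] by simp
          then have "real_of_rat \<bar>r b - of_int m * of_int (q b)\<bar> \<le> of_rat (of_int \<bar>m\<bar>)"
            by (simp only: of_rat_less_eq)
          then have "real_of_rat \<bar>r b - of_int m * of_int (q b)\<bar> \<le> \<bar>of_int m\<bar>"
            unfolding of_rat_of_int_eq by simp
          then show ?thesis unfolding complex_of_rat_eq_of_real norm_of_real
            by simp
        qed
        then show "cmod (f (of_rat (r b - of_int m * of_int (q b)) * b)) \<le> \<bar>of_int m\<bar> * cmod (f b)"
          by (simp add: field_embedding_simps[OF fe] norm_mult mult_right_mono)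
      qed
      then show ?thesis using CC'[OF f] by linarith
    qed
    moreover have "(\<alpha> - \<rho>) / \<delta> = (of_int m / \<delta>) * \<beta>" by (simp add: \<rho>_def)
    ultimately show ?thesis using \<rho> algebraic_int_add_mult(2)[OF m(2) \<beta>] by auto
  qed
  then show ?thesis using finite_algebraic_int_bounded[OF nf, of C'] by blast
qed

section \<open>Small integral combinations\<close>

lemma pigeonhole_boxes:
  fixes u :: "'a \<Rightarrow> 'j \<Rightarrow> real" and A :: "'j \<Rightarrow> nat"
  assumes "finite J" "finite S" and u: "\<And>x j. x \<in> S \<Longrightarrow> j \<in> J \<Longrightarrow> \<bar>u x j\<bar> < L j"
    and A: "\<And>j. j \<in> J \<Longrightarrow> A j \<ge> 1" and card: "(\<Prod>j\<in>J. A j) < card S"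
  shows "\<exists>x\<in>S. \<exists>y\<in>S. x \<noteq> y \<and> (\<forall>j\<in>J. \<bar>u x j - u y j\<bar> \<le> 2 * L j / A j)"
proof -
  define t where "t x j = (u x j + L j) * A j / (2 * L j)" for x j
  define c where "c x = (\<lambda>j\<in>J. nat \<lfloor>t x j\<rfloor>)" for x
  have t: "0 \<le> t x j" "t x j < A j" if "x \<in> S" "j \<in> J" for x j
  proof -
    have L: "L j > 0" "- L j < u x j" "u x j < L j" using u[OF that] by auto
    then show "0 \<le> t x j" unfolding t_def by (intro divide_nonneg_pos mult_nonneg_nonneg) auto
    have "(u x j + L j) * A j < (2 * L j) * A j" using L A[OF that(2)] by (intro mult_strict_right_mono) auto
    then show "t x j < A j" unfolding t_def using L by (simp add: divide_simps ac_simps)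
  qed
  have "c ` S \<subseteq> PiE J (\<lambda>j. {..<A j})"
  proof (auto simp: c_def)
    fix x j assume "x \<in> S" "j \<in> J"
    from t[OF this] show "nat \<lfloor>t x j\<rfloor> < A j" by (simp add: nat_less_iff floor_less_iff)
  qed
  then have "card (c ` S) \<le> card (PiE J (\<lambda>j. {..<A j}))"
    using assms(1) by (intro card_mono finite_PiE) auto
  then have "card (c ` S) < card S" using card assms(1) by (simp add: card_PiE)
  then have "\<not> inj_on c S" by (rule pigeonhole)
  then obtain x y where xy: "x \<in> S" "y \<in> S" "x \<noteq> y" "c x = c y" by (auto simp: inj_on_def)
  have "\<bar>u x j - u y j\<bar> \<le> 2 * L j / A j" if j: "j \<in> J" for j
  proof -
    have L: "L j > 0" using u[OF xy(1) j] by auto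
    have "nat \<lfloor>t x j\<rfloor> = nat \<lfloor>t y j\<rfloor>" using fun_cong[OF xy(4), of j] j by (simp add: c_def)
    then have "\<lfloor>t x j\<rfloor> = \<lfloor>t y j\<rfloor>" using t[OF xy(1) j] t[OF xy(2) j] by (simp add: eq_nat_nat_iff)
    then have "\<bar>t x j - t y j\<bar> \<le> 1" by linarith
    moreover have "u x j - u y j = (t x j - t y j) * (2 * L j / A j)"
      using L A[OF j] by (simp add: t_def field_simps)
    moreover have "0 \<le> 2 * L j / A j" using L by simp
    ultimately show ?thesis
      using mult_right_mono[of "\<bar>t x j - t y j\<bar>" 1 "2 * L j / A j"] by (simp add: abs_mult abs_of_pos[OF L])
  qed
  then show ?thesis using xy by blast
qed

text \<open>
  The pigeonhole principle applied to the combinations with coefficients in \<open>{0..M}\<close>: some two agree up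
  to the cell sizes, and their difference is small. The exponent \<open>d j\<close> is the number of real dimensions in
  which the \<open>j\<close>-th form varies, which is one if the form is real and two otherwise.
\<close>
lemma small_integral_combination:
  fixes w :: "'j \<Rightarrow> 't \<Rightarrow> complex" and A :: "'j \<Rightarrow> nat" and M :: nat
  assumes fin: "finite J" "finite T" and A: "\<And>j. j \<in> J \<Longrightarrow> A j \<ge> 1"
    and d: "\<And>j. j \<in> J \<Longrightarrow> d j \<ge> 2 \<or> (d j \<ge> 1 \<and> (\<forall>t\<in>T. Im (w j t) = 0))"
    and card: "(\<Prod>j\<in>J. A j ^ d j) < (M + 1) ^ card T"
  shows "\<exists>z::'t \<Rightarrow> int. (\<exists>t\<in>T. z t \<noteq> 0) \<and>
    (\<forall>j\<in>J. cmod (\<Sum>t\<in>T. of_int (z t) * w j t) \<le> 4 * (M * (\<Sum>t\<in>T. cmod (w j t)) + 1) / A j)"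
proof -
  define S where "S = PiE T (\<lambda>_. {..M})"
  have S: "finite S" "card S = (M + 1) ^ card T" using fin by (auto simp: S_def card_PiE intro: finite_PiE)
  define L where "L j = M * (\<Sum>t\<in>T. cmod (w j t)) + 1" for j
  define F where "F x j = (\<Sum>t\<in>T. of_nat (x t) * w j t)" for x :: "'t \<Rightarrow> nat" and j
  define u where "u x = (\<lambda>(j, re). if re then Re (F x j) else Im (F x j))" for x
  define A' where "A' = (\<lambda>(j, re). if re then A j else if \<forall>t\<in>T. Im (w j t) = 0 then 1 else A j)"
  have "(\<Prod>p\<in>J \<times> (UNIV::bool set). A' p) = (\<Prod>j\<in>J. \<Prod>re\<in>(UNIV::bool set). A' (j, re))"
    by (simp add: prod.cartesian_product)
  also have "\<dots> \<le> (\<Prod>j\<in>J. A j ^ d j)"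
  proof (rule prod_mono, safe)
    fix j assume j: "j \<in> J"
    have "(\<Prod>re\<in>(UNIV::bool set). A' (j, re)) = A j ^ (if \<forall>t\<in>T. Im (w j t) = 0 then 1 else 2)"
      by (simp add: A'_def UNIV_bool power2_eq_square)
    also have "\<dots> \<le> A j ^ d j"
      using d[OF j] A[OF j] by (intro power_increasing) auto
    finally show "(\<Prod>re\<in>(UNIV::bool set). A' (j, re)) \<le> A j ^ d j" .
  qed
  finally have prod: "(\<Prod>p\<in>J \<times> (UNIV::bool set). A' p) < card S" using card S by linarith
  have bound: "cmod (F x j) < L j" if "x \<in> S" for x j
  proof -
    have "cmod (F x j) \<le> (\<Sum>t\<in>T. M * cmod (w j t))"
      unfolding F_def
    proof (rule sum_norm_le)
      fix t assume "t \<in> T"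
      then have "x t \<le> M" using that by (auto simp: S_def)
      then show "cmod (of_nat (x t) * w j t) \<le> M * cmod (w j t)"
        by (simp add: norm_mult mult_right_mono)
    qed
    then show ?thesis by (simp add: L_def sum_distrib_left)
  qed
  have "\<exists>x\<in>S. \<exists>y\<in>S. x \<noteq> y \<and> (\<forall>p\<in>J \<times> (UNIV::bool set). \<bar>u x p - u y p\<bar> \<le> 2 * L (fst p) / A' p)"
  proof (rule pigeonhole_boxes)
    show "\<bar>u x p\<bar> < L (fst p)" if "x \<in> S" for x p
      using bound[OF that, of "fst p"] abs_Re_le_cmod[of "F x (fst p)"] abs_Im_le_cmod[of "F x (fst p)"]
      by (auto simp: u_def split: prod.splits)
    show "1 \<le> A' p" if "p \<in> J \<times> UNIV" for p using A that by (auto simp: A'_def)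
  qed (use fin S prod in auto)
  then obtain x y where xy: "x \<in> S" "y \<in> S" "x \<noteq> y"
    and close: "\<And>j re. j \<in> J \<Longrightarrow> \<bar>u x (j, re) - u y (j, re)\<bar> \<le> 2 * L j / A' (j, re)" by force
  define z where "z t = int (x t) - int (y t)" for t
  have "\<exists>t\<in>T. z t \<noteq> 0"
  proof (rule ccontr)
    assume "\<not> ?thesis"
    then have "x = y" using xy by (intro PiE_ext[of _ T]) (auto simp: S_def z_def)
    then show False using xy by simp
  qed
  moreover have "cmod (\<Sum>t\<in>T. of_int (z t) * w j t) \<le> 4 * L j / A j" if j: "j \<in> J" for j
  proof -
    have eq: "(\<Sum>t\<in>T. of_int (z t) * w j t) = F x j - F y j"
      by (simp add: F_def z_def left_diff_distrib sum_subtractf)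
    have L: "L j > 0" unfolding L_def by (intro add_nonneg_pos mult_nonneg_nonneg sum_nonneg) auto
    have "\<bar>Re (F x j - F y j)\<bar> \<le> 2 * L j / A j"
      using close[OF j, of True] by (simp add: u_def A'_def)
    moreover have "\<bar>Im (F x j - F y j)\<bar> \<le> 2 * L j / A j"
    proof (cases "\<forall>t\<in>T. Im (w j t) = 0")
      case True
      then have "Im (F x j - F y j) = 0" by (simp add: F_def)
      then show ?thesis using L by simp
    next
      case False
      then have "A' (j, False) = A j" by (auto simp: A'_def)
      then show ?thesis using close[OF j, of False] by (simp add: u_def)
    qed
    ultimately show ?thesis unfolding eq using cmod_le[of "F x j - F y j"] by simp
  qed
  ultimately show ?thesis unfolding L_def by blast
qed


section \<open>The two archimedean places and units\<close>

locale hilbert_rank2 =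
  fixes \<sigma> :: "'i::finite \<Rightarrow> 'k::field_char_0 \<Rightarrow> complex"
  assumes nf: "number_field TYPE('k)"
    and places: "archimedean_completions \<sigma>"
    and rank: "CARD('i) = 2"
begin

lemma \<sigma>_embedding: "field_embedding (\<sigma> i)"
  using places by (simp add: archimedean_completions_def)

lemmas \<sigma>_simps = field_embedding_simps[OF \<sigma>_embedding]

lemma UNIV_places:
  assumes "i \<noteq> j"
  shows "UNIV = {i, j :: 'i}"
proof -
  obtain a b :: 'i where "UNIV = {a, b}" using rank by (auto simp: card_2_iff)
  have "i \<in> {a, b}" "j \<in> {a, b}" unfolding \<open>UNIV = {a, b}\<close>[symmetric] by simp_all
  then have "{i, j} = {a, b}" using assms by auto
  then show ?thesis using \<open>UNIV = {a, b}\<close> by simp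
qed

text \<open>
  An equivalence of the absolute values of two embeddings has exponent \<open>1\<close>, as both send \<open>2\<close>
  to \<open>2\<close>.
\<close>
lemma ex1_place:
  assumes f: "f \<in> embeddings"
  shows "\<exists>!i. \<forall>x. cmod (f x) = cmod (\<sigma> i x)"
proof -
  have fe: "field_embedding f" using f by (simp add: embeddings_def)
  note fs = field_embedding_simps[OF fe]
  have "\<not> (\<forall>x y. cmod (f (x + y)) \<le> max (cmod (f x)) (cmod (f y)))"
    by (auto simp: fs intro!: exI[of _ 1])
  then have "archimedean_absolute_value (\<lambda>x. cmod (f x))"
    unfolding archimedean_absolute_value_def by (simp add: fs norm_mult norm_triangle_ineq)
  then have ex: "\<exists>!i. equivalent_absolute_values (\<lambda>x. cmod (f x)) (\<lambda>x. cmod (\<sigma> i x))"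
    using places by (simp add: archimedean_completions_def)
  have "equivalent_absolute_values (\<lambda>x. cmod (f x)) (\<lambda>x. cmod (\<sigma> i x)) \<longleftrightarrow> (\<forall>x. cmod (f x) = cmod (\<sigma> i x))" for i
  proof
    assume "equivalent_absolute_values (\<lambda>x. cmod (f x)) (\<lambda>x. cmod (\<sigma> i x))"
    then obtain s where s: "s > 0" "\<And>x. cmod (\<sigma> i x) = cmod (f x) powr s"
      by (auto simp: equivalent_absolute_values_def)
    have "f (1 + 1) = 2" "\<sigma> i (1 + 1) = 2" by (simp_all only: fs \<sigma>_simps) simp_all
    then have "(2::real) = 2 powr s" using s(2)[of "1 + 1"] by simp
    then have "ln (2::real) = s * ln 2" by (metis ln_powr zero_less_numeral)
    then have "s = 1" by simp
    then show "\<forall>x. cmod (f x) = cmod (\<sigma> i x)" using s(2) by simp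
  next
    assume "\<forall>x. cmod (f x) = cmod (\<sigma> i x)"
    then show "equivalent_absolute_values (\<lambda>x. cmod (f x)) (\<lambda>x. cmod (\<sigma> i x))"
      unfolding equivalent_absolute_values_def by (intro exI[of _ 1]) simp
  qed
  with ex show ?thesis by simp
qed

definition embeddings_over :: "'i \<Rightarrow> ('k \<Rightarrow> complex) set" where
  "embeddings_over i = {f \<in> embeddings. \<forall>x. cmod (f x) = cmod (\<sigma> i x)}"

abbreviation local_degree :: "'i \<Rightarrow> nat" where
  "local_degree i \<equiv> card (embeddings_over i)"

lemma embeddings_partition:
  assumes "i \<noteq> j"
  shows "embeddings = embeddings_over i \<union> embeddings_over j" "embeddings_over i \<inter> embeddings_over j = {}"
proof -
  show "embeddings = embeddings_over i \<union> embeddings_over j"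
  proof (intro equalityI subsetI)
    fix f :: "'k \<Rightarrow> complex" assume f: "f \<in> embeddings"
    then obtain l where l: "\<forall>x. cmod (f x) = cmod (\<sigma> l x)" using ex1_place by blast
    have "l = i \<or> l = j" using UNIV_places[OF assms] by blast
    then show "f \<in> embeddings_over i \<union> embeddings_over j" using f l by (auto simp: embeddings_over_def)
  qed (auto simp: embeddings_over_def)
  show "embeddings_over i \<inter> embeddings_over j = {}"
  proof (intro equals0I)
    fix f assume f: "f \<in> embeddings_over i \<inter> embeddings_over j"
    then have "f \<in> embeddings" "\<forall>x. cmod (f x) = cmod (\<sigma> i x)" "\<forall>x. cmod (f x) = cmod (\<sigma> j x)"
      unfolding embeddings_over_def by blast+
    then show False using ex1_place[of f] assms by blast
  qed
qed

lemma finite_embeddings_over: "finite (embeddings_over i)"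
  unfolding embeddings_over_def using finite_embeddings[OF nf] by simp

lemma local_degree_sum:
  assumes "i \<noteq> j" and B: "integral_basis (B :: 'k set)"
  shows "card B = local_degree i + local_degree j"
  unfolding card_embeddings[OF nf B, symmetric] embeddings_partition(1)[OF assms(1)]
  by (intro card_Un_disjoint finite_embeddings_over embeddings_partition assms)

lemma local_degree_pos: "local_degree i \<ge> 1"
proof -
  have "\<sigma> i \<in> embeddings_over i" by (simp add: embeddings_over_def embeddings_def \<sigma>_embedding)
  then show ?thesis using finite_embeddings_over[of i] by (metis One_nat_def Suc_leI card_gt_0_iff empty_iff)
qed

lemma local_degree_complex:
  assumes "Im (\<sigma> i x) \<noteq> 0"
  shows "local_degree i \<ge> 2"
proof -
  have "field_embedding (\<lambda>x. cnj (\<sigma> i x))" unfolding field_embedding_def by (simp add: \<sigma>_simps)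
  then have "{\<sigma> i, \<lambda>x. cnj (\<sigma> i x)} \<subseteq> embeddings_over i"
    by (simp add: embeddings_over_def embeddings_def \<sigma>_embedding)
  moreover have "\<sigma> i \<noteq> (\<lambda>x. cnj (\<sigma> i x))"
  proof
    assume "\<sigma> i = (\<lambda>x. cnj (\<sigma> i x))"
    then have "Im (\<sigma> i x) = Im (cnj (\<sigma> i x))" by metis
    then show False using assms by simp
  qed
  ultimately show ?thesis using card_mono[OF finite_embeddings_over[of i], of "{\<sigma> i, \<lambda>x. cnj (\<sigma> i x)}"] by simp
qed

lemma cmod_norm:
  assumes "i \<noteq> j"
  shows "cmod (\<Prod>f\<in>embeddings. f \<alpha>) = cmod (\<sigma> i \<alpha>) ^ local_degree i * cmod (\<sigma> j \<alpha>) ^ local_degree j"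
proof -
  have "cmod (\<Prod>f\<in>embeddings_over l. f \<alpha>) = cmod (\<sigma> l \<alpha>) ^ local_degree l" for l
    unfolding prod_norm[symmetric] by (subst prod.cong[OF refl, of _ _ "\<lambda>_. cmod (\<sigma> l \<alpha>)"]) (auto simp: embeddings_over_def)
  then show ?thesis
    unfolding embeddings_partition(1)[OF assms]
    by (subst prod.union_disjoint) (simp_all add: finite_embeddings_over embeddings_partition(2)[OF assms] norm_mult)
qed

lemma finite_algebraic_int_bounded_places:
  "finite {\<alpha>. algebraic_int \<alpha> \<and> (\<forall>i. cmod (\<sigma> i \<alpha>) \<le> C)}"
proof (rule finite_subset[OF _ finite_algebraic_int_bounded[OF nf, of C]], safe)
  fix \<alpha> and f :: "'k \<Rightarrow> complex" assume "\<forall>i. cmod (\<sigma> i \<alpha>) \<le> C" "f \<in> embeddings"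
  then show "cmod (f \<alpha>) \<le> C" using ex1_place[of f] by metis
qed

text \<open>
  Only finitely many integers are at most \<open>C\<close> at \<open>j\<close> and at most \<open>1\<close> at \<open>i\<close>.
\<close>
lemma algebraic_int_lower_bound:
  assumes "i \<noteq> j"
  shows "\<exists>\<mu>>0. \<forall>\<alpha>. algebraic_int \<alpha> \<longrightarrow> \<alpha> \<noteq> 0 \<longrightarrow> cmod (\<sigma> j \<alpha>) \<le> C \<longrightarrow> \<mu> \<le> cmod (\<sigma> i \<alpha>)"
proof -
  let ?A = "{\<alpha>. algebraic_int \<alpha> \<and> (\<forall>i. cmod (\<sigma> i \<alpha>) \<le> max 1 C)} - {0}"
  define \<mu> where "\<mu> = Min (insert 1 ((\<lambda>\<alpha>. cmod (\<sigma> i \<alpha>)) ` ?A))"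
  have fin: "finite (insert 1 ((\<lambda>\<alpha>. cmod (\<sigma> i \<alpha>)) ` ?A))"
    using finite_algebraic_int_bounded_places[of "max 1 C"] by simp
  have "\<mu> > 0" unfolding \<mu>_def using fin by (subst Min_gr_iff) (auto simp: \<sigma>_simps)
  moreover have "\<mu> \<le> cmod (\<sigma> i \<alpha>)" if a: "algebraic_int \<alpha>" "\<alpha> \<noteq> 0" "cmod (\<sigma> j \<alpha>) \<le> C" for \<alpha>
  proof (cases "cmod (\<sigma> i \<alpha>) \<le> 1")
    case True
    have "cmod (\<sigma> l \<alpha>) \<le> max 1 C" for l using True a(3) UNIV_places[OF assms] by (cases "l = i") auto
    then have "\<alpha> \<in> ?A" using a by simp
    then show ?thesis unfolding \<mu>_def using fin by (intro Min_le) auto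
  next
    case False
    have "\<mu> \<le> 1" unfolding \<mu>_def using fin by (intro Min_le) auto
    then show ?thesis using False by linarith
  qed
  ultimately show ?thesis by blast
qed

text \<open>
  The weak form of Dirichlet's theorem for two places. The pigeonhole principle yields
  nonzero integers that get small at \<open>j\<close> while their norms stay bounded; two of them with the same
  norm \<open>m\<close> that are congruent modulo \<open>m\<close> have a unit as quotient.
\<close>
lemma exists_unit:
  assumes ij: "i \<noteq> j"
  shows "\<exists>\<epsilon>. algebraic_int \<epsilon> \<and> algebraic_int (inverse \<epsilon>) \<and> 1 < cmod (\<sigma> i \<epsilon>) \<and> cmod (\<sigma> j \<epsilon>) < 1 \<and> \<epsilon> \<noteq> 0"
proof -
  obtain B :: "'k set" where B: "integral_basis B" using integral_basis_exists[OF nf] by blast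
  then have B': "finite B" "rat_vs.independent B" "\<And>b. b \<in> B \<Longrightarrow> algebraic_int b"
    by (auto simp: integral_basis_def)
  define ni nj where "ni = local_degree i" and "nj = local_degree j"
  have n: "card B = ni + nj" "ni \<ge> 1" "nj \<ge> 1"
    unfolding ni_def nj_def using local_degree_sum[OF ij B] local_degree_pos by auto
  define W where "W = (\<Sum>l\<in>{i, j}. \<Sum>b\<in>B. cmod (\<sigma> l b))"
  define C where "C = 4 * (W + 1)"
  have Wnn: "(\<Sum>b\<in>B. cmod (\<sigma> l b)) \<ge> 0" for l by (intro sum_nonneg) auto
  have C: "C \<ge> 4" unfolding C_def W_def using ij Wnn[of i] Wnn[of j] by simp
  have WC: "4 * (real M * (\<Sum>b\<in>B. cmod (\<sigma> l b)) + 1) \<le> C * M" if "M \<ge> 1" "l = i \<or> l = j" for M :: nat and l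
  proof -
    have "(\<Sum>b\<in>B. cmod (\<sigma> l b)) \<le> W" unfolding W_def using that(2) ij Wnn[of i] Wnn[of j] by auto
    then have "real M * (\<Sum>b\<in>B. cmod (\<sigma> l b)) \<le> real M * W" by (intro mult_left_mono) auto
    moreover have "C * M = 4 * (real M * W) + 4 * real M" by (simp add: C_def algebra_simps)
    moreover have "1 \<le> real M" using that(1) by simp
    ultimately show ?thesis by argo
  qed
  have small: "\<exists>\<alpha>. algebraic_int \<alpha> \<and> \<alpha> \<noteq> 0 \<and> cmod (\<sigma> i \<alpha>) \<le> C * Q ^ nj \<and> cmod (\<sigma> j \<alpha>) \<le> C / Q ^ ni"
    if Q: "Q \<ge> 1" for Q :: nat
  proof -
    \<comment> \<open>With coefficients up to \<open>Q\<^sup>n\<^sup>j\<close> it suffices to subdivide at \<open>j\<close>: the numbers of cells and of combinations then balance.\<close>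
    define A where "A = (\<lambda>l. if l = j then Q ^ card B else 1)"
    have "\<exists>z. (\<exists>t\<in>B. z t \<noteq> 0) \<and> (\<forall>l\<in>{i, j}. cmod (\<Sum>t\<in>B. of_int (z t) * \<sigma> l t)
        \<le> 4 * (real (Q ^ nj) * (\<Sum>t\<in>B. cmod (\<sigma> l t)) + 1) / A l)"
    proof (rule small_integral_combination)
      show "(\<Prod>l\<in>{i, j}. A l ^ local_degree l) < (Q ^ nj + 1) ^ card B"
      proof -
        have "(\<Prod>l\<in>{i, j}. A l ^ local_degree l) = (Q ^ nj) ^ card B"
          using ij by (simp add: A_def nj_def mult.commute flip: power_mult)
        also have "\<dots> < (Q ^ nj + 1) ^ card B" using n by (intro power_strict_mono) auto
        finally show ?thesis .
      qed
      show "2 \<le> local_degree l \<or> 1 \<le> local_degree l \<and> (\<forall>t\<in>B. Im (\<sigma> l t) = 0)" for l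
        using local_degree_pos[of l] local_degree_complex[of l] by blast
    qed (use B' Q in \<open>auto simp: A_def\<close>)
    then obtain z where z: "\<exists>t\<in>B. z t \<noteq> 0"
      and zb: "\<And>l. l = i \<or> l = j \<Longrightarrow> cmod (\<Sum>t\<in>B. of_int (z t) * \<sigma> l t)
        \<le> 4 * (real (Q ^ nj) * (\<Sum>t\<in>B. cmod (\<sigma> l t)) + 1) / A l" by auto
    define \<alpha> where "\<alpha> = (\<Sum>t\<in>B. of_int (z t) * t)"
    have "algebraic_int \<alpha>" unfolding \<alpha>_def
      by (rule algebraic_int_sum, rule algebraic_int_add_mult(2)) (simp_all add: B'(3))
    moreover have "\<alpha> \<noteq> 0"
    proof
      assume "\<alpha> = 0"
      then have "(\<Sum>t\<in>B. of_rat (of_int (z t)) * t) = 0" by (simp add: \<alpha>_def)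
      then have "\<forall>t\<in>B. (of_int (z t) :: rat) = 0"
        using rat_vs.independentD[OF B'(2) B'(1) order.refl, of "\<lambda>t. of_int (z t)"] by blast
      then show False using z by auto
    qed
    moreover have \<sigma>\<alpha>: "cmod (\<sigma> l \<alpha>) \<le> C * Q ^ nj / A l" if "l = i \<or> l = j" for l
    proof -
      have "\<sigma> l \<alpha> = (\<Sum>t\<in>B. of_int (z t) * \<sigma> l t)" by (simp add: \<alpha>_def \<sigma>_simps)
      then have "cmod (\<sigma> l \<alpha>) \<le> 4 * (real (Q ^ nj) * (\<Sum>t\<in>B. cmod (\<sigma> l t)) + 1) / A l"
        using zb[OF that] by simp
      also have "\<dots> \<le> C * Q ^ nj / A l"
        using WC[of "Q ^ nj" l] that Q by (intro divide_right_mono) auto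
      finally show ?thesis .
    qed
    moreover have "C * Q ^ nj / A j = C / Q ^ ni"
      using Q by (simp add: A_def n(1) power_add field_simps)
    ultimately show ?thesis using \<sigma>\<alpha>[of i] \<sigma>\<alpha>[of j] ij by (auto simp: A_def)
  qed
  then obtain a :: "nat \<Rightarrow> 'k" where a: "\<And>Q. Q \<ge> 1 \<Longrightarrow> algebraic_int (a Q)"
    "\<And>Q. Q \<ge> 1 \<Longrightarrow> a Q \<noteq> 0" "\<And>Q. Q \<ge> 1 \<Longrightarrow> cmod (\<sigma> i (a Q)) \<le> C * real (Q ^ nj)"
    "\<And>Q. Q \<ge> 1 \<Longrightarrow> cmod (\<sigma> j (a Q)) \<le> C / real (Q ^ ni)"
    by metis
  have "\<exists>m::int. m \<noteq> 0 \<and> of_int m = (\<Prod>f\<in>embeddings. f (a Q)) \<and> algebraic_int (of_int m / a Q)" if "Q \<ge> 1" for Q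
    using norm_integer[OF nf a(1,2)] that by blast
  then obtain m where m: "\<And>Q. Q \<ge> 1 \<Longrightarrow> m Q \<noteq> (0::int)"
    "\<And>Q. Q \<ge> 1 \<Longrightarrow> of_int (m Q) = (\<Prod>f\<in>embeddings. f (a Q))" "\<And>Q. Q \<ge> 1 \<Longrightarrow> algebraic_int (of_int (m Q) / a Q)"
    by metis
  \<comment> \<open>The powers of \<open>Q\<close> cancel in the bound for the norm.\<close>
  define K where "K = \<lceil>C ^ ni * C ^ nj\<rceil>"
  have mK: "m Q \<in> {-K..K} - {0}" if Q: "Q \<ge> 1" for Q
  proof -
    have "\<bar>real_of_int (m Q)\<bar> = cmod (\<Prod>f\<in>embeddings. f (a Q))"
      unfolding m(2)[OF Q, symmetric] by simp
    also have "\<dots> = cmod (\<sigma> i (a Q)) ^ ni * cmod (\<sigma> j (a Q)) ^ nj"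
      unfolding ni_def nj_def by (rule cmod_norm[OF ij])
    also have "\<dots> \<le> (C * Q ^ nj) ^ ni * (C / Q ^ ni) ^ nj"
      using a(3,4)[OF Q] C by (intro mult_mono power_mono) auto
    also have "\<dots> = C ^ ni * C ^ nj" using Q
      by (simp add: power_mult_distrib power_divide mult.commute flip: power_mult)
    finally have "\<bar>m Q\<bar> \<le> K" unfolding K_def by linarith
    then show ?thesis using m(1)[OF Q] by auto
  qed
  have "\<exists>R. finite R \<and> (\<forall>\<alpha>::'k. algebraic_int \<alpha> \<longrightarrow> (\<exists>\<rho>\<in>R. algebraic_int ((\<alpha> - \<rho>) / of_int l)))" if "l \<noteq> 0" for l :: int
    using finite_residues[OF nf, of "of_int l"] that by simp
  then obtain R where R: "\<And>l. l \<noteq> 0 \<Longrightarrow> finite (R l)"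
    "\<And>l \<alpha>. l \<noteq> 0 \<Longrightarrow> algebraic_int \<alpha> \<Longrightarrow> \<exists>\<rho>\<in>R l. algebraic_int (((\<alpha>::'k) - \<rho>) / of_int (l::int))"
    by metis
  have "\<exists>\<rho>\<in>R (m Q). algebraic_int ((a Q - \<rho>) / of_int (m Q))" if "Q \<ge> 1" for Q
    using R(2) m(1) a(1) that by blast
  then obtain r where r: "\<And>Q. Q \<ge> 1 \<Longrightarrow> r Q \<in> R (m Q)"
    "\<And>Q. Q \<ge> 1 \<Longrightarrow> algebraic_int ((a Q - r Q) / of_int (m Q))" by metis
  have "finite (\<Union>l\<in>{-K..K} - {0}. {l} \<times> R l)" using R(1) by auto
  moreover have "(\<lambda>Q. (m Q, r Q)) ` {1..} \<subseteq> (\<Union>l\<in>{-K..K} - {0}. {l} \<times> R l)"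
    using mK r(1) by force
  ultimately have "finite ((\<lambda>Q. (m Q, r Q)) ` {1..})" by (rule finite_subset[rotated])
  then obtain Q0 where Q0: "Q0 \<ge> 1" "infinite {Q \<in> {1..}. (m Q, r Q) = (m Q0, r Q0)}"
    using pigeonhole_infinite[of "{1::nat..}" "\<lambda>Q. (m Q, r Q)"] infinite_Ici by auto
  have "cmod (\<sigma> j (a Q0)) > 0" using a(2)[OF Q0(1)] by (simp add: \<sigma>_simps)
  obtain Q1 where Q1: "Q1 \<ge> 1" "m Q1 = m Q0" "r Q1 = r Q0" "real Q1 > C / cmod (\<sigma> j (a Q0))"
  proof -
    obtain N where N: "real N > C / cmod (\<sigma> j (a Q0))" using reals_Archimedean2 by blast
    from Q0(2) obtain Q where "Q > N" "Q \<in> {Q \<in> {1..}. (m Q, r Q) = (m Q0, r Q0)}"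
      by (meson infinite_nat_iff_unbounded)
    then show ?thesis using that[of Q] N by auto
  qed
  define \<epsilon> where "\<epsilon> = a Q1 / a Q0"
  have nz: "a Q0 \<noteq> 0" "a Q1 \<noteq> 0" "(of_int (m Q0) :: 'k) \<noteq> 0" using a(2) m(1) Q0(1) Q1(1) by auto
  have cong: "algebraic_int ((a Q1 - a Q0) / of_int (m Q0))"
    using algebraic_int_diff[OF r(2)[OF Q1(1)] r(2)[OF Q0(1)]] Q1(2,3) by (simp flip: diff_divide_distrib)
  have q: "algebraic_int (x / y)" if "algebraic_int ((x - y) / of_int (m Q0))" "algebraic_int (of_int (m Q0) / y)" "y \<noteq> 0" for x y :: 'k
  proof -
    have "x / y = 1 + ((x - y) / of_int (m Q0)) * (of_int (m Q0) / y)"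
      using nz that(3) by (simp add: field_simps)
    then show ?thesis by (metis algebraic_int_add_mult that(1,2) algebraic_int_1)
  qed
  have 1: "algebraic_int \<epsilon>" unfolding \<epsilon>_def by (rule q[OF cong m(3)[OF Q0(1)] nz(1)])
  have "algebraic_int ((a Q0 - a Q1) / of_int (m Q0))"
    using cong by (metis algebraic_int_minus_iff minus_diff_eq minus_divide_left)
  from q[OF this] m(3)[OF Q1(1)] nz Q1(2) have 2: "algebraic_int (inverse \<epsilon>)" unfolding \<epsilon>_def by simp
  have 3: "cmod (\<sigma> j \<epsilon>) < 1"
  proof -
    have "cmod (\<sigma> j (a Q1)) \<le> C / Q1 ^ ni" by (rule a(4)[OF Q1(1)])
    also have "\<dots> \<le> C / Q1" using Q1(1) n(2) C by (intro divide_left_mono) (auto simp: self_le_power)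
    also have "\<dots> < cmod (\<sigma> j (a Q0))"
      using Q1(1,4) \<open>cmod (\<sigma> j (a Q0)) > 0\<close> by (simp add: field_simps)
    finally show ?thesis using nz by (simp add: \<epsilon>_def \<sigma>_simps norm_divide)
  qed
  have 4: "1 < cmod (\<sigma> i \<epsilon>)"
  proof (rule ccontr)
    assume le: "\<not> 1 < cmod (\<sigma> i \<epsilon>)"
    obtain l :: int where l: "l \<noteq> 0" "of_int l = (\<Prod>f\<in>embeddings. f \<epsilon>)"
      using norm_integer[OF nf 1] nz by (auto simp: \<epsilon>_def)
    have "1 \<le> \<bar>real_of_int l\<bar>" using l(1) by linarith
    also have "\<dots> = cmod (\<Prod>f\<in>embeddings. f \<epsilon>)" unfolding l(2)[symmetric] by simp
    also have "\<dots> = cmod (\<sigma> i \<epsilon>) ^ ni * cmod (\<sigma> j \<epsilon>) ^ nj" unfolding ni_def nj_def by (rule cmod_norm[OF ij])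
    also have "\<dots> \<le> 1 * cmod (\<sigma> j \<epsilon>) ^ nj"
      using le by (intro mult_right_mono power_le_one) auto
    also have "\<dots> < 1" using 3 n(3) by (simp add: power_less_one_iff)
    finally show False by simp
  qed
  show ?thesis using 1 2 3 4 nz by (intro exI[of _ \<epsilon>]) (simp add: \<epsilon>_def)
qed

end


section \<open>Two by two matrices\<close>

definition mk2 :: "'a \<Rightarrow> 'a \<Rightarrow> 'a \<Rightarrow> 'a \<Rightarrow> 'a^2^2" where
  "mk2 a b c d = (\<chi> i j. if i = 1 then (if j = 1 then a else b) else (if j = 1 then c else d))"

definition adj2 :: "'a::comm_ring_1^2^2 \<Rightarrow> 'a^2^2" where
  "adj2 A = mk2 (A $ 2 $ 2) (- A $ 1 $ 2) (- A $ 2 $ 1) (A $ 1 $ 1)"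

lemma mk2_nth [simp]:
  "mk2 a b c d $ 1 $ 1 = a" "mk2 a b c d $ 1 $ 2 = b" "mk2 a b c d $ 2 $ 1 = c" "mk2 a b c d $ 2 $ 2 = d"
  by (simp_all add: mk2_def)

lemma eq_mk2_iff: "A = mk2 a b c d \<longleftrightarrow> A $ 1 $ 1 = a \<and> A $ 1 $ 2 = b \<and> A $ 2 $ 1 = c \<and> A $ 2 $ 2 = d"
  by (auto simp: vec_eq_iff forall_2)

lemma mk2_cases: obtains a b c d where "A = mk2 a b c d"
  using that[of "A $ 1 $ 1" "A $ 1 $ 2" "A $ 2 $ 1" "A $ 2 $ 2"] by (simp add: eq_mk2_iff)

lemma mk2_mult:
  "mk2 a b c d ** mk2 a' b' c' d' = mk2 (a * a' + b * c') (a * b' + b * d') (c * a' + d * c') (c * b' + d * (d' :: 'a::comm_ring_1))"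
  by (simp add: eq_mk2_iff matrix_matrix_mult_def sum_2)

lemma mk2_one: "(mat 1 :: 'a::comm_ring_1^2^2) = mk2 1 0 0 1"
  by (simp add: eq_mk2_iff mat_def)

lemma det_mk2 [simp]: "det (mk2 a b c d) = a * d - b * (c :: 'a::comm_ring_1)"
  by (simp add: det_2)

lemma adj2_mk2 [simp]: "adj2 (mk2 a b c d) = mk2 d (- b) (- c) (a :: 'a::comm_ring_1)"
  by (simp add: adj2_def)

lemma adj2_inverse:
  assumes "det A = (1 :: 'a::comm_ring_1)"
  shows "adj2 A ** A = mat 1" "A ** adj2 A = mat 1" "det (adj2 A) = 1" "adj2 (adj2 A) = A"
proof -
  obtain a b c d where A: "A = mk2 a b c d" by (rule mk2_cases)
  have "a * d - b * c = 1" using assms by (simp add: A)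
  then show "adj2 A ** A = mat 1" "A ** adj2 A = mat 1" "det (adj2 A) = 1" "adj2 (adj2 A) = A"
    by (simp_all add: A mk2_mult mk2_one algebra_simps)
qed

lemma adj2_mult: "adj2 (A ** B) = adj2 B ** adj2 (A :: 'a::comm_ring_1^2^2)"
proof -
  obtain a b c d where A: "A = mk2 a b c d" by (rule mk2_cases)
  obtain a' b' c' d' where B: "B = mk2 a' b' c' d'" by (rule mk2_cases)
  show ?thesis by (simp add: A B mk2_mult algebra_simps)
qed

abbreviation dg :: "'a::field \<Rightarrow> 'a^2^2" where
  "dg t \<equiv> mk2 t 0 0 (1 / t)"

lemma dg_mult: "dg s ** dg t = dg (s * t)"
  by (simp add: mk2_mult)

lemma tendsto_mk2:
  fixes a b c d :: "'x \<Rightarrow> 'a::topological_space"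
  assumes "(a \<longlongrightarrow> a') F" "(b \<longlongrightarrow> b') F" "(c \<longlongrightarrow> c') F" "(d \<longlongrightarrow> d') F"
  shows "((\<lambda>x. mk2 (a x) (b x) (c x) (d x)) \<longlongrightarrow> mk2 a' b' c' d') F"
  unfolding mk2_def by (intro tendsto_vec_lambda) (auto intro: assms)

lemma tendsto_matrix_mult:
  fixes f g :: "'x \<Rightarrow> complex^2^2"
  assumes "(f \<longlongrightarrow> A) F" "(g \<longlongrightarrow> B) F"
  shows "((\<lambda>x. f x ** g x) \<longlongrightarrow> A ** B) F"
  unfolding matrix_matrix_mult_def
  by (intro tendsto_vec_lambda tendsto_sum tendsto_mult tendsto_vec_nth assms)

section \<open>The group, the lattice and the diagonal subgroup\<close>

abbreviation gone :: "complex^2^2^'i::finite" where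
  "gone \<equiv> \<chi> i. mat 1"

definition ginv :: "complex^2^2^'i::finite \<Rightarrow> complex^2^2^'i" where
  "ginv g = (\<chi> i. adj2 (g $ i))"

lemma gmult_nth [simp]: "gmult g h $ i = g $ i ** h $ i"
  by (simp add: gmult_def)

lemma ginv_nth [simp]: "ginv g $ i = adj2 (g $ i)"
  by (simp add: ginv_def)

lemma gmult_assoc: "gmult (gmult a b) c = gmult a (gmult b c)"
  by (simp add: vec_eq_iff[of "gmult _ _"] matrix_mul_assoc)

lemma gmult_gone [simp]: "gmult gone g = g" "gmult g gone = g"
  by (simp_all add: vec_eq_iff[of "gmult _ _"])

lemma tendsto_gmult:
  assumes "(f \<longlongrightarrow> a) F" "(g \<longlongrightarrow> b) F"
  shows "((\<lambda>x. gmult (f x) (g x)) \<longlongrightarrow> gmult a b) F"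
  unfolding gmult_def
  by (intro tendsto_vec_lambda tendsto_matrix_mult tendsto_vec_nth assms)

lemma tendsto_ginv:
  assumes "(f \<longlongrightarrow> a) F"
  shows "((\<lambda>x. ginv (f x)) \<longlongrightarrow> ginv a) F"
  unfolding ginv_def adj2_def
  by (intro tendsto_vec_lambda tendsto_mk2 tendsto_minus tendsto_vec_nth assms)

lemma cmod_entry_le_norm: "cmod (x $ i $ a $ b) \<le> norm (x :: complex^2^2^'i::finite)"
  by (meson Finite_Cartesian_Product.norm_nth_le order_trans)

lemma norm_le_sum_components: "norm (x :: 'a::real_normed_vector^'n) \<le> (\<Sum>i\<in>UNIV. norm (x $ i))"
  by (simp add: norm_vec_def L2_set_le_sum)

lemma norm_le_of_entries:
  fixes C :: real
  assumes "\<And>i a b. cmod (x $ i $ a $ b) \<le> (C::real)"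
  shows "norm (x :: complex^2^2^'i::finite) \<le> CARD('i) * (4 * C)"
proof -
  have "norm x \<le> (\<Sum>i\<in>UNIV. norm (x $ i))" by (rule norm_le_sum_components)
  also have "(\<Sum>i\<in>UNIV. norm (x $ i)) \<le> (\<Sum>i\<in>(UNIV::'i set). 4 * C :: real)"
  proof (rule sum_mono)
    fix i :: 'i
    have "norm (x $ i) \<le> (\<Sum>a\<in>UNIV. norm (x $ i $ a))" by (rule norm_le_sum_components)
    also have "\<dots> \<le> (\<Sum>a\<in>UNIV. \<Sum>b\<in>UNIV. norm (x $ i $ a $ b))" by (intro sum_mono norm_le_sum_components)
    also have "\<dots> \<le> (\<Sum>a\<in>(UNIV::2 set). \<Sum>b\<in>(UNIV::2 set). C)" by (intro sum_mono assms)
    finally show "norm (x $ i) \<le> 4 * C" by simp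
  qed
  finally show ?thesis by simp
qed

lemma algebraic_int_SL2_mult:
  assumes "A \<in> SL2 {x::'k::field_char_0. algebraic_int x}" "B \<in> SL2 {x. algebraic_int x}"
  shows "A ** B \<in> SL2 {x. algebraic_int x}"
proof -
  have "det (A ** B) = 1" using assms by (simp add: SL2_def det_mul)
  moreover have "algebraic_int ((A ** B) $ a $ b)" for a b
    using assms unfolding SL2_def
    by (auto simp: matrix_matrix_mult_def sum_2 intro!: algebraic_int_add_mult(1) algebraic_int_add_mult(2))
  ultimately show ?thesis by (simp add: SL2_def)
qed

lemma algebraic_int_SL2_adj2:
  assumes "A \<in> SL2 {x::'k::field_char_0. algebraic_int x}"
  shows "adj2 A \<in> SL2 {x. algebraic_int x}"
  using assms adj2_inverse(3)[of A] unfolding SL2_def by (auto simp: adj2_def mk2_def)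

context hilbert_rank2
begin

definition real_place :: "'i \<Rightarrow> bool" where
  "real_place i \<longleftrightarrow> (\<forall>x. Im (\<sigma> i x) = 0)"

text \<open>
  If \<open>z\<close> is a nonreal value of the embedding, the rational combinations of \<open>1\<close> and \<open>z\<close> are dense in
  the complex plane.
\<close>
lemma completion_eq: "completion (\<sigma> i) = (if real_place i then \<real> else UNIV)"
proof -
  have dense: "\<exists>q::rat. \<bar>r - of_rat q\<bar> < e" if "e > 0" for r e :: real
  proof -
    have "r - e < r" using that by simp
    then obtain x where "x \<in> \<rat>" "r - e < x" "x < r" using Rats_dense_in_real by blast
    moreover then obtain q where "x = of_rat q" by (auto elim: Rats_cases)
    ultimately show ?thesis by (intro exI[of _ q]) simp
  qed
  have rat: "\<sigma> i (of_rat q) = of_real (of_rat q)" for q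
    by (simp add: \<sigma>_simps complex_of_rat_eq_of_real)
  show ?thesis
  proof (cases "real_place i")
    case True
    have "range (\<sigma> i) \<subseteq> \<real>" using True by (auto simp: real_place_def complex_is_Real_iff)
    then have "closure (range (\<sigma> i)) \<subseteq> \<real>" by (intro closure_minimal closed_complex_Reals)
    moreover have "of_real r \<in> closure (range (\<sigma> i))" for r
    proof (unfold closure_approachable, intro allI impI)
      fix e :: real assume "e > 0"
      then obtain q :: rat where q: "\<bar>r - of_rat q\<bar> < e" using dense by blast
      have "dist (\<sigma> i (of_rat q)) (of_real r) = \<bar>r - of_rat q\<bar>"
        unfolding rat by (simp add: dist_norm abs_minus_commute flip: of_real_diff)
      then show "\<exists>y\<in>range (\<sigma> i). dist y (of_real r) < e"
        using q by (intro bexI[of _ "\<sigma> i (of_rat q)"]) simp_all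
    qed
    ultimately show ?thesis using True by (auto simp: completion_def elim!: Reals_cases)
  next
    case False
    then obtain x where x: "Im (\<sigma> i x) \<noteq> 0" by (auto simp: real_place_def)
    let ?z = "\<sigma> i x"
    have "w \<in> closure (range (\<sigma> i))" for w
    proof (unfold closure_approachable, intro allI impI)
      fix e :: real assume e: "e > 0"
      define v where "v = Im w / Im ?z"
      define u where "u = Re w - v * Re ?z"
      have w: "w = of_real u + of_real v * ?z" using x by (simp add: u_def v_def complex_eq_iff)
      have z: "cmod ?z > 0" using x by auto
      obtain p :: rat where p: "\<bar>u - of_rat p\<bar> < e / 2" using dense[of "e/2" u] e by auto
      obtain q :: rat where q: "\<bar>v - of_rat q\<bar> < e / (2 * cmod ?z)" using dense[of "e / (2 * cmod ?z)" v] e z by auto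
      have "\<sigma> i (of_rat p + of_rat q * x) - w = of_real (of_rat p - u) + of_real (of_rat q - v) * ?z"
        unfolding w \<sigma>_simps(3,4) rat by (simp add: algebra_simps)
      also have "cmod \<dots> \<le> \<bar>of_rat p - u\<bar> + \<bar>of_rat q - v\<bar> * cmod ?z"
        by (metis norm_triangle_ineq norm_mult norm_of_real)
      also have "\<dots> < e / 2 + e / 2"
        using p q z by (intro add_strict_mono) (simp_all add: abs_minus_commute field_simps)
      finally show "\<exists>y\<in>range (\<sigma> i). dist y w < e" by (auto simp: dist_norm)
    qed
    then show ?thesis using False by (auto simp: completion_def)
  qed
qed

lemma completion_closed:
  assumes "x \<in> completion (\<sigma> i)" "y \<in> completion (\<sigma> i)"
  shows "x + y \<in> completion (\<sigma> i)" "x * y \<in> completion (\<sigma> i)" "- x \<in> completion (\<sigma> i)"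
    "x / y \<in> completion (\<sigma> i)"
  using assms by (auto simp: completion_eq)

lemma \<sigma>_completion: "\<sigma> i x \<in> completion (\<sigma> i)" "0 \<in> completion (\<sigma> i)" "1 \<in> completion (\<sigma> i)"
  by (auto simp: completion_eq real_place_def complex_is_Real_iff)

abbreviation "G \<equiv> hilbert_group \<sigma>"
abbreviation "\<Gamma> \<equiv> hilbert_lattice \<sigma>"
abbreviation "D \<equiv> D_group \<sigma>"
abbreviation "X \<equiv> hilbert_modular_space \<sigma>"

lemma G_iff: "g \<in> G \<longleftrightarrow> (\<forall>i. (\<forall>a b. g $ i $ a $ b \<in> completion (\<sigma> i)) \<and> det (g $ i) = 1)"
  by (simp add: hilbert_group_def SL2_def)

lemma G_closed_mult:
  assumes "g \<in> G" "h \<in> G" shows "gmult g h \<in> G"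
proof -
  have "det (gmult g h $ i) = 1" for i using assms by (simp add: G_iff det_mul)
  moreover have "gmult g h $ i $ a $ b \<in> completion (\<sigma> i)" for i a b
    using assms unfolding G_iff
    by (auto simp: matrix_matrix_mult_def sum_2 intro!: completion_closed(1) completion_closed(2))
  ultimately show ?thesis unfolding G_iff by blast
qed

lemma G_ginv:
  assumes "g \<in> G"
  shows "ginv g \<in> G" "gmult (ginv g) g = gone" "gmult g (ginv g) = gone" "ginv (ginv g) = g"
proof -
  have d: "det (g $ i) = 1" for i using assms by (simp add: G_iff)
  show "ginv g \<in> G" using assms adj2_inverse(3)[OF d]
    unfolding G_iff by (auto simp: adj2_def mk2_def intro: completion_closed(3))
  show "gmult (ginv g) g = gone" "gmult g (ginv g) = gone" "ginv (ginv g) = g"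
    by (simp_all add: vec_eq_iff[of "gmult _ _"] vec_eq_iff[of "ginv _"] adj2_inverse[OF d])
qed

lemma ginv_cancel:
  assumes "g \<in> G"
  shows "gmult (ginv g) (gmult g x) = x" "gmult g (gmult (ginv g) x) = x"
    "gmult (gmult x g) (ginv g) = x" "gmult (gmult x (ginv g)) g = x"
  using G_ginv[OF assms] gmult_assoc gmult_gone by metis+

lemma closed_G: "closed G"
proof (unfold closed_sequential_limits, intro allI impI, elim conjE)
  fix x l assume x: "\<forall>n. x n \<in> G" and l: "x \<longlonglongrightarrow> l"
  have entry: "(\<lambda>n. x n $ i $ a $ b) \<longlonglongrightarrow> l $ i $ a $ b" for i a b
    by (intro tendsto_vec_nth l)
  have "l $ i $ a $ b \<in> completion (\<sigma> i)" for i a b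
    using entry closed_sequentially[of "completion (\<sigma> i)" "\<lambda>n. x n $ i $ a $ b"] x
    by (auto simp: completion_def G_iff)
  moreover have "det (l $ i) = 1" for i
  proof -
    have "(\<lambda>n. det (x n $ i)) \<longlonglongrightarrow> det (l $ i)"
      unfolding det_2 by (intro tendsto_diff tendsto_mult entry)
    moreover have "det (x n $ i) = 1" for n using x by (simp add: G_iff)
    ultimately show ?thesis by (simp add: LIMSEQ_const_iff)
  qed
  ultimately show "l \<in> G" by (simp add: G_iff)
qed

definition \<sigma>m :: "'i \<Rightarrow> 'k^2^2 \<Rightarrow> complex^2^2" where
  "\<sigma>m i A = (\<chi> a b. \<sigma> i (A $ a $ b))"

lemma \<sigma>m_nth [simp]: "\<sigma>m i A $ a $ b = \<sigma> i (A $ a $ b)"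
  by (simp add: \<sigma>m_def)

lemma \<sigma>m_mk2 [simp]: "\<sigma>m i (mk2 a b c d) = mk2 (\<sigma> i a) (\<sigma> i b) (\<sigma> i c) (\<sigma> i d)"
  by (simp add: eq_mk2_iff)

lemma \<sigma>m_mult: "\<sigma>m i (A ** B) = \<sigma>m i A ** \<sigma>m i B"
  by (simp add: vec_eq_iff matrix_matrix_mult_def \<sigma>_simps)

lemma \<sigma>m_adj2: "\<sigma>m i (adj2 A) = adj2 (\<sigma>m i A)"
  by (simp add: adj2_def \<sigma>_simps)

lemma det_\<sigma>m: "det (\<sigma>m i A) = \<sigma> i (det A)"
  by (simp add: det_2 \<sigma>_simps)

definition rational :: "('i \<Rightarrow> 'k^2^2) \<Rightarrow> complex^2^2^'i" where
  "rational q = (\<chi> i. \<sigma>m i (q i))"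

lemma rational_nth [simp]: "rational q $ i = \<sigma>m i (q i)"
  by (simp add: rational_def)

lemma rational_G: "(\<And>i. det (q i) = 1) \<Longrightarrow> rational q \<in> G"
  by (auto simp: G_iff det_\<sigma>m \<sigma>_completion \<sigma>_simps)

abbreviation "SLO \<equiv> SL2 {x::'k. algebraic_int x}"

lemma \<Gamma>_eq: "\<Gamma> = (\<lambda>A. rational (\<lambda>_. A)) ` SLO"
  unfolding hilbert_lattice_def rational_def diagonal_embedding_def \<sigma>m_def ..

lemma \<Gamma>_G: "\<gamma> \<in> \<Gamma> \<Longrightarrow> \<gamma> \<in> G"
  by (auto simp: \<Gamma>_eq SL2_def intro!: rational_G)

lemma gone_\<Gamma>: "gone \<in> \<Gamma>"
proof -
  have "mat 1 \<in> SLO" by (simp add: SL2_def det_I, simp add: mat_def)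
  moreover have "gone = rational (\<lambda>_. mat 1)" by (simp add: vec_eq_iff[of _ "rational _"] mk2_one \<sigma>_simps)
  ultimately show ?thesis by (auto simp: \<Gamma>_eq)
qed

lemma \<Gamma>_mult: "\<gamma> \<in> \<Gamma> \<Longrightarrow> \<gamma>' \<in> \<Gamma> \<Longrightarrow> gmult \<gamma> \<gamma>' \<in> \<Gamma>"
proof -
  assume "\<gamma> \<in> \<Gamma>" "\<gamma>' \<in> \<Gamma>"
  then obtain A B where AB: "A \<in> SLO" "B \<in> SLO" "\<gamma> = rational (\<lambda>_. A)" "\<gamma>' = rational (\<lambda>_. B)"
    by (auto simp: \<Gamma>_eq)
  have "gmult \<gamma> \<gamma>' = rational (\<lambda>_. A ** B)"
    by (simp add: AB vec_eq_iff[of "gmult _ _"] \<sigma>m_mult)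
  then show ?thesis using algebraic_int_SL2_mult[OF AB(1,2)] by (auto simp: \<Gamma>_eq)
qed

lemma \<Gamma>_ginv: "\<gamma> \<in> \<Gamma> \<Longrightarrow> ginv \<gamma> \<in> \<Gamma>"
proof -
  assume "\<gamma> \<in> \<Gamma>"
  then obtain A where A: "A \<in> SLO" "\<gamma> = rational (\<lambda>_. A)"
    by (auto simp: \<Gamma>_eq)
  have "ginv \<gamma> = rational (\<lambda>_. adj2 A)"
    by (simp add: A vec_eq_iff[of "ginv _"] \<sigma>m_adj2)
  then show ?thesis using algebraic_int_SL2_adj2[OF A(1)] by (auto simp: \<Gamma>_eq)
qed

text \<open>Discreteness of the lattice, inherited from that of the integers.\<close>
lemma finite_\<Gamma>_bounded: "finite (\<Gamma> \<inter> cball 0 r)"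
proof -
  let ?F = "{\<alpha>::'k. algebraic_int \<alpha> \<and> (\<forall>i. cmod (\<sigma> i \<alpha>) \<le> r)}"
  have fin: "finite ?F" by (rule finite_algebraic_int_bounded_places)
  have "\<Gamma> \<inter> cball 0 r \<subseteq> (\<lambda>(a, b, c, d). rational (\<lambda>_. mk2 a b c d)) ` (?F \<times> ?F \<times> ?F \<times> ?F)"
  proof
    fix \<gamma> assume "\<gamma> \<in> \<Gamma> \<inter> cball 0 r"
    then obtain A where A: "A \<in> SLO" "\<gamma> = rational (\<lambda>_. A)" "norm \<gamma> \<le> r"
      by (auto simp: \<Gamma>_eq)
    have "A $ a $ b \<in> ?F" for a b
    proof -
      have "cmod (\<sigma> i (A $ a $ b)) \<le> r" for i
        using cmod_entry_le_norm[of \<gamma> i a b] A(2,3) by simp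
      then show ?thesis using A(1) by (auto simp: SL2_def)
    qed
    then have F: "A $ a $ b \<in> ?F" for a b .
    obtain a b c d where abcd: "A = mk2 a b c d" by (rule mk2_cases)
    have "(a, b, c, d) \<in> ?F \<times> ?F \<times> ?F \<times> ?F"
      using F[of 1 1] F[of 1 2] F[of 2 1] F[of 2 2] unfolding abcd mk2_nth by blast
    then show "\<gamma> \<in> (\<lambda>(a, b, c, d). rational (\<lambda>_. mk2 a b c d)) ` (?F \<times> ?F \<times> ?F \<times> ?F)"
      by (rule image_eqI[rotated]) (simp add: A(2) abcd)
  qed
  then show ?thesis by (rule finite_subset) (intro finite_imageI finite_cartesian_product fin)
qed

lemma closed_\<Gamma>: "closed \<Gamma>"
proof (unfold closed_sequential_limits, intro allI impI, elim conjE)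
  fix x l assume x: "\<forall>n. x n \<in> \<Gamma>" and l: "x \<longlonglongrightarrow> l"
  then have "Bseq x" using Bseq_eq_bounded convergent_imp_Bseq convergentI by blast
  then obtain r where "\<And>n. norm (x n) \<le> r" by (auto simp: Bseq_def)
  then have "\<forall>n. x n \<in> \<Gamma> \<inter> cball 0 r" using x by auto
  then have "l \<in> \<Gamma> \<inter> cball 0 r"
    using closed_sequentially[OF finite_imp_closed[OF finite_\<Gamma>_bounded]] l by blast
  then show "l \<in> \<Gamma>" by blast
qed

text \<open>The identity component of the multiplicative group of the completion at \<open>i\<close>.\<close>
definition pos :: "'i \<Rightarrow> complex set" where
  "pos i = (if real_place i then complex_of_real ` {0<..} else - {0})"

lemma pos_simps:
  "1 \<in> pos i" "s \<in> pos i \<Longrightarrow> t \<in> pos i \<Longrightarrow> s * t \<in> pos i" "s \<in> pos i \<Longrightarrow> t \<in> pos i \<Longrightarrow> s / t \<in> pos i"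
  "t \<in> pos i \<Longrightarrow> t \<noteq> 0" "t \<in> pos i \<Longrightarrow> t \<in> completion (\<sigma> i)" "r > 0 \<Longrightarrow> complex_of_real r \<in> pos i"
  "t \<in> completion (\<sigma> i) \<Longrightarrow> t \<noteq> 0 \<Longrightarrow> t \<in> pos i \<or> - t \<in> pos i"
  "t \<in> completion (\<sigma> i) \<Longrightarrow> t \<noteq> 0 \<Longrightarrow> t * t \<in> pos i"
proof -
  show "1 \<in> pos i" by (auto simp: pos_def image_iff intro!: bexI[of _ 1])
  have real: "\<exists>r>0. t = complex_of_real r" if "t \<in> pos i" "real_place i" for t
    using that by (auto simp: pos_def)
  have of_real: "complex_of_real r \<in> pos i" if "r > 0" for r using that by (auto simp: pos_def)
  show "s * t \<in> pos i" "s / t \<in> pos i" if st: "s \<in> pos i" "t \<in> pos i"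
  proof -
    have "s * t \<in> pos i \<and> s / t \<in> pos i"
    proof (cases "real_place i")
      case True
      obtain a b where "a > 0" "s = complex_of_real a" "b > 0" "t = complex_of_real b"
        using real[OF st(1) True] real[OF st(2) True] by blast
      then show ?thesis using of_real[of "a * b"] of_real[of "a / b"] by simp
    qed (use st in \<open>auto simp: pos_def\<close>)
    then show "s * t \<in> pos i" "s / t \<in> pos i" by auto
  qed
  show "t \<in> pos i \<Longrightarrow> t \<noteq> 0" "t \<in> pos i \<Longrightarrow> t \<in> completion (\<sigma> i)" "r > 0 \<Longrightarrow> complex_of_real r \<in> pos i"
    by (auto simp: pos_def completion_eq split: if_splits)
  show "t \<in> completion (\<sigma> i) \<Longrightarrow> t \<noteq> 0 \<Longrightarrow> t \<in> pos i \<or> - t \<in> pos i"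
  proof (cases "real_place i")
    case True
    assume "t \<in> completion (\<sigma> i)" "t \<noteq> 0"
    then obtain r where r: "t = of_real r" "r \<noteq> 0" using True by (auto simp: completion_eq elim!: Reals_cases)
    then have "r > 0 \<or> - r > 0" by auto
    then show ?thesis using True r by (auto simp: pos_def image_iff simp flip: of_real_minus)
  qed (auto simp: pos_def)
  show "t * t \<in> pos i" if t: "t \<in> completion (\<sigma> i)" "t \<noteq> 0"
  proof (cases "real_place i")
    case True
    then obtain r where r: "t = of_real r" using t(1) by (auto simp: completion_eq elim!: Reals_cases)
    then have "r * r > 0" using t(2) by (auto simp: zero_less_mult_iff)
    then show ?thesis using of_real[of "r * r"] r by simp
  qed (use t in \<open>auto simp: pos_def\<close>)
qed

lemma pos_limit:
  assumes "\<And>n. t n \<in> pos i" "t \<longlonglongrightarrow> l" "l \<noteq> 0"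
  shows "l \<in> pos i"
proof (cases "real_place i")
  case True
  have t: "t n \<in> \<real> \<and> Re (t n) > 0" for n using assms(1)[of n] True by (auto simp: pos_def)
  have "l \<in> \<real>" using closed_sequentially[OF closed_complex_Reals _ assms(2)] t by blast
  moreover have "Re l \<ge> 0"
    using tendsto_Re[OF assms(2)] t by (intro LIMSEQ_le_const[of _ "Re l" 0]) (auto intro: less_imp_le)
  ultimately show ?thesis using True assms(3) by (auto simp: pos_def elim!: Reals_cases)
qed (use assms in \<open>auto simp: pos_def\<close>)

text \<open>
  At a real place the first diagonal entry is real and never zero, so by connectedness it cannot change sign.
\<close>
lemma diagonal_component_eq: "diagonal_component (\<sigma> i) = dg ` pos i"
proof -
  define T where "T = {A \<in> SL2 (completion (\<sigma> i)). A $ 1 $ 2 = 0 \<and> A $ 2 $ 1 = 0}"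
  have dgT: "dg t \<in> T" if "t \<in> completion (\<sigma> i)" "t \<noteq> 0" for t
    using that completion_closed(4)[OF \<sigma>_completion(3) that(1)] by (auto simp: T_def SL2_def mk2_def \<sigma>_completion det_2)
  have Tdg: "\<exists>t\<in>completion (\<sigma> i). t \<noteq> 0 \<and> A = dg t" if "A \<in> T" for A
  proof -
    have A: "A $ 1 $ 2 = 0" "A $ 2 $ 1 = 0" "A $ 1 $ 1 * A $ 2 $ 2 = 1" "A $ 1 $ 1 \<in> completion (\<sigma> i)"
      using that by (auto simp: T_def SL2_def det_2)
    then have "A $ 1 $ 1 \<noteq> 0" by auto
    then have "A = dg (A $ 1 $ 1)" using A by (simp add: eq_mk2_iff field_simps)
    then show ?thesis using A(4) \<open>A $ 1 $ 1 \<noteq> 0\<close> by metis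
  qed
  have one: "mat 1 = dg (1::complex)" by (simp add: mk2_one)
  have "connected (pos i)"
  proof (cases "real_place i")
    case True
    then show ?thesis unfolding pos_def
      by (auto intro!: connected_continuous_image continuous_intros)
  next
    case False
    then show ?thesis unfolding pos_def using connected_punctured_universe[of "0::complex"] by simp
  qed
  moreover have "continuous_on (pos i) dg"
    unfolding continuous_on_def using pos_simps(4)[of _ i] by (auto intro!: tendsto_mk2 tendsto_intros)
  ultimately have "connected (dg ` pos i)" by (rule connected_continuous_image[rotated])
  moreover have "mat 1 \<in> dg ` pos i" unfolding one using pos_simps(1)[of i] by blast
  moreover have "dg ` pos i \<subseteq> T" using dgT pos_simps(4,5)[of _ i] by blast
  ultimately have "dg ` pos i \<subseteq> connected_component_set T (mat 1)"
    by (intro connected_component_maximal)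
  moreover have "connected_component_set T (mat 1) \<subseteq> dg ` pos i"
  proof
    fix A assume A: "A \<in> connected_component_set T (mat 1)"
    let ?C = "connected_component_set T (mat 1)"
    have CT: "?C \<subseteq> T" by (rule connected_component_subset)
    with A obtain t where t: "t \<in> completion (\<sigma> i)" "t \<noteq> 0" "A = dg t" using Tdg by blast
    show "A \<in> dg ` pos i"
    proof (rule ccontr)
      assume n: "A \<notin> dg ` pos i"
      then have "real_place i" using t by (auto simp: pos_def)
      then have real: "x \<in> \<real>" if "x \<in> completion (\<sigma> i)" for x using that by (simp add: completion_eq)
      obtain r where r: "t = of_real r" using real[OF t(1)] by (auto elim!: Reals_cases)
      have "\<not> r > 0" using n t(3) r pos_simps(6)[of r i] by blast
      then have "r < 0" using r t(2) by auto
      let ?f = "\<lambda>A::complex^2^2. Re (A $ 1 $ 1)"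
      have "connected (?f ` ?C)"
        by (intro connected_continuous_image connected_connected_component)
          (auto simp: continuous_on_def intro!: tendsto_intros tendsto_vec_nth)
      moreover have "r \<in> ?f ` ?C" using A t(3) r by (force intro: image_eqI[of _ _ A])
      moreover have "mat 1 \<in> ?C" using A connected_component_eq_empty connected_component_refl_eq by blast
      then have "1 \<in> ?f ` ?C" by (force simp: mat_def intro: image_eqI[of _ _ "mat 1"])
      ultimately have "{r..1} \<subseteq> ?f ` ?C" by (simp add: connected_contains_Icc)
      then have "0 \<in> ?f ` ?C" using \<open>r < 0\<close> by auto
      then obtain B where B: "B \<in> ?C" "Re (B $ 1 $ 1) = 0" by auto
      then obtain s where s: "s \<in> completion (\<sigma> i)" "s \<noteq> 0" "B = dg s" using CT Tdg by blast
      then show False using B(2) real[OF s(1)] by (auto elim!: Reals_cases)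
    qed
  qed
  ultimately show ?thesis unfolding diagonal_component_def T_def by blast
qed

definition diag :: "('i \<Rightarrow> complex) \<Rightarrow> complex^2^2^'i" where
  "diag t = (\<chi> i. dg (t i))"

lemma diag_nth [simp]: "diag t $ i = dg (t i)"
  by (simp add: diag_def)

definition Pos :: "('i \<Rightarrow> complex) set" where
  "Pos = {t. \<forall>i. t i \<in> pos i}"

lemma D_eq: "D = diag ` Pos"
proof (intro equalityI subsetI)
  fix h assume "h \<in> D"
  then have "\<forall>i. \<exists>t\<in>pos i. h $ i = dg t" by (auto simp: D_group_def diagonal_component_eq)
  then obtain t where "\<And>i. t i \<in> pos i" "\<And>i. h $ i = dg (t i)" by metis
  then have "h = diag t" "t \<in> Pos" by (simp_all add: vec_eq_iff[of h] Pos_def)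
  then show "h \<in> diag ` Pos" by blast
qed (auto simp: D_group_def diagonal_component_eq Pos_def)

lemma diag_mult: "gmult (diag s) (diag t) = diag (\<lambda>i. s i * t i)"
  by (simp add: vec_eq_iff[of "gmult _ _"] dg_mult)

lemma ginv_diag: "ginv (diag t) = diag (\<lambda>i. 1 / t i)"
  by (simp add: vec_eq_iff[of "ginv _"])

lemma Pos_simps:
  "(\<lambda>_. 1) \<in> Pos" "s \<in> Pos \<Longrightarrow> t \<in> Pos \<Longrightarrow> (\<lambda>i. s i * t i) \<in> Pos" "t \<in> Pos \<Longrightarrow> (\<lambda>i. 1 / t i) \<in> Pos"
  "t \<in> Pos \<Longrightarrow> t i \<noteq> 0"
  unfolding Pos_def by (auto intro: pos_simps dest: pos_simps(4))

lemma diag_G: "t \<in> Pos \<Longrightarrow> diag t \<in> G"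
  using pos_simps(4,5) completion_closed(4)[OF \<sigma>_completion(3)]
  by (auto simp: G_iff Pos_def mk2_def det_2 \<sigma>_completion)

end


section \<open>The topology of the quotient\<close>

context hilbert_rank2
begin

text \<open>The preimage in the group of the orbit of \<open>D\<close> through the class of \<open>g\<close>.\<close>
definition dcoset :: "complex^2^2^'i \<Rightarrow> (complex^2^2^'i) set" where
  "dcoset g = {gmult d (gmult g \<gamma>) | d \<gamma>. d \<in> D \<and> \<gamma> \<in> \<Gamma>}"

lemma D_group_simps:
  "gone \<in> D" "d \<in> D \<Longrightarrow> d' \<in> D \<Longrightarrow> gmult d d' \<in> D" "d \<in> D \<Longrightarrow> ginv d \<in> D" "d \<in> D \<Longrightarrow> d \<in> G"
proof -
  have "gone = diag (\<lambda>_. 1)" by (simp add: vec_eq_iff[of _ "diag _"] mk2_one)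
  then show "gone \<in> D" unfolding D_eq using Pos_simps(1) by blast
  show "d \<in> D \<Longrightarrow> d' \<in> D \<Longrightarrow> gmult d d' \<in> D" unfolding D_eq using Pos_simps(2) by (auto simp: diag_mult)
  show "d \<in> D \<Longrightarrow> ginv d \<in> D" unfolding D_eq using Pos_simps(3) by (auto simp: ginv_diag)
  show "d \<in> D \<Longrightarrow> d \<in> G" unfolding D_eq using diag_G by auto
qed

lemma proj_eq_iff: "proj \<sigma> g = proj \<sigma> h \<longleftrightarrow> (\<exists>\<gamma>\<in>\<Gamma>. g = gmult h \<gamma>)"
proof
  assume "proj \<sigma> g = proj \<sigma> h"
  moreover have "g \<in> proj \<sigma> g" unfolding proj_def using gone_\<Gamma> by (auto intro!: image_eqI[of _ _ gone])
  ultimately show "\<exists>\<gamma>\<in>\<Gamma>. g = gmult h \<gamma>" by (auto simp: proj_def)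
next
  assume "\<exists>\<gamma>\<in>\<Gamma>. g = gmult h \<gamma>"
  then obtain \<gamma> where \<gamma>: "\<gamma> \<in> \<Gamma>" "g = gmult h \<gamma>" by blast
  have "gmult \<gamma> ` \<Gamma> = \<Gamma>"
  proof (intro equalityI subsetI)
    fix x assume "x \<in> \<Gamma>"
    then show "x \<in> gmult \<gamma> ` \<Gamma>"
      using \<Gamma>_mult[OF \<Gamma>_ginv[OF \<gamma>(1)]] ginv_cancel(2)[OF \<Gamma>_G[OF \<gamma>(1)]] by (metis image_eqI)
  qed (use \<Gamma>_mult \<gamma> in auto)
  then have "gmult h ` gmult \<gamma> ` \<Gamma> = gmult h ` \<Gamma>" by simp
  then show "proj \<sigma> g = proj \<sigma> h" unfolding proj_def \<gamma>(2) image_image gmult_assoc .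
qed

lemma translate_proj: "translate h (proj \<sigma> g) = proj \<sigma> (gmult h g)"
  by (simp add: translate_def proj_def image_image gmult_assoc)

lemma topspace_X: "topspace X = proj \<sigma> ` G"
proof (rule antisym)
  show "topspace X \<subseteq> proj \<sigma> ` G"
    using openin_topspace[of X] unfolding openin_hilbert_modular_space by blast
  have "{g \<in> G. proj \<sigma> g \<in> proj \<sigma> ` G} = G" by blast
  then have "openin X (proj \<sigma> ` G)"
    by (simp add: openin_hilbert_modular_space)
  then show "proj \<sigma> ` G \<subseteq> topspace X" by (rule openin_subset)
qed

lemma continuous_gmult: "continuous_on A (\<lambda>x. gmult x h)"
  unfolding continuous_on_def by (intro ballI tendsto_gmult tendsto_ident_at tendsto_const)

text \<open>
  The saturation of an open set is a union of right translates by lattice elements.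
\<close>
lemma openin_proj_image:
  assumes U: "openin (top_of_set G) U"
  shows "openin X (proj \<sigma> ` U)"
proof -
  have UG: "U \<subseteq> G" using openin_subset[OF U] by simp
  have "{g \<in> G. proj \<sigma> g \<in> proj \<sigma> ` U} = (\<Union>\<gamma>\<in>\<Gamma>. G \<inter> (\<lambda>x. gmult x \<gamma>) -` U)"
  proof (intro equalityI subsetI)
    fix g assume "g \<in> {g \<in> G. proj \<sigma> g \<in> proj \<sigma> ` U}"
    then obtain u where "g \<in> G" "u \<in> U" "proj \<sigma> u = proj \<sigma> g" by auto
    then show "g \<in> (\<Union>\<gamma>\<in>\<Gamma>. G \<inter> (\<lambda>x. gmult x \<gamma>) -` U)" unfolding proj_eq_iff by auto
  next
    fix g assume "g \<in> (\<Union>\<gamma>\<in>\<Gamma>. G \<inter> (\<lambda>x. gmult x \<gamma>) -` U)"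
    then obtain \<gamma> where g: "\<gamma> \<in> \<Gamma>" "g \<in> G" "gmult g \<gamma> \<in> U" by auto
    then have "proj \<sigma> (gmult g \<gamma>) = proj \<sigma> g" unfolding proj_eq_iff by blast
    then show "g \<in> {g \<in> G. proj \<sigma> g \<in> proj \<sigma> ` U}" using g by (metis (mono_tags) imageI mem_Collect_eq)
  qed
  moreover have "openin (top_of_set G) (G \<inter> (\<lambda>x. gmult x \<gamma>) -` U)" if "\<gamma> \<in> \<Gamma>" for \<gamma>
    by (rule continuous_openin_preimage[OF continuous_gmult _ U]) (use that G_closed_mult \<Gamma>_G in auto)
  then have "openin (top_of_set G) (\<Union>\<gamma>\<in>\<Gamma>. G \<inter> (\<lambda>x. gmult x \<gamma>) -` U)"
    by (intro openin_Union) blast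
  ultimately have "openin (top_of_set G) {g \<in> G. proj \<sigma> g \<in> proj \<sigma> ` U}" by (simp only:)
  then show ?thesis using UG by (auto simp: openin_hilbert_modular_space)
qed

lemma continuous_map_proj: "continuous_map (top_of_set G) X (proj \<sigma>)"
  unfolding continuous_map_def by (auto simp: topspace_X openin_hilbert_modular_space)

text \<open>
  Since the projection is open and continuous, closures of images can be computed in the group.
\<close>
lemma closure_of_proj_image:
  assumes T: "T \<subseteq> G" and inv: "\<And>t \<gamma>. t \<in> T \<Longrightarrow> \<gamma> \<in> \<Gamma> \<Longrightarrow> gmult t \<gamma> \<in> T"
  shows "X closure_of (proj \<sigma> ` T) = proj \<sigma> ` closure T"
proof -
  have cG: "closure T \<subseteq> G" using T closed_G by (simp add: closure_minimal)
  have "proj \<sigma> x \<in> X closure_of (proj \<sigma> ` T) \<longleftrightarrow> x \<in> closure T" if x: "x \<in> G" for x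
  proof
    assume L: "proj \<sigma> x \<in> X closure_of (proj \<sigma> ` T)"
    show "x \<in> closure T"
    proof (rule ccontr)
      assume nx: "x \<notin> closure T"
      have "openin (top_of_set G) (G - closure T)"
        unfolding Diff_eq by (intro openin_open_Int open_Compl closed_closure)
      then have "openin X (proj \<sigma> ` (G - closure T))" by (rule openin_proj_image)
      moreover have "proj \<sigma> x \<in> proj \<sigma> ` (G - closure T)" using x nx by blast
      ultimately obtain y where "y \<in> proj \<sigma> ` T" "y \<in> proj \<sigma> ` (G - closure T)"
        using L unfolding in_closure_of by meson
      then obtain u where u: "u \<in> G - closure T" "proj \<sigma> u \<in> proj \<sigma> ` T" by blast
      then obtain t \<gamma> where "t \<in> T" "\<gamma> \<in> \<Gamma>" "u = gmult t \<gamma>" by (auto simp: proj_eq_iff)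
      then have "u \<in> T" using inv by blast
      then show False using u(1) closure_subset by blast
    qed
  next
    assume c: "x \<in> closure T"
    show "proj \<sigma> x \<in> X closure_of (proj \<sigma> ` T)"
      unfolding in_closure_of
    proof (intro conjI allI impI, goal_cases)
      case 1
      show ?case using x by (auto simp: topspace_X)
    next
      case (2 V)
      then have "openin (top_of_set G) {g \<in> G. proj \<sigma> g \<in> V}" by (simp add: openin_hilbert_modular_space)
      then obtain W where W: "open W" "{g \<in> G. proj \<sigma> g \<in> V} = G \<inter> W" by (auto simp: openin_open)
      then have "x \<in> W" using 2 x by blast
      then obtain t where "t \<in> T" "t \<in> W" using c W(1) closure_iff_nhds_not_empty[of x T] by blast
      then show ?case using W(2) T by blast
    qed
  qed
  moreover have "X closure_of (proj \<sigma> ` T) \<subseteq> proj \<sigma> ` G"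
    using closure_of_subset_topspace[of X] by (simp add: topspace_X)
  ultimately show ?thesis using cG by blast
qed

lemma dcoset_G: "g \<in> G \<Longrightarrow> dcoset g \<subseteq> G"
  unfolding dcoset_def using G_closed_mult D_group_simps(4) \<Gamma>_G by blast

lemma dcosetI: "d \<in> D \<Longrightarrow> \<gamma> \<in> \<Gamma> \<Longrightarrow> gmult d (gmult g \<gamma>) \<in> dcoset g"
  by (auto simp: dcoset_def)

lemma dcoset_self: "g \<in> dcoset g"
  using dcosetI[OF D_group_simps(1) gone_\<Gamma>, of g] by simp

lemma dcoset_closed:
  assumes "x \<in> dcoset g" "d \<in> D" "\<gamma> \<in> \<Gamma>"
  shows "gmult d (gmult x \<gamma>) \<in> dcoset g"
proof -
  obtain e \<delta> where x: "e \<in> D" "\<delta> \<in> \<Gamma>" "x = gmult e (gmult g \<delta>)" using assms(1) by (auto simp: dcoset_def)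
  have "gmult d (gmult x \<gamma>) = gmult (gmult d e) (gmult g (gmult \<delta> \<gamma>))"
    by (simp add: x gmult_assoc)
  then show ?thesis using x assms D_group_simps(2) \<Gamma>_mult dcosetI by metis
qed

lemma dcoset_eq:
  assumes "x \<in> dcoset g"
  shows "dcoset x = dcoset g"
proof
  show "dcoset x \<subseteq> dcoset g" using dcoset_closed[OF assms] by (auto simp: dcoset_def[of x])
  obtain d \<gamma> where x: "d \<in> D" "\<gamma> \<in> \<Gamma>" "x = gmult d (gmult g \<gamma>)" using assms by (auto simp: dcoset_def)
  then have "g = gmult (ginv d) (gmult x (ginv \<gamma>))"
    using ginv_cancel[OF D_group_simps(4)] ginv_cancel[OF \<Gamma>_G] by (metis gmult_assoc)
  then have "g \<in> dcoset x" using dcosetI[OF D_group_simps(3)[OF x(1)] \<Gamma>_ginv[OF x(2)]] by metis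
  then show "dcoset g \<subseteq> dcoset x" using dcoset_closed[of g x] by (auto simp: dcoset_def[of g])
qed

lemma orbit_eq: "orbit D (proj \<sigma> g) = proj \<sigma> ` dcoset g"
proof (intro equalityI subsetI)
  fix y assume "y \<in> orbit D (proj \<sigma> g)"
  then obtain d where "d \<in> D" "y = proj \<sigma> (gmult d (gmult g gone))"
    by (auto simp: orbit_def translate_proj)
  then show "y \<in> proj \<sigma> ` dcoset g" using dcosetI[OF _ gone_\<Gamma>] by blast
next
  fix y assume "y \<in> proj \<sigma> ` dcoset g"
  then obtain d \<gamma> where d: "d \<in> D" "\<gamma> \<in> \<Gamma>" "y = proj \<sigma> (gmult d (gmult g \<gamma>))" by (auto simp: dcoset_def)
  have "gmult d (gmult g \<gamma>) = gmult (gmult d g) \<gamma>" by (simp add: gmult_assoc)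
  then have "y = proj \<sigma> (gmult d g)" unfolding d(3) proj_eq_iff using d(2) by blast
  then show "y \<in> orbit D (proj \<sigma> g)" using d(1) by (auto simp: orbit_def translate_proj)
qed

lemma proj_mem_dcoset: "proj \<sigma> x \<in> proj \<sigma> ` dcoset g \<Longrightarrow> x \<in> dcoset g"
  using dcoset_closed[OF _ D_group_simps(1)] by (fastforce simp: proj_eq_iff)

lemma closure_of_orbit:
  assumes "g \<in> G"
  shows "X closure_of orbit D (proj \<sigma> g) = proj \<sigma> ` closure (dcoset g)"
  unfolding orbit_eq
proof (rule closure_of_proj_image[OF dcoset_G[OF assms]])
  fix t \<gamma> assume "t \<in> dcoset g" "\<gamma> \<in> \<Gamma>"
  then show "gmult t \<gamma> \<in> dcoset g" using dcoset_closed[OF _ D_group_simps(1), of t g \<gamma>] by simp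
qed

lemma closedin_orbit:
  assumes "g \<in> G" "closure (dcoset g) \<subseteq> dcoset g"
  shows "closedin X (orbit D (proj \<sigma> g))"
proof -
  have "closure (dcoset g) = dcoset g" using assms(2) closure_subset by blast
  then have "X closure_of orbit D (proj \<sigma> g) = orbit D (proj \<sigma> g)"
    using closure_of_orbit[OF assms(1)] by (simp add: orbit_eq)
  then show ?thesis by (simp add: closure_of_eq)
qed

lemma compactin_bounded:
  assumes C: "compactin X C"
  shows "\<exists>r. C \<subseteq> proj \<sigma> ` (G \<inter> ball 0 r)"
proof -
  let ?U = "\<lambda>n::nat. proj \<sigma> ` (G \<inter> ball 0 (real n))"
  have "openin X (?U n)" for n by (intro openin_proj_image openin_open_Int) auto
  moreover have "C \<subseteq> \<Union> (range ?U)"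
  proof
    fix y assume "y \<in> C"
    then obtain g where "g \<in> G" "y = proj \<sigma> g" using compactin_subset_topspace[OF C] by (auto simp: topspace_X)
    moreover obtain n :: nat where "norm g < n" using reals_Archimedean2 by blast
    ultimately have "y \<in> ?U n" by simp
    then show "y \<in> \<Union> (range ?U)" by blast
  qed
  ultimately obtain F where F: "finite F" "F \<subseteq> range ?U" "C \<subseteq> \<Union>F"
    using C[unfolded compactin_def, THEN conjunct2, rule_format, of "range ?U"] by auto
  obtain N where N: "finite N" "F = ?U ` N" using finite_subset_image[OF F(1,2)] by blast
  have "?U n \<subseteq> ?U (Max (insert 0 N))" if "n \<in> N" for n
  proof -
    have "n \<le> Max (insert 0 N)" using N(1) that by simp
    then have "ball (0 :: complex^2^2^'i) (real n) \<subseteq> ball 0 (real (Max (insert 0 N)))"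
      by (intro subset_ball) simp
    then show ?thesis by blast
  qed
  then have "C \<subseteq> ?U (Max (insert 0 N))" using F(3) N(2) by blast
  then show ?thesis by blast
qed

lemma compactin_proj_image:
  assumes "compact K" "K \<subseteq> G"
  shows "compactin X (proj \<sigma> ` K)"
  by (rule image_compactin[OF _ continuous_map_proj]) (use assms in \<open>simp add: compactin_subtopology\<close>)

text \<open>
  By properness, the elements of the factor that carry the point into the image of a closed ball form a compact set.
\<close>
lemma divergent_orbit_escapes:
  assumes dv: "divergent_orbit \<sigma> (D_factor \<sigma> i) (proj \<sigma> g)" and g: "g \<in> G"
    and h: "\<And>k. h k \<in> D_factor \<sigma> i" "\<And>k. norm (h k) \<ge> real k"
  shows "finite {k. \<exists>\<gamma>\<in>\<Gamma>. norm (gmult (h k) (gmult g \<gamma>)) \<le> \<rho>}"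
proof -
  let ?K = "proj \<sigma> ` (G \<inter> cball 0 \<rho>)"
  have "compactin X ?K"
    by (intro compactin_proj_image closed_Int_compact closed_G) auto
  from compactin_proper_map_preimage[OF dv[unfolded divergent_orbit_def] this]
  have "compact {h \<in> D_factor \<sigma> i. translate h (proj \<sigma> g) \<in> ?K}"
    by (simp add: compactin_subtopology)
  then obtain b where b: "\<And>x. x \<in> {h \<in> D_factor \<sigma> i. translate h (proj \<sigma> g) \<in> ?K} \<Longrightarrow> norm x \<le> b"
    using compact_imp_bounded[of "{h \<in> D_factor \<sigma> i. translate h (proj \<sigma> g) \<in> ?K}"]
    unfolding bounded_iff by blast
  have "{k. \<exists>\<gamma>\<in>\<Gamma>. norm (gmult (h k) (gmult g \<gamma>)) \<le> \<rho>} \<subseteq> {..nat \<lceil>b\<rceil>}"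
  proof
    fix k assume "k \<in> {k. \<exists>\<gamma>\<in>\<Gamma>. norm (gmult (h k) (gmult g \<gamma>)) \<le> \<rho>}"
    then obtain \<gamma> where \<gamma>: "\<gamma> \<in> \<Gamma>" "norm (gmult (h k) (gmult g \<gamma>)) \<le> \<rho>" by blast
    have "h k \<in> D"
    proof -
      have "mat 1 = dg (1::complex)" by (simp add: mk2_one)
      then have "mat 1 \<in> diagonal_component (\<sigma> j)" for j
        unfolding diagonal_component_eq using pos_simps(1)[of j] by blast
      moreover have "h k $ i \<in> diagonal_component (\<sigma> i)" "\<And>j. j \<noteq> i \<Longrightarrow> h k $ j = mat 1"
        using h(1)[of k] unfolding D_factor_def by blast+
      ultimately have "h k $ j \<in> diagonal_component (\<sigma> j)" for j by (cases "j = i") simp_all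
      then show ?thesis unfolding D_group_def by simp
    qed
    then have G: "gmult (h k) (gmult g \<gamma>) \<in> G" using g \<gamma>(1)
      G_closed_mult D_group_simps(4) \<Gamma>_G by blast
    have "gmult (h k) (gmult g \<gamma>) = gmult (gmult (h k) g) \<gamma>" by (simp add: gmult_assoc)
    then have "proj \<sigma> (gmult (h k) (gmult g \<gamma>)) = translate (h k) (proj \<sigma> g)"
      unfolding translate_proj proj_eq_iff using \<gamma>(1) by blast
    moreover have "gmult (h k) (gmult g \<gamma>) \<in> G \<inter> cball 0 \<rho>" using G \<gamma>(2) by simp
    ultimately have "translate (h k) (proj \<sigma> g) \<in> ?K" by (metis imageI)
    then have "norm (h k) \<le> b" using b h(1) by blast
    then have "real k \<le> b" using h(2)[of k] by linarith
    then show "k \<in> {..nat \<lceil>b\<rceil>}" by (simp add: le_nat_iff) linarith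
  qed
  then show ?thesis using finite_subset by blast
qed

end


section \<open>Divergence forces rational rows\<close>

context hilbert_rank2
begin

text \<open>
  The linear forms given by the rows of a group element, on the images of the vectors of \<open>K\<^sup>2\<close>.
\<close>
definition form :: "complex^2^2^'i \<Rightarrow> 'i \<Rightarrow> 2 \<Rightarrow> 'k^2 \<Rightarrow> complex" where
  "form y i r v = y $ i $ r $ 1 * \<sigma> i (v $ 1) + y $ i $ r $ 2 * \<sigma> i (v $ 2)"

lemma form_gmult: "form (gmult h y) i r v = h $ i $ r $ 1 * form y i 1 v + h $ i $ r $ 2 * form y i 2 v"
  by (simp add: form_def matrix_matrix_mult_def sum_2 algebra_simps)

lemma form_diag:
  "form (gmult (diag t) y) i 1 v = t i * form y i 1 v"
  "form (gmult (diag t) y) i 2 v = form y i 2 v / t i"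
  by (simp_all add: form_gmult)

lemma form_nonzero:
  assumes "y \<in> G" "v \<noteq> 0"
  shows "\<exists>r. form y i r v \<noteq> 0"
proof (rule ccontr)
  assume "\<nexists>r. form y i r v \<noteq> 0"
  then have z: "form y i 1 v = 0" "form y i 2 v = 0" by auto
  have d: "y $ i $ 1 $ 1 * y $ i $ 2 $ 2 - y $ i $ 1 $ 2 * y $ i $ 2 $ 1 = 1"
    using assms(1) by (simp add: G_iff det_2)
  have "y $ i $ 2 $ 2 * form y i 1 v - y $ i $ 1 $ 2 * form y i 2 v
      = (y $ i $ 1 $ 1 * y $ i $ 2 $ 2 - y $ i $ 1 $ 2 * y $ i $ 2 $ 1) * \<sigma> i (v $ 1)"
    "y $ i $ 1 $ 1 * form y i 2 v - y $ i $ 2 $ 1 * form y i 1 v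
      = (y $ i $ 1 $ 1 * y $ i $ 2 $ 2 - y $ i $ 1 $ 2 * y $ i $ 2 $ 1) * \<sigma> i (v $ 2)"
    by (simp_all add: form_def algebra_simps)
  then have "\<sigma> i (v $ 1) = 0" "\<sigma> i (v $ 2) = 0" using z d by simp_all
  then have "v = 0" by (simp add: \<sigma>_simps vec_eq_iff forall_2)
  then show False using assms(2) by simp
qed

abbreviation integral_vec :: "'k^2 \<Rightarrow> bool" where
  "integral_vec v \<equiv> algebraic_int (v $ 1) \<and> algebraic_int (v $ 2)"

text \<open>
  Minkowski's theorem for the translates of \<open>g\<close> by \<open>diag (2\<^sup>-\<^sup>k, 2\<^sup>k)\<close> at the place \<open>i\<close>:
  the bound is uniform in \<open>k\<close> because these translations preserve volume.
\<close>
lemma exists_short_vector: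
  assumes ij: "i \<noteq> j" and g: "g \<in> G"
  shows "\<exists>C>0. \<forall>k::nat. \<exists>v. v \<noteq> 0 \<and> integral_vec v \<and>
    cmod (form g i 1 v) \<le> C * 2 ^ k \<and> cmod (form g i 2 v) \<le> C / 2 ^ k \<and> (\<forall>r. cmod (form g j r v) \<le> C)"
proof -
  obtain B :: "'k set" where B: "integral_basis B" using integral_basis_exists[OF nf] by blast
  then have B': "finite B" "rat_vs.independent B" "\<And>b. b \<in> B \<Longrightarrow> algebraic_int b"
    by (auto simp: integral_basis_def)
  define T where "T = B \<times> (UNIV::2 set)"
  define w where "w = (\<lambda>(l, r) (b, c). g $ l $ r $ c * \<sigma> l b)"
  have T: "finite T" "card T = 2 * card B" using B' by (simp_all add: T_def)
  define S where "S p = (\<Sum>t\<in>T. cmod (w p t))" for p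
  define W where "W = (\<Sum>p\<in>UNIV. S p)"
  have Snn: "S p \<ge> 0" for p unfolding S_def by (intro sum_nonneg) auto
  have SW: "S p \<le> W" for p unfolding W_def by (intro member_le_sum) (auto simp: Snn)
  define C where "C = 4 * (W + 1)"
  have "W \<ge> 0" using Snn SW order_trans by blast
  then have C: "C > 0" by (simp add: C_def)
  have "\<exists>v. v \<noteq> 0 \<and> integral_vec v \<and>
    cmod (form g i 1 v) \<le> C * 2 ^ k \<and> cmod (form g i 2 v) \<le> C / 2 ^ k \<and> (\<forall>r. cmod (form g j r v) \<le> C)" for k :: nat
  proof -
    \<comment> \<open>With coefficients up to \<open>2\<^sup>k\<close> the forms range up to \<open>2\<^sup>k\<close>; the cells are chosen so that all four forms have bounded size after the translation by \<open>diag (2\<^sup>-\<^sup>k, 2\<^sup>k)\<close> at \<open>i\<close>.\<close>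
    define A :: "'i \<times> 2 \<Rightarrow> nat" where "A = (\<lambda>(l, r). if l = i then (if r = 1 then 1 else 4 ^ k) else 2 ^ k)"
    define d where "d = (\<lambda>(l :: 'i, r :: 2). local_degree l)"
    have "\<exists>z. (\<exists>t\<in>T. z t \<noteq> 0) \<and> (\<forall>p\<in>UNIV. cmod (\<Sum>t\<in>T. of_int (z t) * w p t)
        \<le> 4 * (real (2 ^ k) * (\<Sum>t\<in>T. cmod (w p t)) + 1) / A p)"
    proof (rule small_integral_combination[where d = d])
      show "1 \<le> A p" for p by (auto simp: A_def split: prod.splits)
      show "2 \<le> d p \<or> 1 \<le> d p \<and> (\<forall>t\<in>T. Im (w p t) = 0)" for p
      proof -
        obtain l r where p: "p = (l, r)" by (cases p)
        show ?thesis
        proof (cases "real_place l")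
          case True
          have "Im (g $ l $ r $ c * \<sigma> l b) = 0" for c b
          proof -
            have "g $ l $ r $ c \<in> completion (\<sigma> l)" using g unfolding G_iff by blast
            then have "g $ l $ r $ c \<in> \<real>" using True by (simp add: completion_eq)
            then show ?thesis using True by (auto simp: real_place_def complex_is_Real_iff)
          qed
          then show ?thesis using local_degree_pos[of l] by (auto simp: p d_def w_def)
        next
          case False
          then show ?thesis using local_degree_complex[of l] by (auto simp: p d_def real_place_def)
        qed
      qed
      have "(\<Prod>p\<in>UNIV. A p ^ d p) = (\<Prod>l\<in>{i, j}. \<Prod>r\<in>(UNIV::2 set). A (l, r) ^ local_degree l)"
        unfolding UNIV_Times_UNIV[symmetric] UNIV_places[OF ij, symmetric] d_def
        by (subst prod.cartesian_product) (simp add: case_prod_unfold)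
      also have "\<dots> = (2 ^ k) ^ card T"
      proof -
        have "(4::nat) ^ k = 2 ^ k * 2 ^ k" by (simp flip: power_mult_distrib)
        then have "(\<Prod>l\<in>{i, j}. \<Prod>r\<in>(UNIV::2 set). A (l, r) ^ local_degree l)
            = (2 ^ k) ^ (2 * (local_degree i + local_degree j))"
          using ij unfolding UNIV_2 by (simp add: A_def power_mult_distrib power_add mult_2)
        then show ?thesis using T(2) local_degree_sum[OF ij B] by simp
      qed
      also have "\<dots> < (2 ^ k + 1) ^ card T"
        using T(2) local_degree_sum[OF ij B] local_degree_pos[of i] by (intro power_strict_mono) auto
      finally show "(\<Prod>p\<in>UNIV. A p ^ d p) < (2 ^ k + 1) ^ card T" .
    qed (use T in auto)
    then obtain z where z: "\<exists>t\<in>T. z t \<noteq> 0"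
      and zb: "\<And>p. cmod (\<Sum>t\<in>T. of_int (z t) * w p t) \<le> 4 * (real (2 ^ k) * S p + 1) / A p"
      by (auto simp: S_def)
    define v :: "'k^2" where "v = (\<chi> c. \<Sum>b\<in>B. of_int (z (b, c)) * b)"
    have form_v: "form g l r v = (\<Sum>t\<in>T. of_int (z t) * w (l, r) t)" for l r
    proof -
      have "(\<Sum>t\<in>T. of_int (z t) * w (l, r) t) = (\<Sum>b\<in>B. \<Sum>c\<in>(UNIV::2 set). of_int (z (b, c)) * w (l, r) (b, c))"
        unfolding T_def by (subst sum.cartesian_product) (simp add: case_prod_unfold)
      also have "\<dots> = form g l r v"
        by (simp add: UNIV_2 form_def v_def w_def \<sigma>_simps sum.distrib sum_distrib_left ac_simps)
      finally show ?thesis by simp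
    qed
    have bound: "cmod (form g l r v) \<le> C * 2 ^ k / A (l, r)" for l r
    proof -
      have "real (2 ^ k) * S (l, r) \<le> real (2 ^ k) * W" by (intro mult_left_mono SW) auto
      moreover have "(1::real) \<le> 2 ^ k" by simp
      moreover have "C * 2 ^ k = 4 * (real (2 ^ k) * W) + 4 * 2 ^ k" by (simp add: C_def algebra_simps)
      ultimately have "4 * (real (2 ^ k) * S (l, r) + 1) \<le> C * 2 ^ k" by argo
      then have "4 * (real (2 ^ k) * S (l, r) + 1) / A (l, r) \<le> C * 2 ^ k / A (l, r)" by (intro divide_right_mono) auto
      then show ?thesis using zb[of "(l, r)"] unfolding form_v by linarith
    qed
    have "v \<noteq> 0"
    proof
      assume "v = 0"
      then have "(\<Sum>b\<in>B. of_rat (of_int (z (b, c))) * b) = 0" for c by (simp add: v_def vec_eq_iff)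
      then have "\<forall>b\<in>B. (of_int (z (b, c)) :: rat) = 0" for c
        using rat_vs.independentD[OF B'(2) B'(1) order.refl, of "\<lambda>b. of_int (z (b, c))"] by blast
      then show False using z by (auto simp: T_def)
    qed
    moreover have "algebraic_int (v $ c)" for c unfolding v_def vec_lambda_beta
      by (rule algebraic_int_sum, rule algebraic_int_add_mult(2)) (simp_all add: B'(3))
    moreover have "cmod (form g i 2 v) \<le> C / 2 ^ k"
    proof -
      have "C * 2 ^ k / real (4 ^ k) = C / 2 ^ k"
        by (simp add: field_simps flip: power_mult_distrib)
      then show ?thesis using bound[of i 2] by (simp add: A_def)
    qed
    ultimately show ?thesis using bound[of i 1] bound[of j] ij by (intro exI[of _ v]) (simp add: A_def)
  qed
  then show ?thesis using C by blast
qed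

definition parallel :: "'k^2 \<Rightarrow> 'k^2 \<Rightarrow> bool" where
  "parallel u v \<longleftrightarrow> u $ 1 * v $ 2 = u $ 2 * v $ 1"

lemma parallel_trans:
  assumes "parallel x y" "parallel y z" "y \<noteq> 0"
  shows "parallel x z"
proof -
  have "y $ 1 * (x $ 1 * z $ 2 - x $ 2 * z $ 1) = 0" "y $ 2 * (x $ 1 * z $ 2 - x $ 2 * z $ 1) = 0"
    using assms(1,2) unfolding parallel_def by algebra+
  moreover have "y $ 1 \<noteq> 0 \<or> y $ 2 \<noteq> 0" using assms(3) by (auto simp: vec_eq_iff forall_2)
  ultimately show ?thesis unfolding parallel_def by auto
qed

lemma parallel_scale:
  assumes "parallel u v" "v \<noteq> 0"
  shows "\<exists>s. \<forall>c. u $ c = s * v $ c"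
proof (cases "v $ 1 = 0")
  case True
  then have "v $ 2 \<noteq> 0" using assms(2) by (auto simp: vec_eq_iff forall_2)
  then show ?thesis using assms(1) True by (intro exI[of _ "u $ 2 / v $ 2"]) (auto simp: forall_2 parallel_def)
next
  case False
  then show ?thesis using assms(1) by (intro exI[of _ "u $ 1 / v $ 1"]) (auto simp: forall_2 parallel_def field_simps)
qed

text \<open>
  If the second row of \<open>g\<close> at \<open>i\<close> has no rational zero, the line of a short vector cannot
  stay short, since its contribution at \<open>i\<close> to the norm tends to zero.
\<close>
lemma finite_parallel_short:
  assumes ij: "i \<noteq> j" and g: "g \<in> G" and irr: "\<And>v. v \<noteq> 0 \<Longrightarrow> form g i 2 v \<noteq> 0"
    and v: "\<And>k::nat. v k \<noteq> 0 \<and> integral_vec (v k) \<and> cmod (form g i 2 (v k)) \<le> C / 2 ^ k \<and> (\<forall>r. cmod (form g j r (v k)) \<le> C)"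
    and u: "u \<noteq> 0"
  shows "finite {k. parallel (v k) u}"
proof -
  obtain c where c: "u $ c \<noteq> 0" using u by (auto simp: vec_eq_iff)
  obtain r where r: "form g j r u \<noteq> 0" using form_nonzero[OF g u] by blast
  define w where "w = form g i 2 u"
  have w: "w \<noteq> 0" using irr[OF u] by (simp add: w_def)
  obtain \<mu> where \<mu>: "\<mu> > 0" "\<And>\<alpha>. algebraic_int \<alpha> \<Longrightarrow> \<alpha> \<noteq> 0 \<Longrightarrow>
      cmod (\<sigma> j \<alpha>) \<le> C / cmod (form g j r u) * cmod (\<sigma> j (u $ c)) \<Longrightarrow> \<mu> \<le> cmod (\<sigma> i \<alpha>)"
    using algebraic_int_lower_bound[OF ij] by metis
  define K where "K = C * cmod (\<sigma> i (u $ c)) / (cmod w * \<mu>)"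
  have "{k. parallel (v k) u} \<subseteq> {k. real k \<le> K}"
  proof clarify
    fix k assume "parallel (v k) u"
    then obtain s where s: "\<And>c. v k $ c = s * u $ c" using parallel_scale[OF _ u] by blast
    have "s \<noteq> 0" using v[of k] s by (auto simp: vec_eq_iff)
    have f: "form g l r (v k) = \<sigma> l s * form g l r u" for l r
      by (simp add: form_def s \<sigma>_simps algebra_simps)
    have j: "cmod (\<sigma> j s) \<le> C / cmod (form g j r u)"
      using v[of k] r by (auto simp: f norm_mult field_simps)
    have i: "cmod (\<sigma> i s) \<le> C / 2 ^ k / cmod w"
      using v[of k] w by (auto simp: f norm_mult field_simps w_def)
    have "\<mu> \<le> cmod (\<sigma> i (v k $ c))"
    proof (rule \<mu>(2))
      show "algebraic_int (v k $ c)" using v[of k] exhaust_2[of c] by auto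
      show "v k $ c \<noteq> 0" using s \<open>s \<noteq> 0\<close> c by simp
      show "cmod (\<sigma> j (v k $ c)) \<le> C / cmod (form g j r u) * cmod (\<sigma> j (u $ c))"
        unfolding s \<sigma>_simps norm_mult by (intro mult_right_mono j) auto
    qed
    also have "\<dots> \<le> C / 2 ^ k / cmod w * cmod (\<sigma> i (u $ c))"
      unfolding s \<sigma>_simps norm_mult by (intro mult_right_mono i) auto
    finally have "2 ^ k * \<mu> * cmod w \<le> C * cmod (\<sigma> i (u $ c))"
      using w by (simp add: field_simps)
    then have "2 ^ k \<le> K" using \<mu>(1) w by (simp add: K_def field_simps)
    moreover have "real k \<le> 2 ^ k" using less_exp[of k] by (metis less_imp_le of_nat_le_iff of_nat_numeral of_nat_power)
    ultimately show "real k \<le> K" by linarith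
  qed
  moreover have "finite {k::nat. real k \<le> K}"
    by (rule finite_subset[of _ "{..nat \<lceil>K\<rceil>}"]) (auto simp: le_nat_iff, linarith)
  ultimately show ?thesis by (rule finite_subset)
qed

lemma infinite_nonparallel:
  assumes nz: "\<And>k::nat. v k \<noteq> 0" and fin: "\<And>u. u \<noteq> 0 \<Longrightarrow> finite {k. parallel (v k) u}"
  shows "infinite {k. \<not> parallel (v (Suc k)) (v k)}"
proof
  assume "finite {k. \<not> parallel (v (Suc k)) (v k)}"
  then obtain K where K: "\<And>k. \<not> parallel (v (Suc k)) (v k) \<Longrightarrow> k < K"
    unfolding finite_nat_set_iff_bounded by blast
  have "parallel (v k) (v K)" if "k \<ge> K" for k
    using that
  proof (induction k rule: dec_induct)
    case base
    show ?case by (simp add: parallel_def)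
  next
    case (step k)
    then show ?case using K[of k] parallel_trans[OF _ step.IH nz] by force
  qed
  then have "{K..} \<subseteq> {k. parallel (v k) (v K)}" by auto
  then show False using fin[OF nz[of K]] finite_subset infinite_Ici by blast
qed

text \<open>
  Integral matrices of equal nonzero determinant \<open>\<delta>\<close> that are congruent modulo \<open>\<delta>\<close> differ
  by a left factor in the lattice.
\<close>
lemma congruent_matrices:
  assumes F: "\<And>a b. algebraic_int (F $ a $ b)" "det F = \<delta>" and M: "det M = \<delta>" "\<delta> \<noteq> (0::'k)"
    and cong: "\<And>a b. algebraic_int ((M $ a $ b - F $ a $ b) / \<delta>)"
  shows "\<exists>A\<in>SLO. A = M ** (\<chi> a b. adj2 F $ a $ b / \<delta>)"
proof -
  obtain a b c d where M': "M = mk2 a b c d" by (rule mk2_cases)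
  obtain a0 b0 c0 d0 where F': "F = mk2 a0 b0 c0 d0" by (rule mk2_cases)
  have dM: "a * d - b * c = \<delta>" and dF: "a0 * d0 - b0 * c0 = \<delta>" using M F by (simp_all add: M' F')
  have int: "algebraic_int a0" "algebraic_int b0" "algebraic_int c0" "algebraic_int d0"
    using F(1)[of 1 1] F(1)[of 1 2] F(1)[of 2 1] F(1)[of 2 2] by (simp_all add: F')
  have co: "algebraic_int ((a - a0) / \<delta>)" "algebraic_int ((b - b0) / \<delta>)" "algebraic_int ((c - c0) / \<delta>)" "algebraic_int ((d - d0) / \<delta>)"
    using cong[of 1 1] cong[of 1 2] cong[of 2 1] cong[of 2 2] by (simp_all add: F' M')
  define A where "A = M ** (\<chi> a b. adj2 F $ a $ b / \<delta>)"
  have "(\<chi> a b. adj2 F $ a $ b / \<delta>) = mk2 (d0 / \<delta>) (- b0 / \<delta>) (- c0 / \<delta>) (a0 / \<delta>)"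
    by (simp add: eq_mk2_iff F')
  then have "A = mk2 ((a * d0 - b * c0) / \<delta>) ((b * a0 - a * b0) / \<delta>) ((c * d0 - d * c0) / \<delta>) ((d * a0 - c * b0) / \<delta>)"
    using M(2) by (simp add: A_def M' mk2_mult field_simps)
  also have "\<dots> = mk2 (1 + ((a - a0) / \<delta> * d0 - (b - b0) / \<delta> * c0)) ((b - b0) / \<delta> * a0 - (a - a0) / \<delta> * b0)
     ((c - c0) / \<delta> * d0 - (d - d0) / \<delta> * c0) (1 + ((d - d0) / \<delta> * a0 - (c - c0) / \<delta> * b0))"
    using M(2) dF by (simp add: eq_mk2_iff field_simps)
  finally have A: "A = \<dots>" .
  have prods: "algebraic_int (s * t)"
    if "s \<in> {(a - a0) / \<delta>, (b - b0) / \<delta>, (c - c0) / \<delta>, (d - d0) / \<delta>}" "t \<in> {a0, b0, c0, d0}" for s t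
    using that co int by (auto simp del: times_divide_eq_left intro!: algebraic_int_add_mult(2))
  have "algebraic_int (A $ x $ y)" for x y
    using exhaust_2[of x] exhaust_2[of y] unfolding A
    by (auto simp del: times_divide_eq_left intro!: algebraic_int_add_mult(1) algebraic_int_diff algebraic_int_1 prods)
  moreover have "det A = 1"
  proof -
    have "\<delta> * \<delta> * det A = \<delta> * \<delta>"
      unfolding \<open>A = mk2 ((a * d0 - b * c0) / \<delta>) _ _ _\<close> det_mk2 using M(2) dM dF
      by (simp add: field_simps) algebra
    then show ?thesis using M(2) by simp
  qed
  ultimately show ?thesis unfolding A_def[symmetric] by (auto simp: SL2_def)
qed

end

context hilbert_rank2
begin

definition dilation :: "'i \<Rightarrow> nat \<Rightarrow> 'i \<Rightarrow> complex" where
  "dilation i k l = (if l = i then 1 / 2 ^ k else 1)"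

text \<open>
  When the short vectors at times \<open>k\<close> and \<open>k + 1\<close> are independent, both are bounded at
  time \<open>k\<close>. They form a matrix with bounded determinant, and there are only finitely many such
  matrices modulo the lattice.
\<close>
lemma recurrent_if_irrational:
  assumes ij: "i \<noteq> j" and g: "g \<in> G" and irr: "\<And>v. v \<noteq> 0 \<Longrightarrow> form g i 2 v \<noteq> 0"
  shows "\<exists>\<rho>. infinite {k. \<exists>\<gamma>\<in>\<Gamma>. norm (gmult (diag (dilation i k)) (gmult g \<gamma>)) \<le> \<rho>}"
proof -
  obtain C v where C: "C > 0" and v: "\<And>k::nat. v k \<noteq> 0 \<and> integral_vec (v k) \<and>
    cmod (form g i 1 (v k)) \<le> C * 2 ^ k \<and> cmod (form g i 2 (v k)) \<le> C / 2 ^ k \<and> (\<forall>r. cmod (form g j r (v k)) \<le> C)"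
    using exists_short_vector[OF ij g] by metis
  have "finite {k. parallel (v k) u}" if "u \<noteq> 0" for u
    by (rule finite_parallel_short[OF ij g irr _ that, where C = C]) (use v in blast)+
  then have "infinite {k. \<not> parallel (v (Suc k)) (v k)}"
    by (intro infinite_nonparallel) (use v in auto)
  then obtain I where inf: "infinite I" and I: "\<And>k. k \<in> I \<Longrightarrow> \<not> parallel (v (Suc k)) (v k)" by blast
  define M where "M k = mk2 (v k $ 1) (v (Suc k) $ 1) (v k $ 2) (v (Suc k) $ 2)" for k
  define Y where "Y k = gmult (gmult (diag (dilation i k)) g) (rational (\<lambda>_. M k))" for k
  have M_int: "algebraic_int (M k $ a $ b)" for k a b
    using v[of k] v[of "Suc k"] exhaust_2[of a] exhaust_2[of b] by (auto simp: M_def)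
  have M_det: "det (M k) \<noteq> 0" if "k \<in> I" for k
    using I[OF that] by (auto simp: M_def parallel_def ac_simps)
  have Y_entry: "Y k $ l $ r $ 1 = form (gmult (diag (dilation i k)) g) l r (v k)"
    "Y k $ l $ r $ 2 = form (gmult (diag (dilation i k)) g) l r (v (Suc k))" for k l r
    by (simp_all add: Y_def M_def form_def matrix_matrix_mult_def[of "_ ** _"] sum_2 \<sigma>m_mk2 del: gmult_nth)
      (simp_all add: matrix_matrix_mult_def sum_2)
  have Y_bound: "cmod (Y k $ l $ r $ c) \<le> 2 * C" for k l r c
  proof -
    have l: "l = i \<or> l = j" using UNIV_places[OF ij] by blast
    have i1: "cmod (form (gmult (diag (dilation i k)) g) i 1 (v m)) \<le> 2 * C"
      "cmod (form (gmult (diag (dilation i k)) g) i 2 (v m)) \<le> 2 * C" if "m = k \<or> m = Suc k" for m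
    proof -
      have "0 < C * 2 ^ k" using C by simp
      have "cmod (form g i 1 (v m)) \<le> 2 * (C * 2 ^ k)"
      proof (rule disjE[OF that])
        assume "m = k"
        then have "cmod (form g i 1 (v m)) \<le> C * 2 ^ k" using v[of k] by blast
        then show ?thesis using \<open>0 < C * 2 ^ k\<close> by linarith
      next
        assume m: "m = Suc k"
        have "C * 2 ^ Suc k = 2 * (C * 2 ^ k)" by simp
        then show ?thesis using v[of "Suc k"] unfolding m by metis
      qed
      then show "cmod (form (gmult (diag (dilation i k)) g) i 1 (v m)) \<le> 2 * C"
        by (simp add: form_diag dilation_def norm_mult norm_divide norm_power field_simps)
      have "C / 2 ^ k \<le> 2 * (C / 2 ^ k)" "C / 2 ^ Suc k \<le> 2 * (C / 2 ^ k)" using C by (simp_all add: field_simps)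
      then have "cmod (form g i 2 (v m)) \<le> 2 * (C / 2 ^ k)"
        using that v[of k] v[of "Suc k"] by (metis order_trans)
      then show "cmod (form (gmult (diag (dilation i k)) g) i 2 (v m)) \<le> 2 * C"
        by (simp add: form_diag dilation_def norm_mult norm_divide norm_power field_simps)
    qed
    have j: "cmod (form (gmult (diag (dilation i k)) g) j 1 (v m)) \<le> 2 * C"
      "cmod (form (gmult (diag (dilation i k)) g) j 2 (v m)) \<le> 2 * C" for m
    proof -
      have "cmod (form g j r (v m)) \<le> 2 * C" for r using v[of m] C by (metis dual_order.trans le_add_same_cancel1 less_imp_le mult_2)
      then show "cmod (form (gmult (diag (dilation i k)) g) j 1 (v m)) \<le> 2 * C"
        "cmod (form (gmult (diag (dilation i k)) g) j 2 (v m)) \<le> 2 * C"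
        using ij by (simp_all add: form_diag dilation_def)
    qed
    show ?thesis
      using l exhaust_2[of r] exhaust_2[of c] i1[of k] i1[of "Suc k"] j[of k] j[of "Suc k"] by (auto simp: Y_entry)
  qed
  have det_bound: "cmod (\<sigma> l (det (M k))) \<le> 8 * C\<^sup>2" for k l
  proof -
    have "dilation i k l \<noteq> 0" for l by (simp add: dilation_def)
    then have "det (Y k $ l) = det (g $ l) * \<sigma> l (det (M k))"
      by (simp add: Y_def det_mul det_\<sigma>m)
    then have "\<sigma> l (det (M k)) = Y k $ l $ 1 $ 1 * Y k $ l $ 2 $ 2 - Y k $ l $ 1 $ 2 * Y k $ l $ 2 $ 1"
      using g by (simp add: G_iff flip: det_2)
    also have "cmod \<dots> \<le> (2 * C) * (2 * C) + (2 * C) * (2 * C)"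
      by (rule order.trans[OF norm_triangle_ineq4], unfold norm_mult)
        (use C in \<open>intro add_mono mult_mono Y_bound; simp\<close>)
    finally show ?thesis by (simp add: power2_eq_square)
  qed
  define \<Delta> where "\<Delta> = {\<alpha>. algebraic_int \<alpha> \<and> (\<forall>l. cmod (\<sigma> l \<alpha>) \<le> 8 * C\<^sup>2)} - {0}"
  have \<Delta>: "finite \<Delta>" unfolding \<Delta>_def using finite_algebraic_int_bounded_places by simp
  have det\<Delta>: "det (M k) \<in> \<Delta>" if "k \<in> I" for k
  proof -
    have "algebraic_int (det (M k))"
      unfolding det_2 by (intro algebraic_int_diff algebraic_int_add_mult(2) M_int)
    then show ?thesis using M_det[OF that] det_bound by (simp add: \<Delta>_def)
  qed
  have "\<exists>R. finite R \<and> (\<forall>\<alpha>::'k. algebraic_int \<alpha> \<longrightarrow> (\<exists>\<rho>\<in>R. algebraic_int ((\<alpha> - \<rho>) / \<delta>)))" if "\<delta> \<in> \<Delta>" for \<delta>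
    using finite_residues[OF nf, of \<delta>] that by (auto simp: \<Delta>_def)
  then obtain R where R: "\<And>\<delta>. \<delta> \<in> \<Delta> \<Longrightarrow> finite (R \<delta>)"
    "\<And>\<delta> \<alpha>. \<delta> \<in> \<Delta> \<Longrightarrow> algebraic_int (\<alpha>::'k) \<Longrightarrow> \<exists>\<rho>\<in>R \<delta>. algebraic_int ((\<alpha> - \<rho>) / \<delta>)" by metis
  have "\<exists>\<rho>\<in>R (det (M k)). algebraic_int ((M k $ a $ b - \<rho>) / det (M k))" if "k \<in> I" for k a b
    using R(2)[OF det\<Delta>[OF that] M_int] .
  then obtain res where res: "\<And>k a b. k \<in> I \<Longrightarrow> res k a b \<in> R (det (M k))"
    "\<And>k a b. k \<in> I \<Longrightarrow> algebraic_int ((M k $ a $ b - res k a b) / det (M k))" by metis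
  \<comment> \<open>The data on which the matrix \<open>M k\<close> depends modulo the lattice.\<close>
  define cls where "cls k = (det (M k), res k 1 1, res k 1 2, res k 2 1, res k 2 2)" for k
  have "finite (\<Union>\<delta>\<in>\<Delta>. {\<delta>} \<times> R \<delta> \<times> R \<delta> \<times> R \<delta> \<times> R \<delta>)" using \<Delta> R(1) by auto
  moreover have "cls ` I \<subseteq> (\<Union>\<delta>\<in>\<Delta>. {\<delta>} \<times> R \<delta> \<times> R \<delta> \<times> R \<delta> \<times> R \<delta>)"
  proof
    fix x assume "x \<in> cls ` I"
    then obtain k where k: "k \<in> I" "x = cls k" by blast
    show "x \<in> (\<Union>\<delta>\<in>\<Delta>. {\<delta>} \<times> R \<delta> \<times> R \<delta> \<times> R \<delta> \<times> R \<delta>)"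
      using det\<Delta>[OF k(1)] res(1)[OF k(1)] by (auto simp: k(2) cls_def)
  qed
  ultimately have "finite (cls ` I)" by (rule finite_subset[rotated])
  from pigeonhole_infinite[OF inf this] obtain k0 where k0: "k0 \<in> I" "infinite {k \<in> I. cls k = cls k0}" by auto
  define \<delta> where "\<delta> = det (M k0)"
  define N where "N = (\<chi> a b. adj2 (M k0) $ a $ b / \<delta>)"
  define S where "S = (\<Sum>l\<in>UNIV. \<Sum>a\<in>UNIV. \<Sum>b\<in>UNIV. cmod (\<sigma> l (N $ a $ b)))"
  have NS: "cmod (\<sigma> l (N $ a $ b)) \<le> S" for l a b
  proof -
    have "cmod (\<sigma> l (N $ a $ b)) \<le> (\<Sum>b\<in>UNIV. cmod (\<sigma> l (N $ a $ b)))" by (rule member_le_sum) auto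
    also have "\<dots> \<le> (\<Sum>a\<in>UNIV. \<Sum>b\<in>UNIV. cmod (\<sigma> l (N $ a $ b)))" by (rule member_le_sum) (auto intro!: sum_nonneg)
    also have "\<dots> \<le> S" unfolding S_def by (rule member_le_sum) (auto intro!: sum_nonneg)
    finally show ?thesis .
  qed
  define \<rho> where "\<rho> = CARD('i) * (4 * (2 * C * S + 2 * C * S))"
  have "{k \<in> I. cls k = cls k0} \<subseteq> {k. \<exists>\<gamma>\<in>\<Gamma>. norm (gmult (diag (dilation i k)) (gmult g \<gamma>)) \<le> \<rho>}"
  proof clarify
    fix k assume k: "k \<in> I" and eq: "cls k = cls k0"
    have "res k a b = res k0 a b" for a b
      using eq exhaust_2[of a] exhaust_2[of b] by (auto simp: cls_def)
    moreover have d: "det (M k) = \<delta>" using eq by (simp add: cls_def \<delta>_def)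
    ultimately have "algebraic_int ((M k $ a $ b - M k0 $ a $ b) / \<delta>)" for a b
      using algebraic_int_diff[OF res(2)[OF k, of a b] res(2)[OF k0(1), of a b]]
      by (simp add: \<delta>_def flip: diff_divide_distrib)
    then obtain A where A: "A \<in> SLO" "A = M k ** N"
      using congruent_matrices[of "M k0" \<delta> "M k"] M_int d M_det[OF k0(1)] unfolding N_def \<delta>_def by metis
    have eq: "gmult (diag (dilation i k)) (gmult g (rational (\<lambda>_. A))) = gmult (Y k) (rational (\<lambda>_. N))"
      unfolding Y_def A(2) by (simp add: vec_eq_iff[of "gmult _ _"] \<sigma>m_mult matrix_mul_assoc)
    have "cmod (gmult (Y k) (rational (\<lambda>_. N)) $ l $ a $ b) \<le> 2 * C * S + 2 * C * S" for l a b
    proof -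
      have term_bound: "cmod (Y k $ l $ a $ c * \<sigma> l (N $ c $ b)) \<le> 2 * C * S" for c
        unfolding norm_mult using C by (intro mult_mono Y_bound NS) auto
      show ?thesis
        using norm_triangle_le[OF add_mono, OF term_bound[of 1] term_bound[of 2]]
        by (simp add: matrix_matrix_mult_def sum_2)
    qed
    then have "norm (gmult (Y k) (rational (\<lambda>_. N))) \<le> \<rho>" unfolding \<rho>_def by (rule norm_le_of_entries)
    moreover have "rational (\<lambda>_. A) \<in> \<Gamma>" using A(1) by (auto simp: \<Gamma>_eq)
    ultimately show "\<exists>\<gamma>\<in>\<Gamma>. norm (gmult (diag (dilation i k)) (gmult g \<gamma>)) \<le> \<rho>" using eq by metis
  qed
  then show ?thesis using k0(2) finite_subset by blast
qed

text \<open>The Weyl element exchanges the two rows up to sign and inverts the diagonal subgroup.\<close>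
definition weyl :: "'a::comm_ring_1^2^2" where
  "weyl = mk2 0 1 (- 1) 0"

definition weyl_inv :: "'a::comm_ring_1^2^2" where
  "weyl_inv = mk2 0 (- 1) 1 0"

lemma weyl_simps:
  "weyl ** weyl_inv = (mat 1 :: 'a::comm_ring_1^2^2)" "weyl_inv ** weyl = (mat 1 :: 'a::comm_ring_1^2^2)"
  "det (weyl :: 'a::comm_ring_1^2^2) = 1" "det (weyl_inv :: 'a::comm_ring_1^2^2) = 1"
  "\<sigma>m i weyl = weyl" "\<sigma>m i weyl_inv = weyl_inv"
  by (simp_all add: weyl_def weyl_inv_def mk2_mult mk2_one \<sigma>_simps)

lemma weyl_dg: "t \<noteq> 0 \<Longrightarrow> weyl ** dg t = dg (1 / t) ** (weyl :: complex^2^2)"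
  by (simp add: weyl_def mk2_mult)

text \<open>
  The direction of the factor that contracts the first coordinate shows that the second row is rational. The opposite direction
  gives the first row, since the Weyl element exchanges the rows.
\<close>
lemma divergent_rational_row:
  assumes ij: "i \<noteq> j" and g: "g \<in> G" and dv: "divergent_orbit \<sigma> (D_factor \<sigma> i) (proj \<sigma> g)"
  shows "\<exists>v. v \<noteq> 0 \<and> form g i r v = 0"
proof -
  have mem: "diag (\<lambda>l. if l = i then c else 1) \<in> D_factor \<sigma> i" if "c \<in> pos i" for c
    using that by (auto simp: D_factor_def diagonal_component_eq mk2_one)
  have pos2: "(2::complex) ^ k \<in> pos i" "1 / (2::complex) ^ k \<in> pos i" for k
    using pos_simps(6)[of "2 ^ k" i] pos_simps(6)[of "1 / 2 ^ k" i] by simp_all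
  have k2: "real k \<le> 2 ^ k" for k
    using less_exp[of k] by (metis less_imp_le of_nat_le_iff of_nat_numeral of_nat_power)
  have ge: "real k \<le> norm x" if "cmod (x $ i $ a $ a) = 2 ^ k" for k a and x :: "complex^2^2^'i"
    using cmod_entry_le_norm[of x i a a] k2[of k] that by linarith
  have two: "\<exists>v. v \<noteq> 0 \<and> form g i 2 v = 0"
  proof (rule ccontr)
    assume "\<nexists>v. v \<noteq> 0 \<and> form g i 2 v = 0"
    then obtain \<rho> where inf: "infinite {k. \<exists>\<gamma>\<in>\<Gamma>. norm (gmult (diag (dilation i k)) (gmult g \<gamma>)) \<le> \<rho>}"
      using recurrent_if_irrational[OF ij g] by blast
    have "finite {k. \<exists>\<gamma>\<in>\<Gamma>. norm (gmult (diag (dilation i k)) (gmult g \<gamma>)) \<le> \<rho>}"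
    proof (rule divergent_orbit_escapes[OF dv g])
      show "diag (dilation i k) \<in> D_factor \<sigma> i" for k
        using mem[OF pos2(2)[of k]] by (simp add: dilation_def[abs_def])
      show "real k \<le> norm (diag (dilation i k))" for k
        by (rule ge[of _ 2]) (simp add: dilation_def norm_power)
    qed
    then show False using inf by blast
  qed
  have one: "\<exists>v. v \<noteq> 0 \<and> form g i 1 v = 0"
  proof (rule ccontr)
    assume n: "\<nexists>v. v \<noteq> 0 \<and> form g i 1 v = 0"
    define wl :: "complex^2^2^'i" where "wl = (\<chi> l. weyl)"
    have wl: "wl \<in> G" by (auto simp: G_iff wl_def weyl_simps) (auto simp: weyl_def mk2_def \<sigma>_completion completion_closed(3)[OF \<sigma>_completion(3) \<sigma>_completion(3)])
    have "form (gmult wl g) i 2 v = - form g i 1 v" for v by (simp add: form_gmult wl_def weyl_def)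
    then have "v \<noteq> 0 \<Longrightarrow> form (gmult wl g) i 2 v \<noteq> 0" for v using n by auto
    from recurrent_if_irrational[OF ij G_closed_mult[OF wl g] this]
    obtain \<rho> where inf: "infinite {k. \<exists>\<gamma>\<in>\<Gamma>. norm (gmult (diag (dilation i k)) (gmult (gmult wl g) \<gamma>)) \<le> \<rho>}" by blast
    define h where "h k = diag (\<lambda>l. if l = i then 2 ^ k else 1)" for k :: nat
    have comm: "gmult (diag (dilation i k)) (gmult (gmult wl g) \<gamma>) = gmult wl (gmult (h k) (gmult g \<gamma>))" for k \<gamma>
    proof -
      have "gmult (diag (dilation i k)) wl = gmult wl (h k)"
        by (simp add: vec_eq_iff[of "gmult _ _"] h_def wl_def weyl_dg dilation_def)
      then show ?thesis by (metis gmult_assoc)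
    qed
    have entries: "norm y \<le> CARD('i) * (4 * \<rho>)" if "norm (gmult wl y) \<le> \<rho>" for y
    proof (rule norm_le_of_entries)
      fix l a b
      have y: "y $ l $ 1 $ b = - gmult wl y $ l $ 2 $ b" "y $ l $ 2 $ b = gmult wl y $ l $ 1 $ b" for b
        by (simp_all add: wl_def weyl_def matrix_matrix_mult_def sum_2)
      have "cmod (gmult wl y $ l $ a $ b) \<le> \<rho>" for a b
        using cmod_entry_le_norm[of "gmult wl y" l a b] that by linarith
      then show "cmod (y $ l $ a $ b) \<le> \<rho>" using y exhaust_2[of a] by (auto simp del: gmult_nth)
    qed
    have "finite {k. \<exists>\<gamma>\<in>\<Gamma>. norm (gmult (h k) (gmult g \<gamma>)) \<le> CARD('i) * (4 * \<rho>)}"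
    proof (rule divergent_orbit_escapes[OF dv g])
      show "h k \<in> D_factor \<sigma> i" for k unfolding h_def by (rule mem[OF pos2(1)])
      show "real k \<le> norm (h k)" for k by (rule ge[of _ 1]) (simp add: h_def norm_power)
    qed
    moreover have "{k. \<exists>\<gamma>\<in>\<Gamma>. norm (gmult (diag (dilation i k)) (gmult (gmult wl g) \<gamma>)) \<le> \<rho>}
        \<subseteq> {k. \<exists>\<gamma>\<in>\<Gamma>. norm (gmult (h k) (gmult g \<gamma>)) \<le> CARD('i) * (4 * \<rho>)}"
      unfolding comm using entries by blast
    ultimately show False using inf finite_subset by blast
  qed
  show ?thesis using one two exhaust_2[of r] by auto
qed

lemma rational_row:
  assumes "v \<noteq> 0" "form g i r v = 0" "\<And>c. g $ i $ r $ c \<in> completion (\<sigma> i)"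
  shows "\<exists>s\<in>completion (\<sigma> i). g $ i $ r $ 1 = s * \<sigma> i (- v $ 2) \<and> g $ i $ r $ 2 = s * \<sigma> i (v $ 1)"
proof (cases "v $ 1 = 0")
  case True
  then have "v $ 2 \<noteq> 0" using assms(1) by (auto simp: vec_eq_iff forall_2)
  then show ?thesis using assms(2) True
    by (intro bexI[of _ "g $ i $ r $ 1 / \<sigma> i (- v $ 2)"] completion_closed(4) assms(3) \<sigma>_completion)
      (auto simp: form_def \<sigma>_simps)
next
  case False
  then show ?thesis using assms(2)
    by (intro bexI[of _ "g $ i $ r $ 2 / \<sigma> i (v $ 1)"] completion_closed(4) assms(3) \<sigma>_completion)
      (auto simp: form_def \<sigma>_simps field_simps eq_neg_iff_add_eq_0)
qed

text \<open>
  Each row is a multiple of a rational row. As the determinant is \<open>1\<close>, the two factors can be made inverse to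
  each other by rescaling one rational row; a sign is absorbed by the rational matrix.
\<close>
lemma locally_divergent_rational:
  assumes g: "g \<in> G" and ld: "locally_divergent \<sigma> g"
  shows "\<exists>t q. t \<in> Pos \<and> (\<forall>i. det (q i) = 1) \<and> g = gmult (diag t) (rational q)"
proof -
  have "\<exists>t q. t \<in> pos i \<and> det q = 1 \<and> g $ i = dg t ** \<sigma>m i q" for i
  proof -
    obtain a b :: 'i where ab: "a \<noteq> b" "UNIV = {a, b}" using rank by (auto simp: card_2_iff)
    obtain j where ij: "i \<noteq> j" using ab(1) by metis
    have row: "\<exists>v. v \<noteq> 0 \<and> form g i r v = 0" for r
      using divergent_rational_row[OF ij g] ld by (simp add: locally_divergent_def)
    have comp: "g $ i $ r $ c \<in> completion (\<sigma> i)" for r c using g by (simp add: G_iff)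
    obtain u where u: "u \<noteq> 0" "form g i 1 u = 0" using row by blast
    obtain v where v: "v \<noteq> 0" "form g i 2 v = 0" using row by blast
    obtain s where s: "s \<in> completion (\<sigma> i)" "g $ i $ 1 $ 1 = s * \<sigma> i (- u $ 2)" "g $ i $ 1 $ 2 = s * \<sigma> i (u $ 1)"
      using rational_row[OF u comp] by blast
    obtain s' where s': "g $ i $ 2 $ 1 = s' * \<sigma> i (- v $ 2)" "g $ i $ 2 $ 2 = s' * \<sigma> i (v $ 1)"
      using rational_row[OF v comp] by blast
    define \<delta> where "\<delta> = u $ 1 * v $ 2 - u $ 2 * v $ 1"
    have "det (g $ i) = 1" using g by (simp add: G_iff)
    then have d: "s * s' * \<sigma> i \<delta> = 1" by (simp add: det_2 s s' \<delta>_def \<sigma>_simps algebra_simps)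
    then have nz: "s \<noteq> 0" "s' \<noteq> 0" "\<sigma> i \<delta> \<noteq> 0" by auto
    then have nz': "\<delta> \<noteq> 0" by (simp add: \<sigma>_simps)
    have s'_eq: "s' = 1 / (s * \<sigma> i \<delta>)" using d nz by (simp add: field_simps)
    define q where "q = mk2 (- u $ 2) (u $ 1) (- v $ 2 / \<delta>) (v $ 1 / \<delta>)"
    have "det q = (u $ 1 * v $ 2 - u $ 2 * v $ 1) / \<delta>"
      by (simp add: q_def diff_divide_distrib)
    then have q: "det q = 1" using nz' by (simp add: \<delta>_def)
    have gi: "g $ i = dg s ** \<sigma>m i q"
      unfolding q_def \<sigma>m_mk2 mk2_mult eq_mk2_iff using s s' s'_eq by (simp add: \<sigma>_simps)
    have "det (- q) = 1" using q by (simp add: det_2)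
    moreover have "g $ i = dg (- s) ** \<sigma>m i (- q)"
      unfolding gi by (simp add: vec_eq_iff forall_2 matrix_matrix_mult_def sum_2 \<sigma>_simps)
    ultimately show ?thesis using q gi pos_simps(7)[OF s(1) nz(1)] by blast
  qed
  then obtain t q where "\<And>i. t i \<in> pos i" "\<And>i. det (q i) = 1" "\<And>i. g $ i = dg (t i) ** \<sigma>m i (q i)" by metis
  then have "t \<in> Pos" "\<forall>i. det (q i) = 1" "g = gmult (diag t) (rational q)"
    by (simp_all add: Pos_def vec_eq_iff[of g])
  then show ?thesis by blast
qed

end


section \<open>Units acting on the lattice\<close>

context hilbert_rank2
begin

definition unit_at :: "'i \<Rightarrow> 'i \<Rightarrow> 'k \<Rightarrow> bool" where
  "unit_at i j \<epsilon> \<longleftrightarrow> algebraic_int \<epsilon> \<and> algebraic_int (inverse \<epsilon>) \<and> \<epsilon> \<noteq> 0 \<and>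
     1 < cmod (\<sigma> i \<epsilon>) \<and> cmod (\<sigma> j \<epsilon>) < 1 \<and> (\<forall>l. \<sigma> l \<epsilon> \<in> pos l)"

text \<open>
  Squaring a unit makes it positive at the real places.
\<close>
lemma unit_at_exists:
  assumes "i \<noteq> j"
  shows "\<exists>\<epsilon>. unit_at i j \<epsilon>"
proof -
  obtain \<epsilon> where e: "algebraic_int \<epsilon>" "algebraic_int (inverse \<epsilon>)" "1 < cmod (\<sigma> i \<epsilon>)" "cmod (\<sigma> j \<epsilon>) < 1" "\<epsilon> \<noteq> 0"
    using exists_unit[OF assms] by blast
  have "\<sigma> l (\<epsilon> * \<epsilon>) \<in> pos l" for l
    using pos_simps(8)[OF \<sigma>_completion(1), of l \<epsilon>] e(5) by (simp add: \<sigma>_simps)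
  moreover have "1 < cmod (\<sigma> i (\<epsilon> * \<epsilon>))" using e(3) by (simp add: \<sigma>_simps norm_mult less_1_mult)
  moreover have "cmod (\<sigma> j (\<epsilon> * \<epsilon>)) < 1"
    using e(4) by (simp add: \<sigma>_simps norm_mult) (metis mult_le_one less_eq_real_def mult_left_le norm_ge_zero order_le_less_trans)
  ultimately have "unit_at i j (\<epsilon> * \<epsilon>)"
    using e algebraic_int_add_mult(2)[OF e(1) e(1)] algebraic_int_add_mult(2)[OF e(2) e(2)] by (simp add: unit_at_def)
  then show ?thesis by blast
qed

lemma unit_at_power:
  assumes "unit_at i j \<epsilon>" "m > 0"
  shows "unit_at i j (\<epsilon> ^ m)"
proof -
  have e: "algebraic_int \<epsilon>" "algebraic_int (inverse \<epsilon>)" "1 < cmod (\<sigma> i \<epsilon>)" "cmod (\<sigma> j \<epsilon>) < 1" "\<epsilon> \<noteq> 0" "\<And>l. \<sigma> l \<epsilon> \<in> pos l"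
    using assms(1) by (auto simp: unit_at_def)
  have "\<sigma> l \<epsilon> ^ n \<in> pos l" for l n by (induction n) (auto intro: pos_simps e)
  then show ?thesis unfolding unit_at_def
    using e assms(2) algebraic_int_power[OF e(1), of m] algebraic_int_power[OF e(2), of m]
    by (auto simp: \<sigma>_simps norm_power power_inverse one_less_power power_less_one_iff)
qed

lemma common_denominator:
  assumes "finite (S :: 'k set)"
  shows "\<exists>N::int. N > 0 \<and> (\<forall>s\<in>S. algebraic_int (of_int N * s))"
  using assms
proof (induction S)
  case empty
  show ?case by (intro exI[of _ 1]) simp
next
  case (insert x S)
  obtain N :: int where N: "N > 0" "\<forall>s\<in>S. algebraic_int (of_int N * s)" using insert.IH by blast
  obtain n :: int where n: "n > 0" "algebraic_int (of_int n * x)" using algebraic_int_scale[OF nf] by blast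
  have "algebraic_int (of_int (N * n) * x)"
    using algebraic_int_add_mult(2)[OF algebraic_int_of_int[of N] n(2)] by (simp only: of_int_mult mult.assoc)
  moreover have "algebraic_int (of_int (N * n) * s)" if "s \<in> S" for s
  proof -
    have "of_int (N * n) * s = of_int n * (of_int N * s)" by (simp only: of_int_mult ac_simps)
    then show ?thesis using algebraic_int_add_mult(2)[OF algebraic_int_of_int[of n], of "of_int N * s"] N(2) that by metis
  qed
  ultimately have "\<forall>s\<in>insert x S. algebraic_int (of_int (N * n) * s)" by blast
  moreover have "N * n > 0" using N(1) n(1) by simp
  ultimately show ?case by blast
qed

text \<open>
  A power of a unit is congruent to \<open>1\<close> modulo any given integer, so its diagonal matrix
  is conjugated into the lattice by a given rational matrix.
\<close>
lemma unit_conjugate: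
  assumes u: "unit_at i j \<epsilon>" and P: "det (P :: 'k^2^2) = 1"
  shows "\<exists>m>0. \<forall>n. adj2 P ** dg ((\<epsilon> ^ m) ^ n) ** P \<in> SLO"
proof -
  obtain a b c d where P': "P = mk2 a b c d" by (rule mk2_cases)
  have dP: "a * d - b * c = 1" using P by (simp add: P')
  obtain N :: int where N: "N > 0" "\<forall>s\<in>{d * a, d * b, b * c, b * d, c * a, c * b, a * c, a * d}. algebraic_int (of_int N * s)"
    using common_denominator[of "{d * a, d * b, b * c, b * d, c * a, c * b, a * c, a * d}"] by auto
  have e: "algebraic_int \<epsilon>" "algebraic_int (inverse \<epsilon>)" "\<epsilon> \<noteq> 0" using u by (auto simp: unit_at_def)
  obtain R where R: "finite R" "\<And>\<alpha>::'k. algebraic_int \<alpha> \<Longrightarrow> \<exists>\<rho>\<in>R. algebraic_int ((\<alpha> - \<rho>) / of_int N)"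
    using finite_residues[OF nf, of "of_int N"] N(1) by auto
  have "\<exists>\<rho>\<in>R. algebraic_int ((\<epsilon> ^ k - \<rho>) / of_int N)" for k by (intro R(2) algebraic_int_power e)
  then obtain r where r: "\<And>k. r k \<in> R" "\<And>k. algebraic_int ((\<epsilon> ^ k - r k) / of_int N)" by metis
  have "finite (range r)" using R(1) r(1) finite_subset[of "range r" R] by blast
  then have "\<not> inj r" using finite_imageD infinite_UNIV_nat by blast
  then obtain k l where "r k = r l" "k \<noteq> l" by (auto simp: inj_def)
  then obtain k l where kl: "r k = r l" "k < l" by (metis linorder_neqE_nat)
  \<comment> \<open>Two powers of the unit with the same residue modulo \<open>N\<close>.\<close>
  define m where "m = l - k"
  have m: "m > 0" "l = k + m" using kl by (auto simp: m_def)
  define \<eta> where "\<eta> = \<epsilon> ^ m"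
  have \<eta>: "algebraic_int \<eta>" "algebraic_int (inverse \<eta>)" "\<eta> \<noteq> 0"
    unfolding \<eta>_def using e algebraic_int_power[OF e(1)] algebraic_int_power[OF e(2), of m] by (auto simp: power_inverse)
  have "algebraic_int ((\<epsilon> ^ l - \<epsilon> ^ k) / of_int N)"
    using algebraic_int_diff[OF r(2)[of l] r(2)[of k]] kl(1) by (simp flip: diff_divide_distrib)
  moreover have "(\<eta> - 1) / of_int N = inverse \<epsilon> ^ k * ((\<epsilon> ^ l - \<epsilon> ^ k) / of_int N)"
  proof -
    have "\<epsilon> ^ l - \<epsilon> ^ k = \<epsilon> ^ k * (\<eta> - 1)" by (simp add: m(2) \<eta>_def power_add right_diff_distrib)
    moreover have "inverse \<epsilon> ^ k * \<epsilon> ^ k = 1" using e(3) by (simp flip: power_mult_distrib)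
    ultimately show ?thesis by (metis mult.assoc mult_1 times_divide_eq_right)
  qed
  ultimately have \<mu>: "algebraic_int ((\<eta> - 1) / of_int N)"
    using algebraic_int_add_mult(2)[OF algebraic_int_power[OF e(2)]] by metis
  have "(inverse \<eta> - 1) / of_int N = - (inverse \<eta> * ((\<eta> - 1) / of_int N))"
  proof -
    have "inverse \<eta> - 1 = - (inverse \<eta> * (\<eta> - 1))" using \<eta>(3) by (simp add: right_diff_distrib)
    then show ?thesis by simp
  qed
  then have \<mu>': "algebraic_int ((inverse \<eta> - 1) / of_int N)"
    using algebraic_int_add_mult(2)[OF \<eta>(2) \<mu>] by (metis algebraic_int_minus)
  have NZ: "(of_int N :: 'k) \<noteq> 0" using N(1) by simp
  define x where "x = (\<eta> - 1) / of_int N"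
  define y where "y = (inverse \<eta> - 1) / of_int N"
  have xy: "\<eta> = 1 + of_int N * x" "1 / \<eta> = 1 + of_int N * y" "algebraic_int x" "algebraic_int y"
    using NZ \<mu> \<mu>' by (simp_all add: x_def y_def inverse_eq_divide)
  have "adj2 P ** dg \<eta> ** P = mk2 (d * a * \<eta> - b * c * (1 / \<eta>)) (d * b * \<eta> - b * d * (1 / \<eta>))
      (- (c * a * \<eta>) + a * c * (1 / \<eta>)) (- (c * b * \<eta>) + a * d * (1 / \<eta>))"
    unfolding P' by (simp add: mk2_mult algebra_simps)
  also have "\<dots> = mk2 (1 + ((of_int N * (d * a)) * x - (of_int N * (b * c)) * y)) ((of_int N * (d * b)) * x - (of_int N * (b * d)) * y)
      ((of_int N * (a * c)) * y - (of_int N * (c * a)) * x) (1 + ((of_int N * (a * d)) * y - (of_int N * (c * b)) * x))"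
    unfolding xy(2) unfolding xy(1) using dP by (simp add: eq_mk2_iff algebra_simps)
  finally have U: "adj2 P ** dg \<eta> ** P = \<dots>" .
  have prods: "algebraic_int ((of_int N * s) * z)"
    if "s \<in> {d * a, d * b, b * c, b * d, c * a, c * b, a * c, a * d}" "z \<in> {x, y}" for s z
  proof (rule algebraic_int_add_mult(2))
    show "algebraic_int (of_int N * s)" using that(1) N(2) by blast
    show "algebraic_int z" using that(2) xy(3,4) by blast
  qed
  have "algebraic_int ((adj2 P ** dg \<eta> ** P) $ r $ s)" for r s
    using exhaust_2[of r] exhaust_2[of s] unfolding U
    by (elim disjE; simp only: mk2_nth)
      (intro algebraic_int_add_mult(1) algebraic_int_diff algebraic_int_1 prods; simp)+
  moreover have "det (adj2 P ** dg \<eta> ** P) = 1"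
    using P \<eta>(3) adj2_inverse(3)[OF P] by (simp add: det_mul)
  ultimately have one: "adj2 P ** dg \<eta> ** P \<in> SLO" by (simp add: SL2_def)
  have "adj2 P ** dg (\<eta> ^ n) ** P \<in> SLO" for n
  proof (induction n)
    case 0
    have "adj2 P ** dg (\<eta> ^ 0) ** P = mat 1"
      using adj2_inverse(1)[OF P] by (simp flip: mk2_one)
    moreover have "mat 1 \<in> SLO" by (simp add: SL2_def det_I, simp add: mat_def)
    ultimately show ?case by simp
  next
    case (Suc n)
    have "(adj2 P ** dg (\<eta> ^ n) ** P) ** (adj2 P ** dg \<eta> ** P) = adj2 P ** dg (\<eta> ^ n) ** (P ** adj2 P) ** dg \<eta> ** P"
      by (simp add: matrix_mul_assoc)
    also have "\<dots> = adj2 P ** (dg (\<eta> ^ n) ** dg \<eta>) ** P"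
      by (simp only: adj2_inverse(2)[OF P] matrix_mul_rid) (simp only: matrix_mul_assoc)
    also have "\<dots> = adj2 P ** dg (\<eta> ^ Suc n) ** P" by (simp only: dg_mult power_Suc2)
    finally show ?case using algebraic_int_SL2_mult[OF Suc one] by simp
  qed
  then show ?thesis using m(1) unfolding \<eta>_def by blast
qed

section \<open>A height bound\<close>

text \<open>
  Weights making the logarithmic height invariant under multiplication by the unit.
\<close>
definition weight :: "'i \<Rightarrow> 'i \<Rightarrow> 'k \<Rightarrow> 'i \<Rightarrow> real" where
  "weight i j \<epsilon> l = (if l = i then - ln (cmod (\<sigma> j \<epsilon>)) else ln (cmod (\<sigma> i \<epsilon>)))"

definition vsize :: "'i \<Rightarrow> 'k^2 \<Rightarrow> real" where
  "vsize l v = cmod (\<sigma> l (v $ 1)) + cmod (\<sigma> l (v $ 2))"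

lemma weight_pos: "unit_at i j \<epsilon> \<Longrightarrow> weight i j \<epsilon> l > 0"
  by (auto simp: weight_def unit_at_def \<sigma>_simps)

lemma vsize_pos: "v \<noteq> 0 \<Longrightarrow> vsize l v > 0"
  by (auto simp: vsize_def vec_eq_iff forall_2 \<sigma>_simps add_pos_nonneg add_nonneg_pos)

lemma sum_places: "i \<noteq> j \<Longrightarrow> (\<Sum>l\<in>(UNIV :: 'i set). f l) = f i + (f j :: real)"
  by (subst UNIV_places[of i j]) simp_all

text \<open>
  A power of the unit brings the size of \<open>v\<close> at \<open>i\<close> into a fixed interval above \<open>1\<close> without changing the
  height. Then either the size at \<open>j\<close> is at least \<open>1\<close> as well, or the vector is one of finitely many.
\<close>
lemma height_lower_bound:
  assumes ij: "i \<noteq> j" and u: "unit_at i j \<epsilon>"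
  shows "\<exists>C. \<forall>v. v \<noteq> 0 \<longrightarrow> integral_vec v \<longrightarrow> (\<Sum>l\<in>UNIV. weight i j \<epsilon> l * ln (vsize l v)) \<ge> - C"
proof -
  let ?h = "\<lambda>v. \<Sum>l\<in>UNIV. weight i j \<epsilon> l * ln (vsize l v)"
  have e: "algebraic_int \<epsilon>" "algebraic_int (inverse \<epsilon>)" "1 < cmod (\<sigma> i \<epsilon>)" "cmod (\<sigma> j \<epsilon>) < 1" "\<epsilon> \<noteq> 0"
    using u by (auto simp: unit_at_def)
  define a where "a = ln (cmod (\<sigma> i \<epsilon>))"
  define b where "b = - ln (cmod (\<sigma> j \<epsilon>))"
  have ab: "a > 0" "b > 0" using e by (auto simp: a_def b_def \<sigma>_simps)
  have h: "?h v = b * ln (vsize i v) + a * ln (vsize j v)" for v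
    using ij by (simp add: sum_places[OF ij] weight_def a_def b_def)
  define A where "A = {\<alpha>::'k. algebraic_int \<alpha> \<and> (\<forall>l. cmod (\<sigma> l \<alpha>) \<le> exp a)}"
  define F :: "('k^2) set" where "F = {v. v \<noteq> 0 \<and> v $ 1 \<in> A \<and> v $ 2 \<in> A}"
  have "F \<subseteq> (\<lambda>(x, y). \<chi> c::2. if c = 1 then x else y) ` (A \<times> A)"
  proof
    fix v assume v: "v \<in> F"
    have "v = (\<chi> c::2. if c = 1 then v $ 1 else v $ 2)" by (simp add: vec_eq_iff forall_2)
    then show "v \<in> (\<lambda>(x, y). \<chi> c::2. if c = 1 then x else y) ` (A \<times> A)"
      using v unfolding F_def by (intro image_eqI[of _ _ "(v $ 1, v $ 2)"]) auto
  qed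
  moreover have "finite A" unfolding A_def by (rule finite_algebraic_int_bounded_places)
  ultimately have F: "finite F" by (meson finite_SigmaI finite_imageI finite_subset)
  define m where "m = Min (insert 0 (?h ` F))"
  have "?h v \<ge> m" if v: "v \<noteq> 0" "integral_vec v" for v
  proof -
    \<comment> \<open>The exponent for which the size at \<open>i\<close> lands between \<open>1\<close> and \<open>exp a\<close>.\<close>
    define k :: int where "k = \<lceil>- ln (vsize i v) / a\<rceil>"
    have "\<exists>\<mu>. algebraic_int \<mu> \<and> \<mu> \<noteq> 0 \<and> (\<forall>l. ln (cmod (\<sigma> l \<mu>)) = k * ln (cmod (\<sigma> l \<epsilon>)))"
    proof (cases "k \<ge> 0")
      case True
      then show ?thesis using e algebraic_int_power[OF e(1)]
        by (intro exI[of _ "\<epsilon> ^ nat k"]) (simp add: \<sigma>_simps norm_power ln_realpow)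
    next
      case False
      then show ?thesis using e algebraic_int_power[OF e(2)]
        by (intro exI[of _ "inverse \<epsilon> ^ nat (- k)"]) (simp add: \<sigma>_simps norm_power norm_inverse ln_realpow ln_inverse)
    qed
    then obtain \<mu> where \<mu>: "algebraic_int \<mu>" "\<mu> \<noteq> 0" "\<And>l. ln (cmod (\<sigma> l \<mu>)) = k * ln (cmod (\<sigma> l \<epsilon>))" by blast
    define w where "w = (\<chi> c. \<mu> * v $ c)"
    have w: "w \<noteq> 0" "integral_vec w"
      using v \<mu> by (auto simp: w_def vec_eq_iff intro: algebraic_int_add_mult(2))
    have "vsize l w = cmod (\<sigma> l \<mu>) * vsize l v" for l
      by (simp add: vsize_def w_def \<sigma>_simps norm_mult distrib_left)
    then have lw: "ln (vsize l w) = k * ln (cmod (\<sigma> l \<epsilon>)) + ln (vsize l v)" for l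
      using vsize_pos[OF v(1), of l] \<mu>(2) by (simp add: ln_mult \<mu>(3) \<sigma>_simps)
    have hw: "?h w = ?h v" unfolding h unfolding lw
      by (simp add: b_def a_def algebra_simps)
    have "- ln (vsize i v) / a \<le> k" "k < - ln (vsize i v) / a + 1" unfolding k_def by linarith+
    then have i: "0 \<le> ln (vsize i w)" "ln (vsize i w) \<le> a"
      unfolding lw a_def[symmetric] using ab(1) by (simp_all add: field_simps)
    show ?thesis
    proof (cases "ln (vsize j w) \<ge> 0")
      case True
      then have "?h w \<ge> 0" unfolding h using i(1) ab by (intro add_nonneg_nonneg mult_nonneg_nonneg) auto
      moreover have "m \<le> 0" unfolding m_def using F by (intro Min_le) auto
      ultimately show ?thesis using hw by simp
    next
      case False
      have "vsize i w \<le> exp a" using i(2) vsize_pos[OF w(1), of i] by (metis exp_le_cancel_iff exp_ln)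
      moreover have "vsize j w \<le> exp a"
        using False ab(1) vsize_pos[OF w(1), of j] by (metis exp_le_cancel_iff exp_ln less_imp_le linorder_not_le order_trans)
      ultimately have "vsize l w \<le> exp a" for l using UNIV_places[OF ij] by (metis UNIV_I insertE singletonD)
      then have "cmod (\<sigma> l (w $ 1)) \<le> exp a" "cmod (\<sigma> l (w $ 2)) \<le> exp a" for l
        unfolding vsize_def by (meson add_increasing2 norm_ge_zero order_trans le_add_same_cancel1 le_add_same_cancel2)+
      then have "w \<in> F" using w by (simp add: F_def A_def)
      then have "m \<le> ?h w" unfolding m_def using F by (intro Min_le) auto
      then show ?thesis using hw by simp
    qed
  qed
  then show ?thesis by (intro exI[of _ "- m"]) auto
qed

text \<open>
  The zero entries of this matrix record which of the rational lines killed by the rows of \<open>q i\<close> and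
  \<open>q j\<close> coincide.
\<close>
definition rel :: "'i \<Rightarrow> 'i \<Rightarrow> ('i \<Rightarrow> 'k^2^2) \<Rightarrow> 'k^2^2" where
  "rel i j q = q j ** adj2 (q i)"

lemma form_rational: "form (rational q) l r v = \<sigma> l (q l $ r $ 1 * v $ 1 + q l $ r $ 2 * v $ 2)"
  by (simp add: form_def \<sigma>_simps)

lemma form_integral_lattice:
  assumes "\<gamma> \<in> \<Gamma>" "integral_vec v" "v \<noteq> 0"
  shows "\<exists>w. integral_vec w \<and> w \<noteq> 0 \<and> (\<forall>y l r. form (gmult y \<gamma>) l r w = form y l r v)"
proof -
  obtain A where A: "A \<in> SLO" "\<gamma> = rational (\<lambda>_. A)" using assms(1) by (auto simp: \<Gamma>_eq)
  obtain a b c d where A': "A = mk2 a b c d" by (rule mk2_cases)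
  have det: "a * d - b * c = 1" using A(1) by (simp add: SL2_def A')
  have int: "algebraic_int a" "algebraic_int b" "algebraic_int c" "algebraic_int d"
    using A(1) unfolding SL2_def A' by (metis (mono_tags, lifting) mem_Collect_eq mk2_nth)+
  define w :: "'k^2" where "w = (\<chi> i. if i = 1 then d * v $ 1 - b * v $ 2 else a * v $ 2 - c * v $ 1)"
  have w: "w $ 1 = d * v $ 1 - b * v $ 2" "w $ 2 = a * v $ 2 - c * v $ 1" by (simp_all add: w_def)
  have v: "v $ 1 = a * w $ 1 + b * w $ 2" "v $ 2 = c * w $ 1 + d * w $ 2"
  proof -
    have "v $ 1 = (a * d - b * c) * v $ 1" "v $ 2 = (a * d - b * c) * v $ 2" by (simp_all add: det)
    then show "v $ 1 = a * w $ 1 + b * w $ 2" "v $ 2 = c * w $ 1 + d * w $ 2"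
      unfolding w by (simp_all add: algebra_simps)
  qed
  have "w \<noteq> 0" using assms(3) v by (auto simp: vec_eq_iff forall_2)
  moreover have "integral_vec w" unfolding w
    using int assms(2) by (auto intro!: algebraic_int_diff algebraic_int_add_mult(2))
  moreover have "form (gmult y \<gamma>) l r w = form y l r v" for y l r
    unfolding form_def v by (simp add: A(2) A' matrix_matrix_mult_def sum_2 \<sigma>_simps algebra_simps)
  ultimately show ?thesis by blast
qed

text \<open>
  A bounded element of determinant \<open>1\<close> has a bounded inverse, so it cannot shorten the integral vector that
  \<open>\<gamma>\<close> carries to \<open>v\<close> by more than a constant factor.
\<close>
lemma height_of_bounded:
  assumes ij: "i \<noteq> j" and u: "unit_at i j \<epsilon>" and v: "v \<noteq> 0" "integral_vec v"
  shows "\<exists>C. \<forall>y \<gamma>. y \<in> G \<longrightarrow> \<gamma> \<in> \<Gamma> \<longrightarrow> norm (gmult y \<gamma>) \<le> r \<longrightarrow>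
    (\<Sum>l\<in>UNIV. weight i j \<epsilon> l * ln (cmod (form y l 1 v) + cmod (form y l 2 v))) \<ge> - C"
proof -
  obtain C where C: "\<And>v. v \<noteq> 0 \<Longrightarrow> integral_vec v \<Longrightarrow> (\<Sum>l\<in>UNIV. weight i j \<epsilon> l * ln (vsize l v)) \<ge> - C"
    using height_lower_bound[OF ij u] by blast
  define r' where "r' = max r 1"
  have r': "r' \<ge> 1" "r' \<ge> r" by (auto simp: r'_def)
  have "(\<Sum>l\<in>UNIV. weight i j \<epsilon> l * ln (cmod (form y l 1 v) + cmod (form y l 2 v)))
      \<ge> - (C + (\<Sum>l\<in>UNIV. weight i j \<epsilon> l * ln (2 * r')))"
    if y: "y \<in> G" and \<gamma>: "\<gamma> \<in> \<Gamma>" and n: "norm (gmult y \<gamma>) \<le> r" for y \<gamma>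
  proof -
    let ?x = "gmult y \<gamma>"
    obtain w where w: "integral_vec w" "w \<noteq> 0" "\<And>y l r. form (gmult y \<gamma>) l r w = form y l r v"
      using form_integral_lattice[OF \<gamma> v(2,1)] by blast
    have xG: "?x \<in> G" using y \<Gamma>_G[OF \<gamma>] by (rule G_closed_mult)
    have f: "cmod (form y l 1 v) + cmod (form y l 2 v) > 0" for l
    proof -
      obtain r where "form y l r v \<noteq> 0" using form_nonzero[OF y v(1)] by blast
      then show ?thesis using exhaust_2[of r] by (auto simp: add_pos_nonneg add_nonneg_pos)
    qed
    have "vsize l w \<le> 2 * r' * (cmod (form y l 1 v) + cmod (form y l 2 v))" for l
    proof -
      have x: "cmod (?x $ l $ a $ b) \<le> r'" for a b using cmod_entry_le_norm[of ?x l a b] n r' by linarith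
      have d: "?x $ l $ 1 $ 1 * ?x $ l $ 2 $ 2 - ?x $ l $ 1 $ 2 * ?x $ l $ 2 $ 1 = 1"
        using xG by (simp add: G_iff det_2 del: gmult_nth)
      have "\<sigma> l (w $ 1) = (?x $ l $ 1 $ 1 * ?x $ l $ 2 $ 2 - ?x $ l $ 1 $ 2 * ?x $ l $ 2 $ 1) * \<sigma> l (w $ 1)"
        "\<sigma> l (w $ 2) = (?x $ l $ 1 $ 1 * ?x $ l $ 2 $ 2 - ?x $ l $ 1 $ 2 * ?x $ l $ 2 $ 1) * \<sigma> l (w $ 2)"
        by (simp_all only: d mult_1)
      then have s: "\<sigma> l (w $ 1) = ?x $ l $ 2 $ 2 * form y l 1 v - ?x $ l $ 1 $ 2 * form y l 2 v"
        "\<sigma> l (w $ 2) = ?x $ l $ 1 $ 1 * form y l 2 v - ?x $ l $ 2 $ 1 * form y l 1 v"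
        unfolding w(3)[symmetric] unfolding form_def by (simp_all add: algebra_simps del: gmult_nth)
      have t: "cmod (p * z - q * z') \<le> r' * cmod z + r' * cmod z'" if "cmod p \<le> r'" "cmod q \<le> r'" for p q z z'
        by (rule order.trans[OF norm_triangle_ineq4], unfold norm_mult) (intro add_mono mult_right_mono that norm_ge_zero)
      show ?thesis unfolding vsize_def s
        using t[OF x[of 2 2] x[of 1 2], of "form y l 1 v" "form y l 2 v"]
          t[OF x[of 1 1] x[of 2 1], of "form y l 2 v" "form y l 1 v"] by (simp add: algebra_simps)
    qed
    then have le: "ln (vsize l w) \<le> ln (2 * r' * (cmod (form y l 1 v) + cmod (form y l 2 v)))" for l
      using vsize_pos[OF w(2), of l] f[of l] r' by simp
    then have "ln (vsize l w) \<le> ln (2 * r') + ln (cmod (form y l 1 v) + cmod (form y l 2 v))" for l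
      using ln_mult_pos[of "2 * r'" "cmod (form y l 1 v) + cmod (form y l 2 v)"] f[of l] r' le[of l] by linarith
    then have "(\<Sum>l\<in>UNIV. weight i j \<epsilon> l * ln (vsize l w))
        \<le> (\<Sum>l\<in>UNIV. weight i j \<epsilon> l * (ln (2 * r') + ln (cmod (form y l 1 v) + cmod (form y l 2 v))))"
      using weight_pos[OF u] by (intro sum_mono mult_left_mono) (auto intro: less_imp_le)
    then show ?thesis using C[OF w(2,1)] by (simp add: distrib_left sum.distrib)
  qed
  then show ?thesis by blast
qed

end


section \<open>Limits of translates of a rational point\<close>

context hilbert_rank2
begin

text \<open>
  If the second rows of \<open>q\<close> at the two places are independent, the rows span the rational
  matrix \<open>frame\<close>, and \<open>q\<close> differs from it by a unipotent factor at \<open>i\<close> and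
  by a factor with vanishing last entry at \<open>j\<close>.
\<close>
definition frame :: "'i \<Rightarrow> 'i \<Rightarrow> ('i \<Rightarrow> 'k^2^2) \<Rightarrow> 'k^2^2" where
  "frame i j q = mk2 (q j $ 2 $ 1 / rel i j q $ 2 $ 1) (q j $ 2 $ 2 / rel i j q $ 2 $ 1) (q i $ 2 $ 1) (q i $ 2 $ 2)"

text \<open>
  Contraction kills the upper right entry of the unipotent factor at \<open>i\<close> and the upper left entry of the factor
  at \<open>j\<close>.
\<close>
definition limit :: "'i \<Rightarrow> 'i \<Rightarrow> ('i \<Rightarrow> 'k^2^2) \<Rightarrow> 'i \<Rightarrow> 'k^2^2" where
  "limit i j q l = (if l = i then frame i j q
     else mk2 0 (- 1 / rel i j q $ 2 $ 1) (rel i j q $ 2 $ 1) 0 ** frame i j q)"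

lemma rel_21: "rel i j q $ 2 $ 1 = q j $ 2 $ 1 * q i $ 2 $ 2 - q j $ 2 $ 2 * q i $ 2 $ 1"
  by (simp add: rel_def adj2_def matrix_matrix_mult_def sum_2)

lemma frame_decomposition:
  assumes q: "\<And>l. det (q l) = 1" and \<delta>: "rel i j q $ 2 $ 1 = \<delta>" "\<delta> \<noteq> 0"
  shows "det (frame i j q) = 1" "\<exists>x. q i = mk2 1 x 0 1 ** frame i j q"
    "\<exists>y. q j = mk2 y (- 1 / \<delta>) \<delta> 0 ** frame i j q"
proof -
  obtain a b c d where qi: "q i = mk2 a b c d" by (rule mk2_cases)
  obtain a' b' c' d' where qj: "q j = mk2 a' b' c' d'" by (rule mk2_cases)
  have di: "a * d - b * c = 1" and dj: "a' * d' - b' * c' = 1"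
    using q[of i] q[of j] by (simp_all add: qi qj)
  have \<delta>': "\<delta> = c' * d - d' * c" using \<delta>(1) by (simp add: rel_21 qi qj)
  have P: "frame i j q = mk2 (c' / \<delta>) (d' / \<delta>) c d" by (simp add: frame_def qi qj \<delta>(1))
  have "c' / \<delta> * d - d' / \<delta> * c = (c' * d - d' * c) / \<delta>" by (simp add: diff_divide_distrib)
  then show "det (frame i j q) = 1" unfolding P det_mk2 \<delta>'[symmetric] using \<delta>(2) by simp
  have "\<delta> * a = c' + (b * c' - a * d') * c" unfolding \<delta>' using di by algebra
  moreover have "\<delta> * b = d' + (b * c' - a * d') * d" unfolding \<delta>' using di by algebra
  ultimately have "q i = mk2 1 ((b * c' - a * d') / \<delta>) 0 1 ** frame i j q"
    unfolding P qi mk2_mult using \<delta>(2) by (simp add: eq_mk2_iff field_simps)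
  then show "\<exists>x. q i = mk2 1 x 0 1 ** frame i j q" by blast
  have "\<delta> * a' = (a' * d - b' * c) * c' - c" unfolding \<delta>' using dj by algebra
  moreover have "\<delta> * b' = (a' * d - b' * c) * d' - d" unfolding \<delta>' using dj by algebra
  ultimately obtain y where y: "\<delta> * a' = y * c' - c" "\<delta> * b' = y * d' - d" by blast
  have "q j = mk2 y (- 1 / \<delta>) \<delta> 0 ** frame i j q"
    unfolding P qj mk2_mult using \<delta>(2) y by (simp add: eq_mk2_iff field_simps)
  then show "\<exists>y. q j = mk2 y (- 1 / \<delta>) \<delta> 0 ** frame i j q" by blast
qed

lemma det_limit:
  assumes "\<And>l. det (q l) = 1" "rel i j q $ 2 $ 1 \<noteq> 0"
  shows "det (limit i j q l) = 1"
  using frame_decomposition(1)[OF assms(1) refl assms(2)] assms(2) by (simp add: limit_def det_mul)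

definition unit_diag :: "'i \<Rightarrow> 'k \<Rightarrow> nat \<Rightarrow> 'i \<Rightarrow> complex" where
  "unit_diag i \<eta> n l = (if l = i then 1 / \<sigma> l \<eta> ^ n else \<sigma> l \<eta> ^ n)"

lemma pos_power: "t \<in> pos l \<Longrightarrow> t ^ n \<in> pos l"
  by (induction n) (auto intro: pos_simps)

lemma unit_diag_Pos: "unit_at i j \<eta> \<Longrightarrow> unit_diag i \<eta> n \<in> Pos"
  unfolding Pos_def unit_diag_def unit_at_def by (auto intro!: pos_power pos_simps(3) pos_simps(1))

text \<open>
  The lattice element multiplies the two basis vectors of the frame by \<open>\<eta>\<^sup>n\<close> and \<open>\<eta>\<^sup>-\<^sup>n\<close>. The diagonal
  element contracts at both places and cancels these factors in the entries of \<open>limit\<close>, whereas the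
  remaining entry of the decomposition of \<open>q\<close> tends to zero.
\<close>
lemma tendsto_limit:
  assumes ij: "i \<noteq> j" and q: "\<And>l. det (q l) = 1" and \<delta>: "rel i j q $ 2 $ 1 \<noteq> 0" and \<eta>: "unit_at i j \<eta>"
  shows "(\<lambda>n. gmult (diag (unit_diag i \<eta> n)) (gmult (rational q)
     (rational (\<lambda>_. adj2 (frame i j q) ** dg (\<eta> ^ n) ** frame i j q)))) \<longlonglongrightarrow> rational (limit i j q)"
proof -
  define P where "P = frame i j q"
  define d where "d = rel i j q $ 2 $ 1"
  have d: "d \<noteq> 0" using \<delta> by (simp add: d_def)
  note dec = frame_decomposition[OF q d_def[symmetric] d, folded P_def]
  obtain x where x: "q i = mk2 1 x 0 1 ** P" using dec(2) by blast
  obtain y where y: "q j = mk2 y (- 1 / d) d 0 ** P" using dec(3) by blast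
  have \<eta>': "1 < cmod (\<sigma> i \<eta>)" "cmod (\<sigma> j \<eta>) < 1" "\<eta> \<noteq> 0" using \<eta> by (auto simp: unit_at_def)
  have nz: "\<sigma> l \<eta> \<noteq> 0" for l using \<eta>'(3) by (simp add: \<sigma>_simps)
  have PP: "P ** (adj2 P ** B) = B" for B
    using adj2_inverse(2)[OF dec(1)] by (simp add: matrix_mul_assoc)
  have mult: "\<sigma>m l (A ** P) ** \<sigma>m l (adj2 P ** dg (\<eta> ^ n) ** P) = \<sigma>m l (A ** dg (\<eta> ^ n)) ** \<sigma>m l P" for l A n
  proof -
    have "(A ** P) ** (adj2 P ** dg (\<eta> ^ n) ** P) = (A ** dg (\<eta> ^ n)) ** P"
      by (simp add: PP flip: matrix_mul_assoc)
    then show ?thesis by (simp flip: \<sigma>m_mult)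
  qed
  have i: "(\<lambda>n. dg (unit_diag i \<eta> n i) ** (\<sigma>m i (q i) ** \<sigma>m i (adj2 P ** dg (\<eta> ^ n) ** P))) \<longlonglongrightarrow> \<sigma>m i P"
  proof -
    have "(\<lambda>n. mk2 1 (\<sigma> i x * (1 / \<sigma> i \<eta>) ^ n * (1 / \<sigma> i \<eta>) ^ n) 0 1 ** \<sigma>m i P) \<longlonglongrightarrow> mk2 1 (\<sigma> i x * 0 * 0) 0 1 ** \<sigma>m i P"
      using \<eta>'(1) by (intro tendsto_matrix_mult tendsto_mk2 tendsto_const tendsto_mult LIMSEQ_power_zero)
        (auto simp: norm_divide divide_less_eq_1)
    moreover have "mk2 1 (\<sigma> i x * 0 * 0) 0 1 ** \<sigma>m i P = \<sigma>m i P" by (simp flip: mk2_one)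
    moreover have "dg (unit_diag i \<eta> n i) ** (\<sigma>m i (q i) ** \<sigma>m i (adj2 P ** dg (\<eta> ^ n) ** P))
        = mk2 1 (\<sigma> i x * (1 / \<sigma> i \<eta>) ^ n * (1 / \<sigma> i \<eta>) ^ n) 0 1 ** \<sigma>m i P" for n
    proof -
      have "dg (unit_diag i \<eta> n i) ** \<sigma>m i (mk2 1 x 0 1 ** dg (\<eta> ^ n)) = mk2 1 (\<sigma> i x * (1 / \<sigma> i \<eta>) ^ n * (1 / \<sigma> i \<eta>) ^ n) 0 1"
        using nz[of i] by (simp add: mk2_mult unit_diag_def \<sigma>_simps eq_mk2_iff power_divide field_simps)
      then show ?thesis unfolding x mult by (simp add: matrix_mul_assoc)
    qed
    ultimately show ?thesis by simp
  qed
  have j: "(\<lambda>n. dg (unit_diag i \<eta> n j) ** (\<sigma>m j (q j) ** \<sigma>m j (adj2 P ** dg (\<eta> ^ n) ** P))) \<longlonglongrightarrow> \<sigma>m j (mk2 0 (- 1 / d) d 0 ** P)"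
  proof -
    have "(\<lambda>n. mk2 (\<sigma> j y * \<sigma> j \<eta> ^ n * \<sigma> j \<eta> ^ n) (\<sigma> j (- 1 / d)) (\<sigma> j d) 0 ** \<sigma>m j P) \<longlonglongrightarrow> mk2 (\<sigma> j y * 0 * 0) (\<sigma> j (- 1 / d)) (\<sigma> j d) 0 ** \<sigma>m j P"
      using \<eta>'(2) by (intro tendsto_matrix_mult tendsto_mk2 tendsto_const tendsto_mult LIMSEQ_power_zero)
    moreover have "mk2 (\<sigma> j y * 0 * 0) (\<sigma> j (- 1 / d)) (\<sigma> j d) 0 ** \<sigma>m j P = \<sigma>m j (mk2 0 (- 1 / d) d 0 ** P)"
      by (simp add: \<sigma>m_mult \<sigma>_simps(1))
    moreover have "dg (unit_diag i \<eta> n j) ** (\<sigma>m j (q j) ** \<sigma>m j (adj2 P ** dg (\<eta> ^ n) ** P))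
        = mk2 (\<sigma> j y * \<sigma> j \<eta> ^ n * \<sigma> j \<eta> ^ n) (\<sigma> j (- 1 / d)) (\<sigma> j d) 0 ** \<sigma>m j P" for n
    proof -
      have "dg (unit_diag i \<eta> n j) ** \<sigma>m j (mk2 y (- 1 / d) d 0 ** dg (\<eta> ^ n))
          = mk2 (\<sigma> j y * \<sigma> j \<eta> ^ n * \<sigma> j \<eta> ^ n) (\<sigma> j (- 1 / d)) (\<sigma> j d) 0"
        using nz[of j] ij by (simp add: mk2_mult unit_diag_def \<sigma>_simps eq_mk2_iff field_simps)
      then show ?thesis unfolding y mult by (simp add: matrix_mul_assoc)
    qed
    ultimately show ?thesis by simp
  qed
  show ?thesis
  proof (rule vec_tendstoI)
    fix l
    have "l = i \<or> l = j" using UNIV_places[OF ij] by blast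
    then show "(\<lambda>n. gmult (diag (unit_diag i \<eta> n)) (gmult (rational q)
       (rational (\<lambda>_. adj2 (frame i j q) ** dg (\<eta> ^ n) ** frame i j q))) $ l) \<longlonglongrightarrow> rational (limit i j q) $ l"
      using i j ij by (auto simp: limit_def P_def d_def)
  qed
qed

text \<open>
  All other factors converge, so the lattice elements converge, and their limit is in the lattice, which is closed.
\<close>
lemma limit_in_dcoset:
  assumes t: "\<And>n. t n \<in> Pos" "\<And>l. (\<lambda>n. t n l) \<longlonglongrightarrow> t' l" "t' \<in> Pos"
    and y: "\<And>n. y n \<in> G" "y \<longlonglongrightarrow> h" "h \<in> G" and \<gamma>: "\<And>n. \<gamma> n \<in> \<Gamma>"
    and x: "(\<lambda>n. gmult (diag (t n)) (gmult (y n) (\<gamma> n))) \<longlonglongrightarrow> x"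
  shows "x \<in> dcoset h"
proof -
  have "(\<lambda>n. gmult (ginv (y n)) (gmult (ginv (diag (t n))) (gmult (diag (t n)) (gmult (y n) (\<gamma> n)))))
      \<longlonglongrightarrow> gmult (ginv h) (gmult (ginv (diag t')) x)"
  proof (intro tendsto_gmult tendsto_ginv y x)
    show "(\<lambda>n. diag (t n)) \<longlonglongrightarrow> diag t'"
      unfolding diag_def using Pos_simps(4)[OF t(3)]
      by (intro tendsto_vec_lambda tendsto_mk2 tendsto_const t tendsto_divide) auto
  qed
  moreover have "gmult (ginv (y n)) (gmult (ginv (diag (t n))) (gmult (diag (t n)) (gmult (y n) (\<gamma> n)))) = \<gamma> n" for n
    by (simp add: ginv_cancel[OF diag_G[OF t(1)]] ginv_cancel[OF y(1)])
  ultimately have "\<gamma> \<longlonglongrightarrow> gmult (ginv h) (gmult (ginv (diag t')) x)" by simp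
  then have L: "gmult (ginv h) (gmult (ginv (diag t')) x) \<in> \<Gamma>"
    using closed_sequentially[OF closed_\<Gamma>] \<gamma> by blast
  have "x = gmult (diag t') (gmult h (gmult (ginv h) (gmult (ginv (diag t')) x)))"
    by (simp add: ginv_cancel[OF y(3)] ginv_cancel[OF diag_G[OF t(3)]])
  moreover have "diag t' \<in> D" using t(3) by (auto simp: D_eq)
  ultimately show ?thesis using L dcosetI by metis
qed

lemma Pos_bounded_subsequence:
  assumes t: "\<And>n::nat. t n \<in> Pos" and B: "\<And>n l. \<bar>ln (cmod (t n l))\<bar> \<le> B"
  shows "\<exists>r t'. strict_mono r \<and> t' \<in> Pos \<and> (\<forall>l. (\<lambda>n. t (r n) l) \<longlonglongrightarrow> t' l)"
proof -
  define v :: "nat \<Rightarrow> complex^'i" where "v n = (\<chi> l. t n l)" for n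
  have pos: "cmod (t n l) > 0" for n l using Pos_simps(4)[OF t] by simp
  have up: "cmod (t n l) \<le> exp B" "exp (- B) \<le> cmod (t n l)" for n l
    using B[of n l] pos[of n l] by (metis abs_le_iff exp_le_cancel_iff exp_ln, metis abs_le_iff exp_le_cancel_iff exp_ln minus_le_iff)
  have "norm (v n) \<le> CARD('i) * exp B" for n
  proof -
    have "norm (v n) \<le> (\<Sum>l\<in>UNIV. norm (v n $ l))" by (rule norm_le_sum_components)
    also have "\<dots> \<le> (\<Sum>l\<in>(UNIV::'i set). exp B)" by (intro sum_mono) (simp add: v_def up)
    finally show ?thesis by simp
  qed
  then have "\<forall>n. v n \<in> cball 0 (CARD('i) * exp B)" by simp
  then obtain l r where r: "strict_mono r" "(v \<circ> r) \<longlonglongrightarrow> l"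
    using compact_cball[of "0 :: complex^'i"] unfolding compact_def by meson
  have c: "(\<lambda>n. t (r n) k) \<longlonglongrightarrow> l $ k" for k
    using tendsto_vec_nth[OF r(2), of k] by (simp add: v_def comp_def)
  have "l $ k \<in> pos k" for k
  proof (rule pos_limit[OF _ c])
    show "t (r n) k \<in> pos k" for n using t[of "r n"] by (simp add: Pos_def)
    have "exp (- B) \<le> cmod (l $ k)"
      using tendsto_norm[OF c[of k]] up(2) by (intro LIMSEQ_le_const) auto
    then show "l $ k \<noteq> 0" by (metis exp_gt_zero norm_zero not_le)
  qed
  then show ?thesis using r(1) c by (intro exI[of _ r] exI[of _ "\<lambda>k. l $ k"]) (auto simp: Pos_def)
qed

text \<open>
  The powers of the unit form a discrete cocompact set of scales. As the coordinates at the two places contract at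
  comparable speed, one power of the unit matches both up to a bounded factor.
\<close>
lemma limit_of_contracting:
  assumes ij: "i \<noteq> j" and q: "\<And>l. det (q l) = 1" and \<delta>: "rel i j q $ 2 $ 1 \<noteq> 0" and u: "unit_at i j \<epsilon>"
    and t: "\<And>n::nat. t n \<in> Pos" and \<gamma>: "\<And>n. \<gamma> n \<in> \<Gamma>"
    and x: "(\<lambda>n. gmult (diag (t n)) (gmult (rational q) (\<gamma> n))) \<longlonglongrightarrow> x"
    and le: "\<And>n. ln (cmod (t n i)) \<le> 0" and to: "filterlim (\<lambda>n. ln (cmod (t n i))) at_bot sequentially"
    and C: "\<And>n. \<bar>weight i j \<epsilon> i * ln (cmod (t n i)) - weight i j \<epsilon> j * ln (cmod (t n j))\<bar> \<le> C"
  shows "x \<in> dcoset (rational (limit i j q))"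
proof -
  define P where "P = frame i j q"
  have dP: "det P = 1" unfolding P_def by (rule frame_decomposition(1)[OF q refl \<delta>])
  obtain m where m: "m > 0" "\<And>n. adj2 P ** dg ((\<epsilon> ^ m) ^ n) ** P \<in> SLO"
    using unit_conjugate[OF u dP] by blast
  define \<eta> where "\<eta> = \<epsilon> ^ m"
  have \<eta>: "unit_at i j \<eta>" unfolding \<eta>_def by (rule unit_at_power[OF u m(1)])
  define w where "w n = rational (\<lambda>_. adj2 P ** dg (\<eta> ^ n) ** P)" for n
  have w\<Gamma>: "w n \<in> \<Gamma>" for n using m(2) by (auto simp: w_def \<eta>_def \<Gamma>_eq)
  define y where "y n = gmult (diag (unit_diag i \<eta> n)) (gmult (rational q) (w n))" for n
  have ylim: "y \<longlonglongrightarrow> rational (limit i j q)"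
    unfolding y_def w_def P_def by (rule tendsto_limit[OF ij q \<delta> \<eta>])
  have yG: "y n \<in> G" for n
    unfolding y_def by (intro G_closed_mult diag_G unit_diag_Pos[OF \<eta>] rational_G q \<Gamma>_G w\<Gamma>)
  define a where "a = ln (cmod (\<sigma> i \<eta>))"
  define b where "b = - ln (cmod (\<sigma> j \<eta>))"
  have e: "1 < cmod (\<sigma> i \<epsilon>)" "cmod (\<sigma> j \<epsilon>) < 1" "\<epsilon> \<noteq> 0" using u by (auto simp: unit_at_def)
  have ab: "a = m * weight i j \<epsilon> j" "b = m * weight i j \<epsilon> i"
    using ij e by (simp_all add: a_def b_def \<eta>_def weight_def \<sigma>_simps norm_power ln_realpow)
  have a: "a > 0" using \<eta> unfolding a_def unit_at_def by (intro ln_gt_zero) blast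
  \<comment> \<open>The exponent for which \<open>t n i\<close> and the power of the unit agree at \<open>i\<close> up to the factor \<open>exp a\<close>.\<close>
  define k where "k n = nat \<lfloor>- ln (cmod (t n i)) / a\<rfloor>" for n
  have k: "real (k n) \<le> - ln (cmod (t n i)) / a" "- ln (cmod (t n i)) / a < real (k n) + 1" for n
  proof -
    have "- ln (cmod (t n i)) / a \<ge> 0" using le[of n] a by (intro divide_nonneg_pos) auto
    then show "real (k n) \<le> - ln (cmod (t n i)) / a" "- ln (cmod (t n i)) / a < real (k n) + 1"
      unfolding k_def by linarith+
  qed
  have kinf: "filterlim k at_top sequentially"
  proof (unfold filterlim_at_top, intro allI)
    fix K :: nat
    have "\<forall>\<^sub>F n in sequentially. ln (cmod (t n i)) \<le> - (a * (real K + 1))"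
      using to unfolding filterlim_at_bot by blast
    then show "\<forall>\<^sub>F n in sequentially. K \<le> k n"
    proof (rule eventually_mono)
      fix n assume "ln (cmod (t n i)) \<le> - (a * (real K + 1))"
      then have "real K + 1 \<le> - ln (cmod (t n i)) / a" using a by (simp add: field_simps)
      then show "K \<le> k n" using k(2)[of n] by linarith
    qed
  qed
  define \<tau> where "\<tau> n l = t n l * (1 / unit_diag i \<eta> (k n) l)" for n l
  have \<tau>: "\<tau> n \<in> Pos" for n
    unfolding \<tau>_def by (intro Pos_simps(2)[OF t] Pos_simps(3) unit_diag_Pos[OF \<eta>])
  have nz: "\<sigma> l \<eta> \<noteq> 0" for l using \<eta> by (auto simp: unit_at_def \<sigma>_simps)
  have tn: "cmod (t n l) > 0" for n l using Pos_simps(4)[OF t] by simp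
  have lni: "ln (cmod (\<tau> n i)) = ln (cmod (t n i)) + k n * a" for n
    using tn[of n i] nz[of i] by (simp add: \<tau>_def unit_diag_def norm_mult norm_divide norm_power a_def ln_mult ln_realpow)
  have lnj: "ln (cmod (\<tau> n j)) = ln (cmod (t n j)) + k n * b" for n
    using tn[of n j] nz[of j] ij by (simp add: \<tau>_def unit_diag_def norm_mult norm_divide norm_power b_def ln_mult ln_div ln_realpow)
  let ?ci = "weight i j \<epsilon> i" and ?cj = "weight i j \<epsilon> j"
  have c: "?ci > 0" "?cj > 0" using weight_pos[OF u] by auto
  have bi: "\<bar>ln (cmod (\<tau> n i))\<bar> \<le> a" for n
    using k[of n] a unfolding lni by (simp add: field_simps abs_le_iff)
  have bj: "\<bar>ln (cmod (\<tau> n j))\<bar> \<le> (C + ?ci * a) / ?cj" for n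
  proof -
    have "?cj * ln (cmod (\<tau> n j)) = ?ci * ln (cmod (\<tau> n i)) - (?ci * ln (cmod (t n i)) - ?cj * ln (cmod (t n j)))"
      unfolding lni lnj ab by (simp add: algebra_simps)
    moreover have "\<bar>?ci * ln (cmod (\<tau> n i))\<bar> \<le> ?ci * a"
      using c(1) mult_left_mono[OF bi[of n], of ?ci] by (simp add: abs_mult)
    ultimately have "\<bar>?cj * ln (cmod (\<tau> n j))\<bar> \<le> C + ?ci * a" using C[of n] by linarith
    then show ?thesis using c(2) by (simp add: abs_mult field_simps)
  qed
  have "\<bar>ln (cmod (\<tau> n l))\<bar> \<le> max a ((C + ?ci * a) / ?cj)" for n l
  proof -
    have "l = i \<or> l = j" using UNIV_places[OF ij] by blast
    then show ?thesis using bi[of n] bj[of n] by auto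
  qed
  from Pos_bounded_subsequence[of \<tau>, OF \<tau> this] obtain r t' where r: "strict_mono r" "t' \<in> Pos" "\<And>l. (\<lambda>n. \<tau> (r n) l) \<longlonglongrightarrow> t' l"
    by blast
  show ?thesis
  proof (rule limit_in_dcoset[where t = "\<lambda>n. \<tau> (r n)" and y = "\<lambda>n. y (k (r n))" and t' = t'
        and \<gamma> = "\<lambda>n. gmult (ginv (w (k (r n)))) (\<gamma> (r n))"])
    show "rational (limit i j q) \<in> G" by (intro rational_G det_limit q \<delta>)
    show "(\<lambda>n. y (k (r n))) \<longlonglongrightarrow> rational (limit i j q)"
      using filterlim_compose[OF ylim filterlim_compose[OF kinf filterlim_subseq[OF r(1)]]] .
    show "gmult (ginv (w (k (r n)))) (\<gamma> (r n)) \<in> \<Gamma>" for n by (intro \<Gamma>_mult \<Gamma>_ginv w\<Gamma> \<gamma>)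
    have "gmult (diag (\<tau> n)) (gmult (y (k n)) (gmult (ginv (w (k n))) (\<gamma> n))) = gmult (diag (t n)) (gmult (rational q) (\<gamma> n))" for n
    proof -
      have "gmult (y (k n)) (gmult (ginv (w (k n))) (\<gamma> n)) = gmult (diag (unit_diag i \<eta> (k n))) (gmult (rational q) (\<gamma> n))"
        unfolding y_def by (simp add: gmult_assoc ginv_cancel[OF \<Gamma>_G[OF w\<Gamma>]])
      moreover have "gmult (diag (\<tau> n)) (diag (unit_diag i \<eta> (k n))) = diag (t n)"
        unfolding diag_mult \<tau>_def using Pos_simps(4)[OF unit_diag_Pos[OF \<eta>]] by simp
      ultimately show ?thesis by (metis gmult_assoc)
    qed
    then show "(\<lambda>n. gmult (diag (\<tau> (r n))) (gmult (y (k (r n))) (gmult (ginv (w (k (r n)))) (\<gamma> (r n))))) \<longlonglongrightarrow> x"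
      using LIMSEQ_subseq_LIMSEQ[OF x r(1)] by (simp add: comp_def)
  qed (use r yG \<tau> in auto)
qed

end


section \<open>The four directions to infinity\<close>

context hilbert_rank2
begin

text \<open>
  A sign pattern \<open>e\<close> selects the places at which a coordinate tends to infinity. Acting there with the Weyl
  element turns the direction into the one in which both coordinates contract.
\<close>
definition weyl_at :: "('i \<Rightarrow> bool) \<Rightarrow> complex^2^2^'i" where
  "weyl_at e = (\<chi> l. if e l then weyl else mat 1)"

definition weyl_inv_at :: "('i \<Rightarrow> bool) \<Rightarrow> complex^2^2^'i" where
  "weyl_inv_at e = (\<chi> l. if e l then weyl_inv else mat 1)"

definition twist :: "('i \<Rightarrow> bool) \<Rightarrow> ('i \<Rightarrow> 'k^2^2) \<Rightarrow> 'i \<Rightarrow> 'k^2^2" where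
  "twist e q l = (if e l then weyl ** q l else q l)"

definition untwist :: "('i \<Rightarrow> bool) \<Rightarrow> ('i \<Rightarrow> 'k^2^2) \<Rightarrow> 'i \<Rightarrow> 'k^2^2" where
  "untwist e q l = (if e l then weyl_inv ** q l else q l)"

definition flip :: "('i \<Rightarrow> bool) \<Rightarrow> ('i \<Rightarrow> complex) \<Rightarrow> 'i \<Rightarrow> complex" where
  "flip e t l = (if e l then 1 / t l else t l)"

lemma twist_simps:
  "rational (twist e q) = gmult (weyl_at e) (rational q)" "rational (untwist e q) = gmult (weyl_inv_at e) (rational q)"
  "untwist e (twist e q) = q" "det (twist e q l) = det (q l)" "det (untwist e q l) = det (q l)"
  by (auto simp: vec_eq_iff[of "rational _"] twist_def untwist_def weyl_at_def weyl_inv_at_def \<sigma>m_mult weyl_simps det_mul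
      matrix_mul_assoc fun_eq_iff)

lemma weyl_inv_at_weyl_at: "gmult (weyl_inv_at e) (gmult (weyl_at e) x) = x"
  by (simp add: vec_eq_iff[of "gmult _ _"] weyl_at_def weyl_inv_at_def matrix_mul_assoc weyl_simps)

lemma weyl_inv_dg: "t \<noteq> 0 \<Longrightarrow> weyl_inv ** dg t = dg (1 / t) ** (weyl_inv :: complex^2^2)"
  by (simp add: weyl_inv_def mk2_mult)

lemma weyl_at_diag:
  assumes "t \<in> Pos"
  shows "gmult (weyl_at e) (gmult (diag t) x) = gmult (diag (flip e t)) (gmult (weyl_at e) x)"
    "gmult (weyl_inv_at e) (gmult (diag t) x) = gmult (diag (flip e t)) (gmult (weyl_inv_at e) x)"
proof -
  have "gmult (weyl_at e) (diag t) = gmult (diag (flip e t)) (weyl_at e)"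
    "gmult (weyl_inv_at e) (diag t) = gmult (diag (flip e t)) (weyl_inv_at e)"
    using Pos_simps(4)[OF assms]
    by (simp_all add: vec_eq_iff[of "gmult _ _"] weyl_at_def weyl_inv_at_def flip_def weyl_dg weyl_inv_dg)
  then show "gmult (weyl_at e) (gmult (diag t) x) = gmult (diag (flip e t)) (gmult (weyl_at e) x)"
    "gmult (weyl_inv_at e) (gmult (diag t) x) = gmult (diag (flip e t)) (gmult (weyl_inv_at e) x)"
    by (metis gmult_assoc)+
qed

lemma flip_Pos: "t \<in> Pos \<Longrightarrow> flip e t \<in> Pos"
  using Pos_simps(3)[of t] by (auto simp: Pos_def flip_def)

lemma ln_flip: "t \<in> Pos \<Longrightarrow> ln (cmod (flip e t l)) = (if e l then - ln (cmod (t l)) else ln (cmod (t l)))"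
  using Pos_simps(4)[of t l] by (simp add: flip_def norm_divide ln_div)

lemma norm_weyl_at:
  fixes r :: real
  assumes "norm x \<le> r"
  shows "norm (gmult (weyl_at e) x) \<le> CARD('i) * (4 * r)"
proof (rule norm_le_of_entries)
  fix l a b
  have x: "cmod (x $ l $ a $ b) \<le> r" for a b using cmod_entry_le_norm[of x l a b] assms by linarith
  have "(weyl ** x $ l) $ 1 $ b = x $ l $ 2 $ b" "(weyl ** x $ l) $ 2 $ b = - x $ l $ 1 $ b" for b
    by (simp_all add: weyl_def matrix_matrix_mult_def sum_2)
  then show "cmod (gmult (weyl_at e) x $ l $ a $ b) \<le> r"
    using x exhaust_2[of a] by (auto simp: weyl_at_def)
qed

lemma weyl_inv_at_dcoset:
  assumes "y \<in> dcoset h"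
  shows "gmult (weyl_inv_at e) y \<in> dcoset (gmult (weyl_inv_at e) h)"
proof -
  obtain t \<gamma> where t: "t \<in> Pos" "\<gamma> \<in> \<Gamma>" "y = gmult (diag t) (gmult h \<gamma>)"
    using assms by (auto simp: dcoset_def D_eq)
  have "gmult (weyl_inv_at e) y = gmult (diag (flip e t)) (gmult (gmult (weyl_inv_at e) h) \<gamma>)"
    by (simp add: t(3) weyl_at_diag(2)[OF t(1)] gmult_assoc)
  moreover have "diag (flip e t) \<in> D" using flip_Pos[OF t(1)] by (auto simp: D_eq)
  ultimately show ?thesis using dcosetI t(2) by metis
qed

lemma kernel_vector:
  assumes q: "det (q l) = 1"
  shows "\<exists>v N. v \<noteq> 0 \<and> integral_vec v \<and> N \<noteq> 0 \<and> v $ 1 = N * q l $ 2 $ 2 \<and> v $ 2 = - (N * q l $ 2 $ 1)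
    \<and> form (rational q) l 1 v = \<sigma> l N \<and> form (rational q) l 2 v = 0"
proof -
  obtain N :: int where N: "N > 0" "\<forall>s\<in>{q l $ 2 $ 1, q l $ 2 $ 2}. algebraic_int (of_int N * s)"
    using common_denominator[of "{q l $ 2 $ 1, q l $ 2 $ 2}"] by auto
  define v :: "'k^2" where "v = (\<chi> c. if c = 1 then of_int N * q l $ 2 $ 2 else - (of_int N * q l $ 2 $ 1))"
  have v: "v $ 1 = of_int N * q l $ 2 $ 2" "v $ 2 = - (of_int N * q l $ 2 $ 1)" by (simp_all add: v_def)
  have "q l $ 1 $ 1 * v $ 1 + q l $ 1 $ 2 * v $ 2 = of_int N * (q l $ 1 $ 1 * q l $ 2 $ 2 - q l $ 1 $ 2 * q l $ 2 $ 1)"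
    unfolding v by (simp add: algebra_simps)
  then have f1: "q l $ 1 $ 1 * v $ 1 + q l $ 1 $ 2 * v $ 2 = of_int N" using q by (simp add: det_2)
  then have "v \<noteq> 0" using N(1) by auto
  moreover have "integral_vec v" unfolding v using N(2) by auto
  moreover have "form (rational q) l 1 v = \<sigma> l (of_int N)" unfolding form_rational f1 ..
  moreover have "form (rational q) l 2 v = 0" unfolding form_rational v by (simp add: \<sigma>_simps(1))
  ultimately show ?thesis using v N(1) by (intro exI[of _ v] exI[of _ "of_int N"]) auto
qed

text \<open>
  The height of the vector killed by the second row of \<open>q l\<close>: at \<open>l\<close> it is scaled by \<open>t l\<close>, and at \<open>m\<close> it
  can be lengthened at most by the factor \<open>exp \<bar>ln (cmod (t m))\<bar>\<close>.
\<close>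
lemma coordinate_lower_bound:
  assumes ij: "i \<noteq> j" and u: "unit_at i j \<epsilon>" and q: "\<And>l. det (q l) = 1" and lm: "l \<noteq> m"
  shows "\<exists>C. \<forall>t \<gamma>. t \<in> Pos \<longrightarrow> \<gamma> \<in> \<Gamma> \<longrightarrow> norm (gmult (diag t) (gmult (rational q) \<gamma>)) \<le> r \<longrightarrow>
    weight i j \<epsilon> l * ln (cmod (t l)) + weight i j \<epsilon> m * \<bar>ln (cmod (t m))\<bar> \<ge> - C"
proof -
  let ?c = "weight i j \<epsilon>"
  obtain v N where v: "v \<noteq> 0" "integral_vec v" "N \<noteq> 0" "form (rational q) l 1 v = \<sigma> l N" "form (rational q) l 2 v = 0"
    using kernel_vector[of q l, OF q] by blast
  obtain C where C: "\<And>y \<gamma>. y \<in> G \<Longrightarrow> \<gamma> \<in> \<Gamma> \<Longrightarrow> norm (gmult y \<gamma>) \<le> r \<Longrightarrow>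
    (\<Sum>l\<in>UNIV. ?c l * ln (cmod (form y l 1 v) + cmod (form y l 2 v))) \<ge> - C"
    using height_of_bounded[OF ij u v(1,2), of r] by blast
  define F where "F = cmod (form (rational q) m 1 v) + cmod (form (rational q) m 2 v)"
  obtain r0 where "form (rational q) m r0 v \<noteq> 0" using form_nonzero[OF rational_G[of q, OF q] v(1), of m] by blast
  then have F: "F > 0" using exhaust_2[of r0] by (auto simp: F_def add_pos_nonneg add_nonneg_pos)
  have "?c l * ln (cmod (t l)) + ?c m * \<bar>ln (cmod (t m))\<bar> \<ge> - (C + ?c l * ln (cmod (\<sigma> l N)) + ?c m * ln F)"
    if t: "t \<in> Pos" and \<gamma>: "\<gamma> \<in> \<Gamma>" and n: "norm (gmult (diag t) (gmult (rational q) \<gamma>)) \<le> r" for t \<gamma>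
  proof -
    let ?y = "gmult (diag t) (rational q)"
    have tl: "cmod (t l) > 0" "cmod (t m) > 0" using Pos_simps(4)[OF t] by auto
    have "?y \<in> G" by (intro G_closed_mult diag_G t rational_G q)
    from C[OF this \<gamma>] n have "- C \<le> ?c l * ln (cmod (form ?y l 1 v) + cmod (form ?y l 2 v))
        + ?c m * ln (cmod (form ?y m 1 v) + cmod (form ?y m 2 v))"
      by (simp add: gmult_assoc sum_places[OF lm])
    moreover have "ln (cmod (form ?y l 1 v) + cmod (form ?y l 2 v)) = ln (cmod (t l)) + ln (cmod (\<sigma> l N))"
      using tl v(3) by (simp add: form_diag v(4,5) norm_mult ln_mult \<sigma>_simps)
    moreover have "ln (cmod (form ?y m 1 v) + cmod (form ?y m 2 v)) \<le> \<bar>ln (cmod (t m))\<bar> + ln F"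
    proof -
      have e: "cmod (t m) \<le> exp \<bar>ln (cmod (t m))\<bar>" "1 / cmod (t m) \<le> exp \<bar>ln (cmod (t m))\<bar>"
      proof -
        have "cmod (t m) = exp (ln (cmod (t m)))" "1 / cmod (t m) = exp (- ln (cmod (t m)))"
          using tl(2) by (simp_all add: exp_minus inverse_eq_divide)
        moreover have "exp (ln (cmod (t m))) \<le> exp \<bar>ln (cmod (t m))\<bar>" "exp (- ln (cmod (t m))) \<le> exp \<bar>ln (cmod (t m))\<bar>"
          by (auto simp: abs_if)
        ultimately show "cmod (t m) \<le> exp \<bar>ln (cmod (t m))\<bar>" "1 / cmod (t m) \<le> exp \<bar>ln (cmod (t m))\<bar>"
          by linarith+
      qed
      have "cmod (form ?y m 1 v) + cmod (form ?y m 2 v)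
          = cmod (t m) * cmod (form (rational q) m 1 v) + (1 / cmod (t m)) * cmod (form (rational q) m 2 v)"
        by (simp add: form_diag norm_mult norm_divide)
      also have "\<dots> \<le> exp \<bar>ln (cmod (t m))\<bar> * cmod (form (rational q) m 1 v) + exp \<bar>ln (cmod (t m))\<bar> * cmod (form (rational q) m 2 v)"
        by (intro add_mono mult_right_mono e norm_ge_zero)
      also have "\<dots> = exp \<bar>ln (cmod (t m))\<bar> * F" by (simp add: F_def distrib_left)
      finally have le: "cmod (form ?y m 1 v) + cmod (form ?y m 2 v) \<le> exp \<bar>ln (cmod (t m))\<bar> * F" .
      have "cmod (form ?y m 1 v) + cmod (form ?y m 2 v) > 0"
      proof -
        obtain r1 where "form ?y m r1 v \<noteq> 0" using form_nonzero[OF \<open>?y \<in> G\<close> v(1), of m] by blast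
        then show ?thesis using exhaust_2[of r1] by (auto simp: add_pos_nonneg add_nonneg_pos)
      qed
      then have "ln (cmod (form ?y m 1 v) + cmod (form ?y m 2 v)) \<le> ln (exp \<bar>ln (cmod (t m))\<bar> * F)"
        using le F by simp
      then show ?thesis using F by (simp add: ln_mult)
    qed
    then have "?c m * ln (cmod (form ?y m 1 v) + cmod (form ?y m 2 v)) \<le> ?c m * (\<bar>ln (cmod (t m))\<bar> + ln F)"
      using weight_pos[OF u, of m] by (intro mult_left_mono) auto
    ultimately show ?thesis by (simp add: algebra_simps)
  qed
  then show ?thesis by blast
qed

text \<open>
  If the second rows at both places kill the same rational line, then this line is scaled by \<open>t\<close> at both places.
\<close>
lemma coincident_lower_bound:
  assumes ij: "i \<noteq> j" and u: "unit_at i j \<epsilon>" and q: "\<And>l. det (q l) = 1" and rel: "rel i j q $ 2 $ 1 = 0"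
  shows "\<exists>C. \<forall>t \<gamma>. t \<in> Pos \<longrightarrow> \<gamma> \<in> \<Gamma> \<longrightarrow> norm (gmult (diag t) (gmult (rational q) \<gamma>)) \<le> r \<longrightarrow>
    weight i j \<epsilon> i * ln (cmod (t i)) + weight i j \<epsilon> j * ln (cmod (t j)) \<ge> - C"
proof -
  let ?c = "weight i j \<epsilon>"
  obtain v N where v: "v \<noteq> 0" "integral_vec v" "N \<noteq> 0" "form (rational q) i 1 v = \<sigma> i N" "form (rational q) i 2 v = 0"
    "v $ 1 = N * q i $ 2 $ 2" "v $ 2 = - (N * q i $ 2 $ 1)"
    using kernel_vector[of q i, OF q] by blast
  have "q j $ 2 $ 1 * v $ 1 + q j $ 2 $ 2 * v $ 2 = N * rel i j q $ 2 $ 1"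
    unfolding v rel_21 by (simp add: algebra_simps)
  then have j2: "form (rational q) j 2 v = 0" unfolding form_rational rel by (simp add: \<sigma>_simps(1))
  obtain r' where "form (rational q) j r' v \<noteq> 0" using form_nonzero[OF rational_G[of q, OF q] v(1), of j] by blast
  then have j1: "form (rational q) j 1 v \<noteq> 0" using j2 exhaust_2[of r'] by auto
  obtain C where C: "\<And>y \<gamma>. y \<in> G \<Longrightarrow> \<gamma> \<in> \<Gamma> \<Longrightarrow> norm (gmult y \<gamma>) \<le> r \<Longrightarrow>
    (\<Sum>l\<in>UNIV. ?c l * ln (cmod (form y l 1 v) + cmod (form y l 2 v))) \<ge> - C"
    using height_of_bounded[OF ij u v(1,2), of r] by blast
  have "?c i * ln (cmod (t i)) + ?c j * ln (cmod (t j)) \<ge> - (C + ?c i * ln (cmod (\<sigma> i N)) + ?c j * ln (cmod (form (rational q) j 1 v)))"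
    if t: "t \<in> Pos" and \<gamma>: "\<gamma> \<in> \<Gamma>" and n: "norm (gmult (diag t) (gmult (rational q) \<gamma>)) \<le> r" for t \<gamma>
  proof -
    let ?y = "gmult (diag t) (rational q)"
    have tl: "cmod (t l) > 0" for l using Pos_simps(4)[OF t] by auto
    have "?y \<in> G" by (intro G_closed_mult diag_G t rational_G q)
    from C[OF this \<gamma>] n have "- C \<le> ?c i * ln (cmod (form ?y i 1 v) + cmod (form ?y i 2 v))
        + ?c j * ln (cmod (form ?y j 1 v) + cmod (form ?y j 2 v))"
      by (simp add: gmult_assoc sum_places[OF ij])
    moreover have "ln (cmod (form ?y i 1 v) + cmod (form ?y i 2 v)) = ln (cmod (t i)) + ln (cmod (\<sigma> i N))"
      using tl[of i] v(3) by (simp add: form_diag v(4,5) norm_mult ln_mult \<sigma>_simps)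
    moreover have "ln (cmod (form ?y j 1 v) + cmod (form ?y j 2 v)) = ln (cmod (t j)) + ln (cmod (form (rational q) j 1 v))"
      using tl[of j] j1 by (simp add: form_diag j2 norm_mult ln_mult)
    ultimately show ?thesis by (simp add: algebra_simps)
  qed
  then show ?thesis by blast
qed

lemma bounded_twist:
  fixes r :: real
  assumes "t \<in> Pos" "norm (gmult (diag t) (gmult (rational q) \<gamma>)) \<le> r"
  shows "norm (gmult (diag (flip e t)) (gmult (rational (twist e q)) \<gamma>)) \<le> CARD('i) * (4 * r)"
proof -
  have "gmult (diag (flip e t)) (gmult (rational (twist e q)) \<gamma>) = gmult (weyl_at e) (gmult (diag t) (gmult (rational q) \<gamma>))"
    by (simp add: weyl_at_diag(1)[OF assms(1)] twist_simps gmult_assoc)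
  then show ?thesis using norm_weyl_at[OF assms(2)] by simp
qed

text \<open>
  The lower bounds for both rows at \<open>l\<close>, the second one obtained by acting with the Weyl element at \<open>l\<close>.
\<close>
lemma coordinates_comparable:
  assumes ij: "i \<noteq> j" and u: "unit_at i j \<epsilon>" and q: "\<And>l. det (q l) = 1" and lm: "l \<noteq> m"
  shows "\<exists>C. \<forall>t \<gamma>. t \<in> Pos \<longrightarrow> \<gamma> \<in> \<Gamma> \<longrightarrow> norm (gmult (diag t) (gmult (rational q) \<gamma>)) \<le> r \<longrightarrow>
    weight i j \<epsilon> l * \<bar>ln (cmod (t l))\<bar> \<le> weight i j \<epsilon> m * \<bar>ln (cmod (t m))\<bar> + C"
proof -
  let ?c = "weight i j \<epsilon>"
  let ?e = "\<lambda>x. x = l"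
  obtain C1 where C1: "\<And>t \<gamma>. t \<in> Pos \<Longrightarrow> \<gamma> \<in> \<Gamma> \<Longrightarrow> norm (gmult (diag t) (gmult (rational q) \<gamma>)) \<le> r \<Longrightarrow>
    ?c l * ln (cmod (t l)) + ?c m * \<bar>ln (cmod (t m))\<bar> \<ge> - C1"
    using coordinate_lower_bound[where r = r and q = q, OF ij u q lm] by blast
  obtain C2 where C2: "\<And>t \<gamma>. t \<in> Pos \<Longrightarrow> \<gamma> \<in> \<Gamma> \<Longrightarrow>
    norm (gmult (diag t) (gmult (rational (twist ?e q)) \<gamma>)) \<le> CARD('i) * (4 * r) \<Longrightarrow>
    ?c l * ln (cmod (t l)) + ?c m * \<bar>ln (cmod (t m))\<bar> \<ge> - C2"
    using coordinate_lower_bound[where r = "CARD('i) * (4 * r)" and q = "twist ?e q", OF ij u _ lm] q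
    by (auto simp: twist_simps)
  have "?c l * \<bar>ln (cmod (t l))\<bar> \<le> ?c m * \<bar>ln (cmod (t m))\<bar> + max C1 C2"
    if t: "t \<in> Pos" "\<gamma> \<in> \<Gamma>" "norm (gmult (diag t) (gmult (rational q) \<gamma>)) \<le> r" for t \<gamma>
  proof -
    have "?c l * ln (cmod (t l)) + ?c m * \<bar>ln (cmod (t m))\<bar> \<ge> - C1" by (rule C1[OF t])
    moreover have "?c l * (- ln (cmod (t l))) + ?c m * \<bar>ln (cmod (t m))\<bar> \<ge> - C2"
      using C2[OF flip_Pos[OF t(1)] t(2) bounded_twist[OF t(1,3)]] lm by (simp add: ln_flip[OF t(1)])
    ultimately show ?thesis by (cases "ln (cmod (t l)) \<ge> 0") (auto simp: max_def)
  qed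
  then show ?thesis by blast
qed

text \<open>
  Given a sequence in the orbit that converges modulo the lattice, either its diagonal parts have a bounded subsequence,
  or both coordinates tend to zero or infinity along one of the four sign patterns \<open>e\<close>. In that direction
  the second rows do not coincide, since this would contradict \<open>coincident_lower_bound\<close>.
\<close>
lemma closure_dcoset_cases:
  assumes ij: "i \<noteq> j" and q: "\<And>l. det (q l) = 1" and x: "x \<in> closure (dcoset (rational q))"
  shows "x \<in> dcoset (rational q) \<or>
    (\<exists>e. rel i j (twist e q) $ 2 $ 1 \<noteq> 0 \<and> x \<in> dcoset (rational (untwist e (limit i j (twist e q)))))"
proof -
  obtain \<epsilon> where u: "unit_at i j \<epsilon>" using unit_at_exists[OF ij] by blast
  let ?c = "weight i j \<epsilon>"
  have c: "?c l > 0" for l using weight_pos[OF u] .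
  obtain X where X: "\<And>n. X n \<in> dcoset (rational q)" "X \<longlonglongrightarrow> x" using x unfolding closure_sequential by blast
  have "\<exists>t \<gamma>. t \<in> Pos \<and> \<gamma> \<in> \<Gamma> \<and> X n = gmult (diag t) (gmult (rational q) \<gamma>)" for n
    using X(1)[of n] by (auto simp: dcoset_def D_eq)
  then obtain t \<gamma> where t: "\<And>n. t n \<in> Pos" and \<gamma>: "\<And>n. \<gamma> n \<in> \<Gamma>"
    and Xn: "\<And>n. X n = gmult (diag (t n)) (gmult (rational q) (\<gamma> n))" by metis
  have "Bseq X" using X(2) by (intro convergent_imp_Bseq convergentI)
  then obtain r where "\<And>n. norm (X n) \<le> r" by (auto simp: Bseq_def)
  then have r: "\<And>n. norm (gmult (diag (t n)) (gmult (rational q) (\<gamma> n))) \<le> r" by (simp add: Xn)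
  define \<rho> where "\<rho> n l = ln (cmod (t n l))" for n l
  obtain C1 where C1: "\<And>n. ?c i * \<bar>\<rho> n i\<bar> \<le> ?c j * \<bar>\<rho> n j\<bar> + C1"
    using coordinates_comparable[where r = r and q = q, OF ij u q ij] t \<gamma> r unfolding \<rho>_def by blast
  obtain C2 where C2: "\<And>n. ?c j * \<bar>\<rho> n j\<bar> \<le> ?c i * \<bar>\<rho> n i\<bar> + C2"
    using coordinates_comparable[where r = r and q = q, OF ij u q ij[symmetric]] t \<gamma> r unfolding \<rho>_def by blast
  show ?thesis
  proof (cases "\<exists>B. infinite {n. \<bar>\<rho> n i\<bar> \<le> B}")
    case True
    then obtain B where "infinite {n. \<bar>\<rho> n i\<bar> \<le> B}" by blast
    from infinite_enumerate[OF this] obtain s :: "nat \<Rightarrow> nat" where "strict_mono s" "\<forall>n. s n \<in> {n. \<bar>\<rho> n i\<bar> \<le> B}" by blast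
    then have s: "strict_mono s" "\<And>n. \<bar>\<rho> (s n) i\<bar> \<le> B" by simp_all
    have "\<bar>\<rho> (s n) j\<bar> \<le> (?c i * B + C2) / ?c j" for n
    proof -
      have "?c j * \<bar>\<rho> (s n) j\<bar> \<le> ?c i * B + C2"
        using C2[of "s n"] mult_left_mono[OF s(2)[of n], of "?c i"] c[of i] by linarith
      then show ?thesis using c[of j] by (simp add: field_simps)
    qed
    then have "\<bar>ln (cmod (t (s n) l))\<bar> \<le> max B ((?c i * B + C2) / ?c j)" for n l
    proof -
      assume j: "\<bar>\<rho> (s n) j\<bar> \<le> (?c i * B + C2) / ?c j" for n
      have "l = i \<or> l = j" using UNIV_places[OF ij] by blast
      then show ?thesis using s(2)[of n] j[of n] unfolding \<rho>_def by auto
    qed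
    from Pos_bounded_subsequence[of "\<lambda>n. t (s n)", OF t this] obtain s' t' where
      s': "strict_mono s'" "t' \<in> Pos" "\<And>l. (\<lambda>n. t (s (s' n)) l) \<longlonglongrightarrow> t' l" by blast
    have "(\<lambda>n. X (s (s' n))) \<longlonglongrightarrow> x"
      using LIMSEQ_subseq_LIMSEQ[OF LIMSEQ_subseq_LIMSEQ[OF X(2) s(1)] s'(1)] by (simp add: comp_def)
    then have "x \<in> dcoset (rational q)"
      using t \<gamma> s' rational_G[of q] q unfolding Xn
      by (intro limit_in_dcoset[where t = "\<lambda>n. t (s (s' n))" and y = "\<lambda>n. rational q" and \<gamma> = "\<lambda>n. \<gamma> (s (s' n))" and t' = t']) auto
    then show ?thesis by blast
  next
    case False
    then have fin: "finite {n. \<bar>\<rho> n i\<bar> \<le> B}" for B by blast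
    have "finite (range (\<lambda>n l. \<rho> n l > 0))" by (rule finite_subset[of _ "UNIV :: ('i \<Rightarrow> bool) set"]) auto
    then obtain n0 where "infinite {n. (\<lambda>l. \<rho> n l > 0) = (\<lambda>l. \<rho> n0 l > 0)}"
      using pigeonhole_infinite[of "UNIV :: nat set" "\<lambda>n l. \<rho> n l > 0"] by auto
    then obtain e where e: "infinite {n. (\<lambda>l. \<rho> n l > 0) = e}" by blast
    from infinite_enumerate[OF this] obtain s :: "nat \<Rightarrow> nat" where "strict_mono s" "\<forall>n. s n \<in> {n. (\<lambda>l. \<rho> n l > 0) = e}" by blast
    then have s: "strict_mono s" "\<And>n. (\<lambda>l. \<rho> (s n) l > 0) = e" by simp_all
    have sgn: "ln (cmod (flip e (t (s n)) l)) = - \<bar>\<rho> (s n) l\<bar>" for n l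
      using fun_cong[OF s(2)[of n], of l] by (auto simp: ln_flip[OF t] \<rho>_def)
    have big: "\<forall>\<^sub>F n in sequentially. B < \<bar>\<rho> (s n) i\<bar>" for B
    proof -
      have "finite (s -` {n. \<bar>\<rho> n i\<bar> \<le> B})"
        by (rule finite_vimageI[OF fin]) (use s(1) strict_mono_imp_inj_on in blast)
      then have "finite {n. \<not> B < \<bar>\<rho> (s n) i\<bar>}" by (simp add: vimage_def not_less)
      then show ?thesis unfolding cofinite_eq_sequentially[symmetric] eventually_cofinite .
    qed
    let ?q = "twist e q"
    have dq: "det (?q l) = 1" for l by (simp add: twist_simps q)
    have rel: "rel i j ?q $ 2 $ 1 \<noteq> 0"
    proof
      assume "rel i j ?q $ 2 $ 1 = 0"
      then obtain C where C: "\<And>t \<gamma>. t \<in> Pos \<Longrightarrow> \<gamma> \<in> \<Gamma> \<Longrightarrow> norm (gmult (diag t) (gmult (rational ?q) \<gamma>)) \<le> CARD('i) * (4 * r) \<Longrightarrow>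
          ?c i * ln (cmod (t i)) + ?c j * ln (cmod (t j)) \<ge> - C"
        using coincident_lower_bound[where r = "CARD('i) * (4 * r)" and q = ?q, OF ij u dq] by blast
      have "?c i * \<bar>\<rho> (s n) i\<bar> \<le> C" for n
      proof -
        have "?c i * (- \<bar>\<rho> (s n) i\<bar>) + ?c j * (- \<bar>\<rho> (s n) j\<bar>) \<ge> - C"
          using C[of "flip e (t (s n))" "\<gamma> (s n)", OF flip_Pos[OF t] \<gamma> bounded_twist[OF t r]] unfolding sgn by simp
        moreover have "?c j * \<bar>\<rho> (s n) j\<bar> \<ge> 0" using c[of j] by simp
        ultimately show ?thesis by simp
      qed
      then have "\<bar>\<rho> (s n) i\<bar> \<le> C / ?c i" for n using c[of i] by (simp add: field_simps)
      then show False using big[of "C / ?c i"] by (simp add: not_less[symmetric])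
    qed
    have "gmult (weyl_at e) x \<in> dcoset (rational (limit i j ?q))"
    proof (rule limit_of_contracting[OF ij dq rel u, where t = "\<lambda>n. flip e (t (s n))" and \<gamma> = "\<lambda>n. \<gamma> (s n)"])
      show "flip e (t (s n)) \<in> Pos" "\<gamma> (s n) \<in> \<Gamma>" for n by (intro flip_Pos t, rule \<gamma>)
      have "(\<lambda>n. gmult (weyl_at e) (X (s n))) \<longlonglongrightarrow> gmult (weyl_at e) x"
        using LIMSEQ_subseq_LIMSEQ[OF X(2) s(1)] by (intro tendsto_gmult tendsto_const) (simp add: comp_def)
      then show "(\<lambda>n. gmult (diag (flip e (t (s n)))) (gmult (rational ?q) (\<gamma> (s n)))) \<longlonglongrightarrow> gmult (weyl_at e) x"
        unfolding Xn by (simp add: weyl_at_diag(1)[OF t] twist_simps gmult_assoc)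
      show "ln (cmod (flip e (t (s n)) i)) \<le> 0" for n by (simp add: sgn)
      show "filterlim (\<lambda>n. ln (cmod (flip e (t (s n)) i))) at_bot sequentially"
        unfolding sgn filterlim_at_bot
      proof
        fix Z :: real
        show "\<forall>\<^sub>F n in sequentially. - \<bar>\<rho> (s n) i\<bar> \<le> Z"
          by (rule eventually_mono[OF big[of "- Z"]]) simp
      qed
      show "\<bar>?c i * ln (cmod (flip e (t (s n)) i)) - ?c j * ln (cmod (flip e (t (s n)) j))\<bar> \<le> max C1 C2" for n
        unfolding sgn using C1[of "s n"] C2[of "s n"] by (simp add: abs_le_iff max_def)
    qed
    then have "x \<in> dcoset (rational (untwist e (limit i j ?q)))"
      using weyl_inv_at_dcoset[of "gmult (weyl_at e) x" _ e] by (simp add: weyl_inv_at_weyl_at twist_simps)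
    then show ?thesis using rel by blast
  qed
qed

lemma limit_in_closure:
  assumes ij: "i \<noteq> j" and q: "\<And>l. det (q l) = 1" and rel: "rel i j (twist e q) $ 2 $ 1 \<noteq> 0"
  shows "rational (untwist e (limit i j (twist e q))) \<in> closure (dcoset (rational q))"
proof -
  let ?q = "twist e q"
  have dq: "det (?q l) = 1" for l by (simp add: twist_simps q)
  obtain \<epsilon> where u: "unit_at i j \<epsilon>" using unit_at_exists[OF ij] by blast
  let ?P = "frame i j ?q"
  have dP: "det ?P = 1" by (rule frame_decomposition(1)[OF dq refl rel])
  obtain m where m: "m > 0" "\<And>n. adj2 ?P ** dg ((\<epsilon> ^ m) ^ n) ** ?P \<in> SLO" using unit_conjugate[OF u dP] by blast
  have \<eta>: "unit_at i j (\<epsilon> ^ m)" by (rule unit_at_power[OF u m(1)])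
  define y where "y n = gmult (diag (unit_diag i (\<epsilon> ^ m) n)) (gmult (rational ?q) (rational (\<lambda>_. adj2 ?P ** dg ((\<epsilon> ^ m) ^ n) ** ?P)))" for n
  have "y \<longlonglongrightarrow> rational (limit i j ?q)" unfolding y_def by (rule tendsto_limit[OF ij dq rel \<eta>])
  then have "(\<lambda>n. gmult (weyl_inv_at e) (y n)) \<longlonglongrightarrow> gmult (weyl_inv_at e) (rational (limit i j ?q))"
    by (intro tendsto_gmult tendsto_const)
  moreover have "gmult (weyl_inv_at e) (y n) \<in> dcoset (rational q)" for n
  proof -
    have "rational (\<lambda>_. adj2 ?P ** dg ((\<epsilon> ^ m) ^ n) ** ?P) \<in> \<Gamma>" using m(2) by (auto simp: \<Gamma>_eq)
    moreover have "diag (unit_diag i (\<epsilon> ^ m) n) \<in> D" using unit_diag_Pos[OF \<eta>] by (auto simp: D_eq)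
    ultimately have "y n \<in> dcoset (rational ?q)" unfolding y_def by (intro dcosetI)
    from weyl_inv_at_dcoset[OF this, of e] show ?thesis by (simp add: twist_simps weyl_inv_at_weyl_at)
  qed
  ultimately show ?thesis unfolding twist_simps(2) closure_sequential
    by (intro exI[of _ "\<lambda>n. gmult (weyl_inv_at e) (y n)"]) simp
qed

lemma dcoset_subset_closure:
  assumes "h \<in> closure (dcoset g)"
  shows "dcoset h \<subseteq> closure (dcoset g)"
proof
  fix x assume "x \<in> dcoset h"
  then obtain d \<gamma> where x: "d \<in> D" "\<gamma> \<in> \<Gamma>" "x = gmult d (gmult h \<gamma>)" by (auto simp: dcoset_def)
  obtain y where y: "\<And>n. y n \<in> dcoset g" "y \<longlonglongrightarrow> h" using assms unfolding closure_sequential by blast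
  have "(\<lambda>n. gmult d (gmult (y n) \<gamma>)) \<longlonglongrightarrow> x" unfolding x(3) by (intro tendsto_gmult tendsto_const y)
  moreover have "gmult d (gmult (y n) \<gamma>) \<in> dcoset g" for n by (rule dcoset_closed[OF y(1) x(1,2)])
  ultimately show "x \<in> closure (dcoset g)" unfolding closure_sequential
    by (intro exI[of _ "\<lambda>n. gmult d (gmult (y n) \<gamma>)"]) simp
qed

end


section \<open>Telling the limit orbits apart\<close>

context hilbert_rank2
begin

text \<open>
  The diagonal group and the lattice change \<open>rel\<close> only by diagonal factors on both sides, so
  its pattern of zero entries depends only on the orbit.
\<close>
lemma rel_dcoset:
  assumes q: "\<And>l. det (q l) = 1" and q': "\<And>l. det (q' l) = 1" and mem: "rational q' \<in> dcoset (rational q)"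
  shows "rel i j q' $ a $ b = 0 \<longleftrightarrow> rel i j q $ a $ b = 0"
proof -
  obtain t \<gamma> where t: "t \<in> Pos" "\<gamma> \<in> \<Gamma>" "rational q' = gmult (diag t) (gmult (rational q) \<gamma>)"
    using mem by (auto simp: dcoset_def D_eq)
  obtain A where A: "A \<in> SLO" "\<gamma> = rational (\<lambda>_. A)" using t(2) by (auto simp: \<Gamma>_eq)
  have dA: "det A = 1" using A(1) by (simp add: SL2_def)
  have "\<exists>n. n \<noteq> 0 \<and> q' l = dg n ** (q l ** A)" for l
  proof -
    let ?M = "q l ** A"
    have dM: "det ?M = 1" by (simp add: det_mul q dA)
    obtain n1 n2 n3 n4 where N: "q' l ** adj2 ?M = mk2 n1 n2 n3 n4" by (rule mk2_cases)
    have "\<sigma>m l (q' l) = dg (t l) ** \<sigma>m l ?M"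
      using arg_cong[OF t(3), of "\<lambda>x. x $ l"] by (simp add: A(2) \<sigma>m_mult)
    then have "\<sigma>m l (q' l ** adj2 ?M) = dg (t l) ** \<sigma>m l (?M ** adj2 ?M)"
      by (simp add: \<sigma>m_mult matrix_mul_assoc)
    also have "\<dots> = dg (t l)" by (simp add: adj2_inverse(2)[OF dM] mk2_one \<sigma>_simps(1,2)) (simp flip: mk2_one)
    finally have "n2 = 0" "n3 = 0" unfolding N by (simp_all add: eq_mk2_iff \<sigma>_simps(11))
    moreover have "det (q' l ** adj2 ?M) = 1" by (simp add: det_mul q' adj2_inverse(3)[OF dM])
    ultimately have n: "n1 * n4 = 1" unfolding N by simp
    then have "n1 \<noteq> 0" by auto
    then have N': "q' l ** adj2 ?M = dg n1" unfolding N using n \<open>n2 = 0\<close> \<open>n3 = 0\<close> by (simp add: eq_mk2_iff field_simps)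
    have "q' l = (q' l ** adj2 ?M) ** ?M" by (simp add: adj2_inverse(1)[OF dM] flip: matrix_mul_assoc)
    then show ?thesis using N' \<open>n1 \<noteq> 0\<close> by metis
  qed
  then obtain n where n: "\<And>l. n l \<noteq> 0" "\<And>l. q' l = dg (n l) ** (q l ** A)" by metis
  have "rel i j q' = dg (n j) ** (q j ** (A ** adj2 A) ** adj2 (q i)) ** adj2 (dg (n i))"
    unfolding rel_def n(2)[of i] n(2)[of j] adj2_mult by (simp add: matrix_mul_assoc)
  also have "\<dots> = dg (n j) ** rel i j q ** adj2 (dg (n i))"
    by (simp add: adj2_inverse(2)[OF dA] rel_def)
  finally have *: "rel i j q' = dg (n j) ** rel i j q ** adj2 (dg (n i))" .
  obtain k1 k2 k3 k4 where K: "rel i j q = mk2 k1 k2 k3 k4" by (rule mk2_cases)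
  show ?thesis using n(1)[of i] n(1)[of j] exhaust_2[of a] exhaust_2[of b] unfolding * K
    by (auto simp: mk2_mult)
qed

text \<open>
  So whether there is a limit in the direction \<open>e\<close> is decided by one entry of \<open>rel\<close>, a different one for each \<open>e\<close>.
\<close>
lemma rel_twist_21:
  "rel i j (twist e q) $ 2 $ 1 = 0 \<longleftrightarrow> rel i j q $ (if e j then 1 else 2) $ (if e i then 2 else 1) = 0"
proof -
  obtain a b c d where qi: "q i = mk2 a b c d" by (rule mk2_cases)
  obtain a' b' c' d' where qj: "q j = mk2 a' b' c' d'" by (rule mk2_cases)
  show ?thesis unfolding rel_def twist_def qi qj weyl_def by (auto simp: mk2_mult algebra_simps)
qed

definition monomial :: "'k^2^2 \<Rightarrow> bool" where
  "monomial A \<longleftrightarrow> (A $ 1 $ 1 = 0 \<and> A $ 2 $ 2 = 0) \<or> (A $ 1 $ 2 = 0 \<and> A $ 2 $ 1 = 0)"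

lemma rel_limit:
  assumes ij: "i \<noteq> j" and q: "\<And>l. det (q l) = 1" and rel: "rel i j q $ 2 $ 1 \<noteq> 0"
  shows "rel i j (limit i j q) = mk2 0 (- 1 / rel i j q $ 2 $ 1) (rel i j q $ 2 $ 1) 0"
proof -
  have "det (frame i j q) = 1" by (rule frame_decomposition(1)[OF q refl rel])
  from adj2_inverse(2)[OF this] show ?thesis
    using ij by (simp add: rel_def limit_def flip: matrix_mul_assoc)
qed

text \<open>
  For the contracting direction \<open>rel\<close> becomes antidiagonal, and each Weyl element exchanges the diagonal
  and antidiagonal patterns. So the pattern tells the directions with equal signs from the others.
\<close>
lemma rel_untwist_limit:
  assumes ij: "i \<noteq> j" and q: "\<And>l. det (q l) = 1" and rel: "rel i j (twist e q) $ 2 $ 1 \<noteq> 0"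
  shows "rel i j (untwist e (limit i j (twist e q))) $ 1 $ 1 = 0 \<longleftrightarrow> e i = e j"
    "monomial (rel i j (untwist e (limit i j (twist e q))))"
proof -
  let ?L = "limit i j (twist e q)"
  define K where "K = rel i j ?L"
  define \<delta> where "\<delta> = rel i j (twist e q) $ 2 $ 1"
  have \<delta>: "\<delta> \<noteq> 0" using rel by (simp add: \<delta>_def)
  have K: "K = mk2 0 (- 1 / \<delta>) \<delta> 0"
    unfolding K_def \<delta>_def by (rule rel_limit[OF ij _ rel]) (simp add: twist_simps q)
  have "rel i j (untwist e ?L) = (if e j then weyl_inv else mat 1) ** K ** adj2 (if e i then weyl_inv else mat 1)"
    unfolding K_def rel_def untwist_def by (auto simp: adj2_mult matrix_mul_assoc mk2_one) (simp_all flip: mk2_one)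
  then have R: "rel i j (untwist e ?L) = (if e j then weyl_inv else mat 1) ** mk2 0 (- 1 / \<delta>) \<delta> 0 ** adj2 (if e i then weyl_inv else mat 1)"
    unfolding K .
  show "rel i j (untwist e ?L) $ 1 $ 1 = 0 \<longleftrightarrow> e i = e j" "monomial (rel i j (untwist e ?L))"
    unfolding R weyl_inv_def mk2_one using \<delta> by (cases "e i"; cases "e j"; simp add: mk2_mult monomial_def)+
qed

text \<open>
  If \<open>rel\<close> is antidiagonal, the frame is \<open>q i\<close> itself, so the orbit is its own limit.
\<close>
lemma limit_eq_self:
  assumes ij: "i \<noteq> j" and q: "\<And>l. det (q l) = 1" and rel: "rel i j q $ 2 $ 1 \<noteq> 0" and mon: "monomial (rel i j q)"
  shows "limit i j q = q"
proof -
  define \<delta> where "\<delta> = rel i j q $ 2 $ 1"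
  have \<delta>: "\<delta> \<noteq> 0" using rel by (simp add: \<delta>_def)
  obtain k1 k2 k3 k4 where K: "rel i j q = mk2 k1 k2 k3 k4" by (rule mk2_cases)
  have "det (rel i j q) = 1" by (simp add: rel_def det_mul q adj2_inverse(3)[OF q])
  then have "rel i j q = mk2 0 (- 1 / \<delta>) \<delta> 0"
    using mon \<delta> unfolding K \<delta>_def monomial_def by (auto simp: eq_mk2_iff field_simps) (metis add.commute add_eq_0_iff mult.commute mult_minus_left)
  moreover have "q j = rel i j q ** q i"
    by (simp add: rel_def adj2_inverse(1)[OF q] flip: matrix_mul_assoc)
  ultimately have qj: "q j = mk2 0 (- 1 / \<delta>) \<delta> 0 ** q i" by simp
  obtain a b c d where qi: "q i = mk2 a b c d" by (rule mk2_cases)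
  have "frame i j q = q i"
    unfolding frame_def \<delta>_def[symmetric] qj qi mk2_mult using \<delta> by (simp add: eq_mk2_iff)
  show ?thesis
  proof
    fix l
    have "l = i \<or> l = j" using UNIV_places[OF ij] by blast
    then show "limit i j q l = q l"
      using ij \<open>frame i j q = q i\<close> qj by (auto simp: limit_def \<delta>_def[symmetric])
  qed
qed

lemma monomial_twist: "monomial (rel i j q) \<Longrightarrow> monomial (rel i j (twist e q))"
proof -
  obtain a b c d where qi: "q i = mk2 a b c d" by (rule mk2_cases)
  obtain a' b' c' d' where qj: "q j = mk2 a' b' c' d'" by (rule mk2_cases)
  show "monomial (rel i j q) \<Longrightarrow> monomial (rel i j (twist e q))"
    unfolding monomial_def rel_def twist_def qi qj weyl_def
    by (cases "e i"; cases "e j"; simp add: mk2_mult algebra_simps; elim disjE; simp add: eq_neg_iff_add_eq_0 algebra_simps)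
qed

lemma monomial_closed:
  assumes ij: "i \<noteq> j" and q: "\<And>l. det (q l) = 1" and mon: "monomial (rel i j q)"
  shows "closure (dcoset (rational q)) \<subseteq> dcoset (rational q)"
proof
  fix x assume "x \<in> closure (dcoset (rational q))"
  from closure_dcoset_cases[where q = q, OF ij q this] show "x \<in> dcoset (rational q)"
  proof (elim disjE exE conjE)
    fix e assume rel: "rel i j (twist e q) $ 2 $ 1 \<noteq> 0" and x: "x \<in> dcoset (rational (untwist e (limit i j (twist e q))))"
    have "limit i j (twist e q) = twist e q"
      by (rule limit_eq_self[OF ij _ rel monomial_twist[OF mon]]) (simp add: twist_simps q)
    then show ?thesis using x by (simp add: twist_simps)
  qed
qed

text \<open>
  Letting only the coordinate at \<open>i\<close> contract makes an integral vector arbitrarily short, which is impossible in a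
  compact set.
\<close>
lemma orbit_not_compact:
  fixes i j :: 'i
  assumes ij: "i \<noteq> j" and q: "\<And>l. det (q l) = 1"
  shows "\<not> compactin X (orbit D (proj \<sigma> (rational q)))"
proof
  assume "compactin X (orbit D (proj \<sigma> (rational q)))"
  then obtain r where r: "orbit D (proj \<sigma> (rational q)) \<subseteq> proj \<sigma> ` (G \<inter> ball 0 r)"
    using compactin_bounded by blast
  obtain \<epsilon> where u: "unit_at i j \<epsilon>" using unit_at_exists[OF ij] by blast
  let ?c = "weight i j \<epsilon>"
  obtain C where C: "\<And>t \<gamma>. t \<in> Pos \<Longrightarrow> \<gamma> \<in> \<Gamma> \<Longrightarrow> norm (gmult (diag t) (gmult (rational q) \<gamma>)) \<le> r \<Longrightarrow>
    ?c i * ln (cmod (t i)) + ?c j * \<bar>ln (cmod (t j))\<bar> \<ge> - C"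
    using coordinate_lower_bound[where r = r and q = q, OF ij u q ij] by blast
  have b: "real k * (?c i * ln 2) \<le> C" for k
  proof -
    let ?t = "dilation i k"
    have t: "?t \<in> Pos"
      using pos_simps(1) pos_simps(6)[of "1 / 2 ^ k"] by (auto simp: Pos_def dilation_def)
    then have "proj \<sigma> (gmult (diag ?t) (rational q)) \<in> orbit D (proj \<sigma> (rational q))"
      unfolding orbit_def translate_proj[symmetric] D_eq by blast
    then obtain y where y: "norm y < r" "proj \<sigma> y = proj \<sigma> (gmult (diag ?t) (rational q))" using r by force
    then obtain \<gamma> where "\<gamma> \<in> \<Gamma>" "y = gmult (diag ?t) (gmult (rational q) \<gamma>)"
      unfolding proj_eq_iff by (auto simp: gmult_assoc)
    from C[OF t this(1)] y(1) this(2) have "?c i * ln (cmod (?t i)) + ?c j * \<bar>ln (cmod (?t j))\<bar> \<ge> - C" by simp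
    then show ?thesis using ij by (simp add: dilation_def norm_divide norm_power ln_div ln_realpow algebra_simps)
  qed
  have "?c i * ln 2 > 0" using weight_pos[OF u, of i] by simp
  then obtain k :: nat where "real k * (?c i * ln 2) > C" using reals_Archimedean3 by blast
  then show False using b[of k] by linarith
qed

lemma orbit_eq_imp_dcoset:
  assumes "orbit D (proj \<sigma> g) = orbit D (proj \<sigma> h)"
  shows "g \<in> dcoset h"
proof (rule proj_mem_dcoset)
  have "proj \<sigma> g \<in> proj \<sigma> ` dcoset g" by (rule imageI) (rule dcoset_self)
  then show "proj \<sigma> g \<in> proj \<sigma> ` dcoset h" using assms unfolding orbit_eq by simp
qed

text \<open>
  As \<open>rel\<close> is not monomial, it has a nonzero diagonal entry and a nonzero antidiagonal entry; the
  corresponding limit orbits are distinguished by their patterns. Since the limit orbits have monomial \<open>rel\<close>, they are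
  closed and different from the given orbit.
\<close>
lemma orbit_closure_structure:
  assumes g: "g \<in> G" and ld: "locally_divergent \<sigma> g" and nc: "\<not> closedin X (orbit D (proj \<sigma> g))"
  shows "\<exists>\<O> :: (complex^2^2^'i) set set set. finite \<O> \<and> 2 \<le> card \<O> \<and> card \<O> \<le> 4 \<and>
    X closure_of orbit D (proj \<sigma> g) - orbit D (proj \<sigma> g) = \<Union>\<O> \<and>
    (\<forall>A\<in>\<O>. \<exists>h\<in>G. A = orbit D (proj \<sigma> h) \<and> closedin X A \<and> \<not> compactin X A)"
proof -
  obtain i j :: 'i where ij: "i \<noteq> j" using rank by (auto simp: card_2_iff)
  obtain t q where tq: "t \<in> Pos" "\<And>l. det (q l) = 1" "g = gmult (diag t) (rational q)"
    using locally_divergent_rational[OF g ld] by blast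
  note q = tq(2)
  have "g \<in> dcoset (rational q)"
    using dcosetI[OF _ gone_\<Gamma>, of "diag t" "rational q"] tq(1) by (simp add: tq(3) D_eq)
  from dcoset_eq[OF this] have dg: "dcoset g = dcoset (rational q)" .
  have nm: "\<not> monomial (rel i j q)"
    using monomial_closed[where q = q, OF ij q] nc closedin_orbit[OF g] unfolding dg by blast
  define E where "E = {e. rel i j (twist e q) $ 2 $ 1 \<noteq> 0}"
  define L where "L e = untwist e (limit i j (twist e q))" for e
  have dL: "det (L e l) = 1" if "e \<in> E" for e l
    unfolding L_def twist_simps(5) by (rule det_limit) (use that in \<open>simp_all add: E_def twist_simps q\<close>)
  have relL: "rel i j (L e) $ 1 $ 1 = 0 \<longleftrightarrow> e i = e j" "monomial (rel i j (L e))" if "e \<in> E" for e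
    using rel_untwist_limit[where q = q and e = e, OF ij q] that by (simp_all add: L_def E_def)
  have cl: "closure (dcoset (rational q)) = dcoset (rational q) \<union> (\<Union>e\<in>E. dcoset (rational (L e)))"
  proof (intro equalityI subsetI)
    fix x assume "x \<in> closure (dcoset (rational q))"
    from closure_dcoset_cases[where q = q, OF ij q this] show "x \<in> dcoset (rational q) \<union> (\<Union>e\<in>E. dcoset (rational (L e)))"
      by (auto simp: E_def L_def)
  next
    fix x assume "x \<in> dcoset (rational q) \<union> (\<Union>e\<in>E. dcoset (rational (L e)))"
    then show "x \<in> closure (dcoset (rational q))"
      using closure_subset dcoset_subset_closure[OF limit_in_closure[where q = q, OF ij q]] by (auto simp: E_def L_def)
  qed
  have disj: "dcoset (rational (L e)) \<inter> dcoset (rational q) = {}" if e: "e \<in> E" for e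
  proof (rule ccontr)
    assume "dcoset (rational (L e)) \<inter> dcoset (rational q) \<noteq> {}"
    then have "dcoset (rational (L e)) = dcoset (rational q)" using dcoset_eq by blast
    then have "rational (L e) \<in> dcoset (rational q)" using dcoset_self by blast
    from rel_dcoset[where q = q and q' = "L e", OF q dL[OF e] this] have "monomial (rel i j q)"
      using relL(2)[OF e] by (simp add: monomial_def)
    then show False using nm by simp
  qed
  define orb where "orb e = orbit D (proj \<sigma> (rational (L e)))" for e
  have finE: "finite E" by (rule finite_subset[of _ UNIV]) auto
  have "card (orb ` E) \<le> card E" by (rule card_image_le[OF finE])
  also have "card E \<le> card (UNIV :: ('i \<Rightarrow> bool) set)" by (rule card_mono) auto
  also have "\<dots> = 4" by (simp add: card_fun rank)
  finally have le4: "card (orb ` E) \<le> 4" .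
  have "\<exists>e1\<in>E. \<exists>e2\<in>E. e1 i = e1 j \<and> e2 i \<noteq> e2 j"
  proof -
    have "(\<lambda>_. False) \<in> E \<or> (\<lambda>_. True) \<in> E" "(\<lambda>x. x = i) \<in> E \<or> (\<lambda>x. x = j) \<in> E"
      using nm ij unfolding E_def mem_Collect_eq rel_twist_21 monomial_def by auto
    then show ?thesis using ij by (metis (full_types))
  qed
  then obtain e1 e2 where e: "e1 \<in> E" "e2 \<in> E" "e1 i = e1 j" "e2 i \<noteq> e2 j" by blast
  have "orb e1 \<noteq> orb e2"
  proof
    assume "orb e1 = orb e2"
    then have "rational (L e1) \<in> dcoset (rational (L e2))" unfolding orb_def by (rule orbit_eq_imp_dcoset)
    from rel_dcoset[where q = "L e2" and q' = "L e1", OF dL[OF e(2)] dL[OF e(1)] this, of i j 1 1] show False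
      using relL(1)[OF e(1)] relL(1)[OF e(2)] e by simp
  qed
  then have "card {orb e1, orb e2} = 2" by simp
  moreover have "card {orb e1, orb e2} \<le> card (orb ` E)" using e finE by (intro card_mono) auto
  ultimately have ge2: "2 \<le> card (orb ` E)" by simp
  have "X closure_of orbit D (proj \<sigma> g) - orbit D (proj \<sigma> g) = \<Union> (orb ` E)"
  proof -
    have "X closure_of orbit D (proj \<sigma> g) - orbit D (proj \<sigma> g)
        = proj \<sigma> ` (dcoset (rational q) \<union> (\<Union>e\<in>E. dcoset (rational (L e)))) - proj \<sigma> ` dcoset (rational q)"
      unfolding closure_of_orbit[OF g] unfolding orbit_eq dg cl ..
    also have "\<dots> = (\<Union>e\<in>E. proj \<sigma> ` dcoset (rational (L e)))"
      using disj proj_mem_dcoset by blast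
    finally show ?thesis by (simp add: orb_def orbit_eq)
  qed
  moreover have "\<exists>h\<in>G. A = orbit D (proj \<sigma> h) \<and> closedin X A \<and> \<not> compactin X A" if A: "A \<in> orb ` E" for A
  proof -
    obtain e where e: "e \<in> E" "A = orbit D (proj \<sigma> (rational (L e)))" using A by (auto simp: orb_def)
    have "rational (L e) \<in> G" by (intro rational_G dL e)
    then show ?thesis
      using closedin_orbit[OF _ monomial_closed[where q = "L e", OF ij dL[OF e(1)] relL(2)[OF e(1)]]]
        orbit_not_compact[where q = "L e", OF ij dL[OF e(1)]] e(2) by blast
  qed
  ultimately show ?thesis using finE le4 ge2 by (intro exI[of _ "orb ` E"]) blast
qed

end

theorem corollary1p3:
  fixes \<sigma> :: "'i::finite \<Rightarrow> 'k::field_char_0 \<Rightarrow> complex"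
    and g :: "complex^2^2^'i"
  assumes "number_field TYPE('k)"
    and "archimedean_completions \<sigma>"
    and "CARD('i) = 2"
    and "g \<in> hilbert_group \<sigma>"
    and "locally_divergent \<sigma> g"
  shows "closedin (hilbert_modular_space \<sigma>) (orbit (D_group \<sigma>) (proj \<sigma> g)) \<or>
    (\<exists>(s::nat) (h :: nat \<Rightarrow> complex^2^2^'i). 2 \<le> s \<and> s \<le> 4 \<and>
       (\<forall>i\<in>{1..s}. h i \<in> hilbert_group \<sigma>) \<and>
       (hilbert_modular_space \<sigma> closure_of orbit (D_group \<sigma>) (proj \<sigma> g))
           - orbit (D_group \<sigma>) (proj \<sigma> g)
         = (\<Union>i\<in>{1..s}. orbit (D_group \<sigma>) (proj \<sigma> (h i))) \<and>
       (\<forall>i\<in>{1..s}. \<forall>j\<in>{1..s}. i \<noteq> j \<longrightarrow>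
          orbit (D_group \<sigma>) (proj \<sigma> (h i)) \<noteq> orbit (D_group \<sigma>) (proj \<sigma> (h j))) \<and>
       (\<forall>i\<in>{1..s}. closedin (hilbert_modular_space \<sigma>) (orbit (D_group \<sigma>) (proj \<sigma> (h i))) \<and>
          \<not> compactin (hilbert_modular_space \<sigma>) (orbit (D_group \<sigma>) (proj \<sigma> (h i)))))"
proof -
  interpret hilbert_rank2 \<sigma> by unfold_locales (rule assms)+
  show ?thesis
  proof (cases "closedin X (orbit D (proj \<sigma> g))")
    case True
    then show ?thesis ..
  next
    case False
    then obtain \<O> :: "(complex^2^2^'i) set set set" where O: "finite \<O>" "2 \<le> card \<O>" "card \<O> \<le> 4"
      "X closure_of orbit D (proj \<sigma> g) - orbit D (proj \<sigma> g) = \<Union>\<O>"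
      "\<And>A. A \<in> \<O> \<Longrightarrow> \<exists>h\<in>G. A = orbit D (proj \<sigma> h) \<and> closedin X A \<and> \<not> compactin X A"
      using orbit_closure_structure[OF assms(4,5)] by blast
    obtain b where b: "bij_betw b {1..card \<O>} \<O>" using ex_bij_betw_nat_finite_1[OF O(1)] by blast
    have "\<exists>h. h \<in> G \<and> b n = orbit D (proj \<sigma> h) \<and> closedin X (b n) \<and> \<not> compactin X (b n)" if "n \<in> {1..card \<O>}" for n
      using O(5)[of "b n"] bij_betwE[OF b] that by blast
    then obtain h where h: "\<And>n. n \<in> {1..card \<O>} \<Longrightarrow> h n \<in> G \<and> b n = orbit D (proj \<sigma> (h n)) \<and> closedin X (b n) \<and> \<not> compactin X (b n)"
      by metis
    have inj: "inj_on b {1..card \<O>}" and img: "b ` {1..card \<O>} = \<O>" using b by (auto simp: bij_betw_def)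
    have "\<Union>\<O> = \<Union> (b ` {1..card \<O>})" by (simp only: img)
    also have "\<dots> = (\<Union>n\<in>{1..card \<O>}. orbit D (proj \<sigma> (h n)))" by (rule SUP_cong) (use h in blast)+
    finally have "\<Union>\<O> = (\<Union>n\<in>{1..card \<O>}. orbit D (proj \<sigma> (h n)))" .
    moreover have "\<forall>n\<in>{1..card \<O>}. \<forall>m\<in>{1..card \<O>}. n \<noteq> m \<longrightarrow> orbit D (proj \<sigma> (h n)) \<noteq> orbit D (proj \<sigma> (h m))"
      using h inj by (metis inj_onD)
    moreover have "\<forall>n\<in>{1..card \<O>}. h n \<in> G"
      "\<forall>n\<in>{1..card \<O>}. closedin X (orbit D (proj \<sigma> (h n))) \<and> \<not> compactin X (orbit D (proj \<sigma> (h n)))"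
      using h by metis+
    ultimately have "\<exists>(s::nat) (h :: nat \<Rightarrow> complex^2^2^'i). 2 \<le> s \<and> s \<le> 4 \<and>
       (\<forall>i\<in>{1..s}. h i \<in> G) \<and>
       (X closure_of orbit D (proj \<sigma> g)) - orbit D (proj \<sigma> g) = (\<Union>i\<in>{1..s}. orbit D (proj \<sigma> (h i))) \<and>
       (\<forall>i\<in>{1..s}. \<forall>j\<in>{1..s}. i \<noteq> j \<longrightarrow> orbit D (proj \<sigma> (h i)) \<noteq> orbit D (proj \<sigma> (h j))) \<and>
       (\<forall>i\<in>{1..s}. closedin X (orbit D (proj \<sigma> (h i))) \<and> \<not> compactin X (orbit D (proj \<sigma> (h i))))"
      using O(2,3,4) by (intro exI[of _ "card \<O>"] exI[of _ h]) simp
    then show ?thesis ..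
  qed
qed

end
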